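(* Let $\mathbf{C}$ be a category with finite limits and coequalisers, such that coequalisers are preserved by the functors $C\times(-)$ for all $C\in\mathbf{C}$, and assume that $\mathbf{C}$ satisfies $\mathrm{OST}$. Let $G\in\mathrm{Grp}(\mathbf{C})$ and let $X$ be a connected $G$-graph in $\mathbf{C}$ such that the quotient map $q\colon X\to G\backslash X$ has a fixed section $s$ in $\mathrm{Graph}(\mathbf{C})$. Assume that the diagonal functor $\Delta\colon\mathrm{Grp}(\mathbf{C})\to\mathrm{Grp}(\mathrm{Graph}(\mathbf{C})_{/(G\backslash X)})$ has a left adjoint $\operatorname{colim}$, let $\pi=\operatorname{colim}s^*G_X$, let $T=T(s^*G_X)$ be the standard graph, and let $\varphi\colon\pi\to G$ and $\Phi\colon T\to X$ be the canonical maps. Assume moreover that $T$ is connected and that the canonical action of $\operatorname{Ker}\varphi$ on $T$ is free. Then the following are equivalent. (i) The map $\Phi\colon T\to X$ has a section in $\mathrm{Graph}(\mathbf{C})$. (ii) The map $\Phi\colon T\to X$ is an isomorphism in $\mathrm{Graph}(\mathbf{C})$. (iii) The map $\varphi\colon\pi\to G$ is an isomorphism in $\mathbf{C}$ (and hence in $\mathrm{Grp}(\mathbf{C})$).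
   Context: Basic notation. $\mathrm{Grp}(\mathbf{C})$ is the category of group objects in $\mathbf{C}$, with structure maps $m_G,i_G,e_G$; $*$ is the terminal object. $\mathrm{Graph}(\mathbf{C})$ is the category of internal directed graphs $X=(d_0,d_1\colon EX\rightrightarrows VX)$, i.e. functors from the parallel-pair category to $\mathbf{C}$; limits and colimits are computed on $E$ and $V$ separately. An object $C$ of $\mathbf{C}$ is also regarded as the constant graph $(C\rightrightarrows C)$, so $C\times X=(C\times EX\rightrightarrows C\times VX)$. A $G$-object is an object $X$ with a left action $a\colon G\times X\to X$; a $G$-graph is a graph with $G$-actions on $EX$ and $VX$ for which $d_0,d_1$ are equivariant, so there is an action map $a\colon G\times X\to X$ in $\mathrm{Graph}(\mathbf{C})$. The quotient $q\colon X\to G\backslash X$ is the coequaliser of $a,\mathrm{pr}_X\colon G\times X\rightrightarrows X$. The stabiliser $G_X$ is the equaliser of $a,\mathrm{pr}_X\colon G\times X\rightrightarrows X$; with its map to $X$ it is a group object in the slice category over $X$, with multiplication induced by $m_G$. The action is free if the canonical map $G_X\to X$ is an isomorphism. A graph $X$ is connected if the coequaliser of $d_0,d_1\colon EX\rightrightarrows VX$ is $*$. For a section $s\colon G\backslash X\to X$ of $q$, $s^*G_X$ is the pullback of $G_X\to X$ along $s$, a group object in the slice over $G\backslash X$. OST. $\mathbf{C}$ satisfies $\mathrm{OST}$ if for every $G\in\mathrm{Grp}(\mathbf{C})$ and every $G$-object $X\in\mathbf{C}$ the quotient $q\colon X\to G\backslash X$ exists and for every section $s\colon G\backslash X\to X$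 of $q$ the diagram $G\times s^*G_X\rightrightarrows G\times(G\backslash X)\xrightarrow{a\circ(\mathrm{id}_G\times s)}X$ is a coequaliser in $\mathbf{C}$, where the two parallel maps are $\mathrm{id}_G\times(s^*G_X\to G\backslash X)$ and $G\times s^*G_X\to G\times G_X\to G\times G\times X\xrightarrow{m_G\times q}G\times(G\backslash X)$. $\Delta$, $T$, $\varphi$, $\Phi$. For $Q\in\mathrm{Graph}(\mathbf{C})$, $\Delta\colon\mathrm{Grp}(\mathbf{C})\to\mathrm{Grp}(\mathrm{Graph}(\mathbf{C})_{/Q})$ is $H\mapsto H\times Q$. Put $Q=G\backslash X$, $\mathcal{G}=s^*G_X$, $\pi=\operatorname{colim}\mathcal{G}$ with unit $\mathcal{G}\to\Delta(\pi)$. The standard graph $T$ is the coequaliser in $\mathrm{Graph}(\mathbf{C})$ of the two maps $\pi\times\mathcal{G}\rightrightarrows\pi\times Q$ given by $\mathrm{id}_\pi\times(\mathcal{G}\to Q)$ and by $\pi\times\mathcal{G}\to\pi\times\Delta(\pi)=\pi\times\pi\times Q\xrightarrow{m_\pi\times\mathrm{id}_Q}\pi\times Q$; left multiplication on the factor $\pi$ induces an action of $\pi$ on $T$. The map $\varphi\colon\pi\to G$ is the adjoint of $s^*G_X\to G_X\to G\times X\xrightarrow{\mathrm{id}\times q}G\times(G\backslash X)=\Delta(G)$. The map $\Phi\colon T\to X$ is induced by $\pi\times(G\backslash X)\xrightarrow{\varphi\times\mathrm{id}}G\times(G\backslash X)\xrightarrow{a\circ(\mathrm{id}_G\times s)}X$.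 $\operatorname{Ker}\varphi$ is the equaliser of $\varphi$ and the trivial map $\pi\to*\xrightarrow{e_G}G$; it acts on $T$ through its inclusion into $\pi$. *)

theory Defs
  imports Main
begin

section \<open>Categories, limits and coequalisers\<close>

record ('o, 'm) cat =
  Ob :: "'o set"
  Ar :: "'m set"
  Dom :: "'m \<Rightarrow> 'o"
  Cod :: "'m \<Rightarrow> 'o"
  Idt :: "'o \<Rightarrow> 'm"
  Comp :: "'m \<Rightarrow> 'm \<Rightarrow> 'm" (infixr "\<cdot>\<index>" 75)

definition hom :: "('o, 'm, 'z) cat_scheme \<Rightarrow> 'o \<Rightarrow> 'o \<Rightarrow> 'm set" where
  "hom C A B = {f \<in> Ar C. Dom C f = A \<and> Cod C f = B}"

locale category =
  fixes C :: "('o, 'm, 'z) cat_scheme" (structure)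
  assumes dom_cod: "f \<in> Ar C \<Longrightarrow> Dom C f \<in> Ob C \<and> Cod C f \<in> Ob C"
    and id_hom: "A \<in> Ob C \<Longrightarrow> Idt C A \<in> hom C A A"
    and comp_hom: "\<lbrakk>f \<in> hom C A B; g \<in> hom C B D\<rbrakk> \<Longrightarrow> g \<cdot> f \<in> hom C A D"
    and comp_id_left: "f \<in> hom C A B \<Longrightarrow> Idt C B \<cdot> f = f"
    and comp_id_right: "f \<in> hom C A B \<Longrightarrow> f \<cdot> Idt C A = f"
    and comp_assoc: "\<lbrakk>f \<in> hom C A B; g \<in> hom C B D; h \<in> hom C D E\<rbrakk>
      \<Longrightarrow> (h \<cdot> g) \<cdot> f = h \<cdot> (g \<cdot> f)"

definition is_iso :: "('o, 'm, 'z) cat_scheme \<Rightarrow> 'm \<Rightarrow> bool" where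
  "is_iso C f \<longleftrightarrow> f \<in> Ar C \<and>
     (\<exists>g \<in> hom C (Cod C f) (Dom C f).
        g \<cdot>\<^bsub>C\<^esub> f = Idt C (Dom C f) \<and> f \<cdot>\<^bsub>C\<^esub> g = Idt C (Cod C f))"

definition is_section :: "('o, 'm, 'z) cat_scheme \<Rightarrow> 'm \<Rightarrow> 'm \<Rightarrow> bool" where
  "is_section C s f \<longleftrightarrow> f \<in> Ar C \<and> s \<in> hom C (Cod C f) (Dom C f) \<and>
     f \<cdot>\<^bsub>C\<^esub> s = Idt C (Cod C f)"

definition is_terminal :: "('o, 'm, 'z) cat_scheme \<Rightarrow> 'o \<Rightarrow> bool" where
  "is_terminal C Z \<longleftrightarrow> Z \<in> Ob C \<and> (\<forall>A \<in> Ob C. \<exists>!f. f \<in> hom C A Z)"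

definition is_product ::
  "('o, 'm, 'z) cat_scheme \<Rightarrow> 'o \<Rightarrow> 'o \<Rightarrow> 'o \<Rightarrow> 'm \<Rightarrow> 'm \<Rightarrow> bool" where
  "is_product C A B P p r \<longleftrightarrow> p \<in> hom C P A \<and> r \<in> hom C P B \<and>
     (\<forall>Y. \<forall>f \<in> hom C Y A. \<forall>g \<in> hom C Y B.
        \<exists>!h. h \<in> hom C Y P \<and> p \<cdot>\<^bsub>C\<^esub> h = f \<and> r \<cdot>\<^bsub>C\<^esub> h = g)"

definition parallel :: "('o, 'm, 'z) cat_scheme \<Rightarrow> 'm \<Rightarrow> 'm \<Rightarrow> bool" where
  "parallel C f g \<longleftrightarrow> f \<in> Ar C \<and> g \<in> hom C (Dom C f) (Cod C f)"

definition is_equaliser :: "('o, 'm, 'z) cat_scheme \<Rightarrow> 'm \<Rightarrow> 'm \<Rightarrow> 'm \<Rightarrow> bool" where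
  "is_equaliser C f g e \<longleftrightarrow> parallel C f g \<and> e \<in> Ar C \<and> Cod C e = Dom C f \<and>
     f \<cdot>\<^bsub>C\<^esub> e = g \<cdot>\<^bsub>C\<^esub> e \<and>
     (\<forall>h \<in> Ar C. Cod C h = Dom C f \<and> f \<cdot>\<^bsub>C\<^esub> h = g \<cdot>\<^bsub>C\<^esub> h \<longrightarrow>
        (\<exists>!k. k \<in> hom C (Dom C h) (Dom C e) \<and> e \<cdot>\<^bsub>C\<^esub> k = h))"

definition is_coequaliser :: "('o, 'm, 'z) cat_scheme \<Rightarrow> 'm \<Rightarrow> 'm \<Rightarrow> 'm \<Rightarrow> bool" where
  "is_coequaliser C f g q \<longleftrightarrow> parallel C f g \<and> q \<in> Ar C \<and> Dom C q = Cod C f \<and>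
     q \<cdot>\<^bsub>C\<^esub> f = q \<cdot>\<^bsub>C\<^esub> g \<and>
     (\<forall>h \<in> Ar C. Dom C h = Cod C f \<and> h \<cdot>\<^bsub>C\<^esub> f = h \<cdot>\<^bsub>C\<^esub> g \<longrightarrow>
        (\<exists>!k. k \<in> hom C (Cod C q) (Cod C h) \<and> k \<cdot>\<^bsub>C\<^esub> q = h))"

definition has_coequalisers :: "('o, 'm, 'z) cat_scheme \<Rightarrow> bool" where
  "has_coequalisers C \<longleftrightarrow> (\<forall>f g. parallel C f g \<longrightarrow> (\<exists>q. is_coequaliser C f g q))"

text \<open>
  Finite limits are carried as a choice of a terminal object, binary products and equalisers; the
  choice is arbitrary. The field \<open>eqz\<close> is the equaliser arrow, so its domain is the equaliser object.
\<close>

record ('o, 'm) pcat = "('o, 'm) cat" +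
  one :: 'o
  prd :: "'o \<Rightarrow> 'o \<Rightarrow> 'o"
  prl :: "'o \<Rightarrow> 'o \<Rightarrow> 'm"
  prr :: "'o \<Rightarrow> 'o \<Rightarrow> 'm"

record ('o, 'm) lcat = "('o, 'm) pcat" +
  eqz :: "'m \<Rightarrow> 'm \<Rightarrow> 'm"

locale finite_products = category C for C :: "('o, 'm, 'z) pcat_scheme" (structure) +
  assumes terminal_one: "is_terminal C (one C)"
    and product_prd: "\<lbrakk>A \<in> Ob C; B \<in> Ob C\<rbrakk>
      \<Longrightarrow> is_product C A B (prd C A B) (prl C A B) (prr C A B)"

locale finite_limits = finite_products C for C :: "('o, 'm, 'z) lcat_scheme" (structure) +
  assumes equaliser_eqz: "parallel C f g \<Longrightarrow> is_equaliser C f g (eqz C f g)"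

definition bang :: "('o, 'm, 'z) pcat_scheme \<Rightarrow> 'o \<Rightarrow> 'm" where
  "bang C A = (THE f. f \<in> hom C A (one C))"

definition pair :: "('o, 'm, 'z) pcat_scheme \<Rightarrow> 'm \<Rightarrow> 'm \<Rightarrow> 'm" where
  "pair C f g = (THE h. h \<in> hom C (Dom C f) (prd C (Cod C f) (Cod C g)) \<and>
     prl C (Cod C f) (Cod C g) \<cdot>\<^bsub>C\<^esub> h = f \<and> prr C (Cod C f) (Cod C g) \<cdot>\<^bsub>C\<^esub> h = g)"

definition cross :: "('o, 'm, 'z) pcat_scheme \<Rightarrow> 'm \<Rightarrow> 'm \<Rightarrow> 'm" where
  "cross C f g = pair C (f \<cdot>\<^bsub>C\<^esub> prl C (Dom C f) (Dom C g)) (g \<cdot>\<^bsub>C\<^esub> prr C (Dom C f) (Dom C g))"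

text \<open>The canonical isomorphism from \<open>A \<times> (B \<times> D)\<close> to \<open>(A \<times> B) \<times> D\<close>.\<close>

definition assoc :: "('o, 'm, 'z) pcat_scheme \<Rightarrow> 'o \<Rightarrow> 'o \<Rightarrow> 'o \<Rightarrow> 'm" where
  "assoc C A B D =
     (let x = prl C A (prd C B D); y = prr C A (prd C B D)
      in pair C (pair C x (prl C B D \<cdot>\<^bsub>C\<^esub> y)) (prr C B D \<cdot>\<^bsub>C\<^esub> y))"

definition eqlift :: "('o, 'm, 'z) lcat_scheme \<Rightarrow> 'm \<Rightarrow> 'm \<Rightarrow> 'm \<Rightarrow> 'm" where
  "eqlift C f g h = (THE k. k \<in> hom C (Dom C h) (Dom C (eqz C f g)) \<and> eqz C f g \<cdot>\<^bsub>C\<^esub> k = h)"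

text \<open>
  The pullback of \<open>p\<close> and \<open>r\<close> is the equaliser of the two composites from the product of their
  domains. Its projections are \<open>pbl\<close> (to the domain of \<open>p\<close>) and \<open>pbr\<close> (to the domain of \<open>r\<close>).
\<close>

definition pbeq :: "('o, 'm, 'z) lcat_scheme \<Rightarrow> 'm \<Rightarrow> 'm \<Rightarrow> 'm" where
  "pbeq C p r = eqz C (p \<cdot>\<^bsub>C\<^esub> prl C (Dom C p) (Dom C r)) (r \<cdot>\<^bsub>C\<^esub> prr C (Dom C p) (Dom C r))"

definition pbl :: "('o, 'm, 'z) lcat_scheme \<Rightarrow> 'm \<Rightarrow> 'm \<Rightarrow> 'm" where
  "pbl C p r = prl C (Dom C p) (Dom C r) \<cdot>\<^bsub>C\<^esub> pbeq C p r"

definition pbr :: "('o, 'm, 'z) lcat_scheme \<Rightarrow> 'm \<Rightarrow> 'm \<Rightarrow> 'm" where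
  "pbr C p r = prr C (Dom C p) (Dom C r) \<cdot>\<^bsub>C\<^esub> pbeq C p r"

definition pblift :: "('o, 'm, 'z) lcat_scheme \<Rightarrow> 'm \<Rightarrow> 'm \<Rightarrow> 'm \<Rightarrow> 'm \<Rightarrow> 'm" where
  "pblift C p r u v =
     (THE k. k \<in> hom C (Dom C u) (Dom C (pbeq C p r)) \<and>
        pbl C p r \<cdot>\<^bsub>C\<^esub> k = u \<and> pbr C p r \<cdot>\<^bsub>C\<^esub> k = v)"

definition products_preserve_coequalisers :: "('o, 'm, 'z) pcat_scheme \<Rightarrow> bool" where
  "products_preserve_coequalisers C \<longleftrightarrow>
     (\<forall>A \<in> Ob C. \<forall>f g q. is_coequaliser C f g q \<longrightarrow>
        is_coequaliser C (cross C (Idt C A) f) (cross C (Idt C A) g) (cross C (Idt C A) q))"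


section \<open>Functors and adjunctions\<close>

definition is_functor ::
  "('o, 'm, 'z) cat_scheme \<Rightarrow> ('p, 'n, 'y) cat_scheme \<Rightarrow> ('o \<Rightarrow> 'p) \<Rightarrow> ('m \<Rightarrow> 'n) \<Rightarrow> bool" where
  "is_functor A B Fo Fa \<longleftrightarrow>
     (\<forall>X \<in> Ob A. Fo X \<in> Ob B \<and> Fa (Idt A X) = Idt B (Fo X)) \<and>
     (\<forall>X Y. \<forall>f \<in> hom A X Y. Fa f \<in> hom B (Fo X) (Fo Y)) \<and>
     (\<forall>X Y Z. \<forall>f \<in> hom A X Y. \<forall>g \<in> hom A Y Z. Fa (g \<cdot>\<^bsub>A\<^esub> f) = Fa g \<cdot>\<^bsub>B\<^esub> Fa f)"

text \<open>
  \<open>left_adjoint A B Fo Fa Ro Ra unit\<close>: the functor \<open>(Fo, Fa)\<close> from \<open>A\<close> to \<open>B\<close> is left adjoint to the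
  functor \<open>(Ro, Ra)\<close> from \<open>B\<close> to \<open>A\<close>, with the given unit.
\<close>

definition left_adjoint ::
  "('o, 'm, 'z) cat_scheme \<Rightarrow> ('p, 'n, 'y) cat_scheme \<Rightarrow> ('o \<Rightarrow> 'p) \<Rightarrow> ('m \<Rightarrow> 'n) \<Rightarrow>
   ('p \<Rightarrow> 'o) \<Rightarrow> ('n \<Rightarrow> 'm) \<Rightarrow> ('o \<Rightarrow> 'm) \<Rightarrow> bool" where
  "left_adjoint A B Fo Fa Ro Ra unit \<longleftrightarrow>
     is_functor A B Fo Fa \<and> is_functor B A Ro Ra \<and>
     (\<forall>X \<in> Ob A. unit X \<in> hom A X (Ro (Fo X))) \<and>
     (\<forall>X Y. \<forall>f \<in> hom A X Y. unit Y \<cdot>\<^bsub>A\<^esub> f = Ra (Fa f) \<cdot>\<^bsub>A\<^esub> unit X) \<and>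
     (\<forall>X \<in> Ob A. \<forall>Y \<in> Ob B. \<forall>g \<in> hom A X (Ro Y).
        \<exists>!f. f \<in> hom B (Fo X) Y \<and> Ra f \<cdot>\<^bsub>A\<^esub> unit X = g)"


section \<open>Group objects and slices\<close>

record ('o, 'm) grp =
  carr :: 'o
  mul :: 'm
  inverse_map :: 'm
  unit_map :: 'm

definition group_object :: "('o, 'm, 'z) pcat_scheme \<Rightarrow> ('o, 'm) grp \<Rightarrow> bool" where
  "group_object C G \<longleftrightarrow>
     (let A = carr G; m = mul G; i = inverse_map G; e = unit_map G in
      A \<in> Ob C \<and> m \<in> hom C (prd C A A) A \<and> i \<in> hom C A A \<and> e \<in> hom C (one C) A \<and>
      m \<cdot>\<^bsub>C\<^esub> cross C m (Idt C A) \<cdot>\<^bsub>C\<^esub> assoc C A A A = m \<cdot>\<^bsub>C\<^esub> cross C (Idt C A) m \<and>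
      m \<cdot>\<^bsub>C\<^esub> pair C (e \<cdot>\<^bsub>C\<^esub> bang C A) (Idt C A) = Idt C A \<and>
      m \<cdot>\<^bsub>C\<^esub> pair C (Idt C A) (e \<cdot>\<^bsub>C\<^esub> bang C A) = Idt C A \<and>
      m \<cdot>\<^bsub>C\<^esub> pair C i (Idt C A) = e \<cdot>\<^bsub>C\<^esub> bang C A \<and>
      m \<cdot>\<^bsub>C\<^esub> pair C (Idt C A) i = e \<cdot>\<^bsub>C\<^esub> bang C A)"

text \<open>
  Morphisms of \<open>Grp\<close> and of slices are triples (source, underlying arrow, target); \<open>mid\<close> is the
  underlying arrow. A homomorphism is only required to respect the multiplications; compatibility with
  units and inverses follows.
\<close>

definition mid :: "'a \<times> 'b \<times> 'c \<Rightarrow> 'b" where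
  "mid t = fst (snd t)"

definition Grp :: "('o, 'm, 'z) pcat_scheme
    \<Rightarrow> (('o, 'm) grp, ('o, 'm) grp \<times> 'm \<times> ('o, 'm) grp) cat" where
  "Grp C =
     \<lparr>Ob = {G. group_object C G},
      Ar = {(G, f, H). group_object C G \<and> group_object C H \<and> f \<in> hom C (carr G) (carr H) \<and>
              f \<cdot>\<^bsub>C\<^esub> mul G = mul H \<cdot>\<^bsub>C\<^esub> cross C f f},
      Dom = (\<lambda>(G, f, H). G),
      Cod = (\<lambda>(G, f, H). H),
      Idt = (\<lambda>G. (G, Idt C (carr G), G)),
      Comp = (\<lambda>(H, g, K) (G, f, H'). (G, g \<cdot>\<^bsub>C\<^esub> f, K))\<rparr>"

definition slice :: "('o, 'm, 'z) lcat_scheme \<Rightarrow> 'o \<Rightarrow> ('m, 'm \<times> 'm \<times> 'm) pcat" where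
  "slice C X =
     \<lparr>Ob = {p \<in> Ar C. Cod C p = X},
      Ar = {(p, f, r). p \<in> Ar C \<and> Cod C p = X \<and> r \<in> Ar C \<and> Cod C r = X \<and>
              f \<in> hom C (Dom C p) (Dom C r) \<and> r \<cdot>\<^bsub>C\<^esub> f = p},
      Dom = (\<lambda>(p, f, r). p),
      Cod = (\<lambda>(p, f, r). r),
      Idt = (\<lambda>p. (p, Idt C (Dom C p), p)),
      Comp = (\<lambda>(r, g, t) (p, f, r'). (p, g \<cdot>\<^bsub>C\<^esub> f, t)),
      one = Idt C X,
      prd = (\<lambda>p r. p \<cdot>\<^bsub>C\<^esub> pbl C p r),
      prl = (\<lambda>p r. (p \<cdot>\<^bsub>C\<^esub> pbl C p r, pbl C p r, p)),
      prr = (\<lambda>p r. (p \<cdot>\<^bsub>C\<^esub> pbl C p r, pbr C p r, r))\<rparr>"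

text \<open>
  The group object \<open>H\<close> lives over the codomain of \<open>f\<close>. The structure maps of its base change are the
  ones that make the projection \<open>l\<close> to \<open>H\<close> multiplicative over \<open>f\<close>.
\<close>

definition pullback_grp ::
  "('o, 'm, 'z) lcat_scheme \<Rightarrow> 'm \<Rightarrow> ('m, 'm \<times> 'm \<times> 'm) grp \<Rightarrow> ('m, 'm \<times> 'm \<times> 'm) grp" where
  "pullback_grp C f H =
     (let p = carr H; Q = Dom C f; c = pbr C p f; l = pbl C p f;
          w = prd (slice C Q) c c; u = pbl C c c; v = pbr C c c
      in \<lparr>carr = c,
          mul = (w, pblift C p f
            (mid (mul H) \<cdot>\<^bsub>C\<^esub> pblift C p p (l \<cdot>\<^bsub>C\<^esub> u) (l \<cdot>\<^bsub>C\<^esub> v)) w, c),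
          inverse_map = (c, pblift C p f (mid (inverse_map H) \<cdot>\<^bsub>C\<^esub> l) c, c),
          unit_map = (Idt C Q, pblift C p f (mid (unit_map H) \<cdot>\<^bsub>C\<^esub> f) (Idt C Q), c)\<rparr>)"

text \<open>The group object \<open>H \<times> Q\<close> over \<open>Q\<close>, with multiplication \<open>(h, y) (k, y) = (h k, y)\<close>.\<close>

definition times_grp ::
  "('o, 'm, 'z) lcat_scheme \<Rightarrow> 'o \<Rightarrow> ('o, 'm) grp \<Rightarrow> ('m, 'm \<times> 'm \<times> 'm) grp" where
  "times_grp C Q H =
     (let l = prl C (carr H) Q; c = prr C (carr H) Q;
          w = prd (slice C Q) c c; u = pbl C c c; v = pbr C c c
      in \<lparr>carr = c,
          mul = (w, pair C (mul H \<cdot>\<^bsub>C\<^esub> pair C (l \<cdot>\<^bsub>C\<^esub> u) (l \<cdot>\<^bsub>C\<^esub> v)) w, c),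
          inverse_map = (c, pair C (inverse_map H \<cdot>\<^bsub>C\<^esub> l) c, c),
          unit_map = (Idt C Q, pair C (unit_map H \<cdot>\<^bsub>C\<^esub> bang C Q) (Idt C Q), c)\<rparr>)"

definition times_grp_map ::
  "('o, 'm, 'z) lcat_scheme \<Rightarrow> 'o \<Rightarrow> ('o, 'm) grp \<times> 'm \<times> ('o, 'm) grp \<Rightarrow>
   ('m, 'm \<times> 'm \<times> 'm) grp \<times> ('m \<times> 'm \<times> 'm) \<times> ('m, 'm \<times> 'm \<times> 'm) grp" where
  "times_grp_map C Q = (\<lambda>(H, f, K).
     (times_grp C Q H,
      (prr C (carr H) Q, cross C f (Idt C Q), prr C (carr K) Q),
      times_grp C Q K))"


section \<open>Actions, quotients and stabilisers\<close>

definition action ::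
  "('o, 'm, 'z) pcat_scheme \<Rightarrow> ('o, 'm) grp \<Rightarrow> 'o \<Rightarrow> 'm \<Rightarrow> bool" where
  "action C G X a \<longleftrightarrow> X \<in> Ob C \<and> a \<in> hom C (prd C (carr G) X) X \<and>
     a \<cdot>\<^bsub>C\<^esub> pair C (unit_map G \<cdot>\<^bsub>C\<^esub> bang C X) (Idt C X) = Idt C X \<and>
     a \<cdot>\<^bsub>C\<^esub> cross C (mul G) (Idt C X) \<cdot>\<^bsub>C\<^esub> assoc C (carr G) (carr G) X
       = a \<cdot>\<^bsub>C\<^esub> cross C (Idt C (carr G)) a"

definition is_quotient ::
  "('o, 'm, 'z) pcat_scheme \<Rightarrow> 'o \<Rightarrow> 'o \<Rightarrow> 'm \<Rightarrow> 'm \<Rightarrow> bool" where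
  "is_quotient C A X a q \<longleftrightarrow> is_coequaliser C a (prr C A X) q"

definition stab_incl :: "('o, 'm, 'z) lcat_scheme \<Rightarrow> 'o \<Rightarrow> 'o \<Rightarrow> 'm \<Rightarrow> 'm" where
  "stab_incl C A X a = eqz C a (prr C A X)"

definition stab_map :: "('o, 'm, 'z) lcat_scheme \<Rightarrow> 'o \<Rightarrow> 'o \<Rightarrow> 'm \<Rightarrow> 'm" where
  "stab_map C A X a = prr C A X \<cdot>\<^bsub>C\<^esub> stab_incl C A X a"

definition free_action :: "('o, 'm, 'z) lcat_scheme \<Rightarrow> 'o \<Rightarrow> 'o \<Rightarrow> 'm \<Rightarrow> bool" where
  "free_action C A X a \<longleftrightarrow> is_iso C (stab_map C A X a)"

text \<open>
  On generalised elements \<open>(g, x)\<close> with \<open>g x = x\<close>, the multiplication over \<open>X\<close> is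
  \<open>(g, x) (h, x) = (g h, x)\<close>.
\<close>

definition stab_grp ::
  "('o, 'm, 'z) lcat_scheme \<Rightarrow> ('o, 'm) grp \<Rightarrow> 'o \<Rightarrow> 'm \<Rightarrow> ('m, 'm \<times> 'm \<times> 'm) grp" where
  "stab_grp C G X a =
     (let A = carr G; c = stab_map C A X a; l = prl C A X \<cdot>\<^bsub>C\<^esub> stab_incl C A X a;
          w = prd (slice C X) c c; u = pbl C c c; v = pbr C c c;
          lift = eqlift C a (prr C A X)
      in \<lparr>carr = c,
          mul = (w, lift (pair C (mul G \<cdot>\<^bsub>C\<^esub> pair C (l \<cdot>\<^bsub>C\<^esub> u) (l \<cdot>\<^bsub>C\<^esub> v)) w), c),
          inverse_map = (c, lift (pair C (inverse_map G \<cdot>\<^bsub>C\<^esub> l) c), c),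
          unit_map = (Idt C X, lift (pair C (unit_map G \<cdot>\<^bsub>C\<^esub> bang C X) (Idt C X)), c)\<rparr>)"

text \<open>
  \<open>pbl C c s\<close> and \<open>pbr C c s\<close>, with \<open>c\<close> the map from the stabiliser to \<open>X\<close>, are the projections of
  the pullback along \<open>s\<close> to the stabiliser and to the quotient.
\<close>

definition OST :: "('o, 'm, 'z) lcat_scheme \<Rightarrow> bool" where
  "OST C \<longleftrightarrow>
     (\<forall>G X a. group_object C G \<and> action C G X a \<longrightarrow>
        (\<exists>q. is_quotient C (carr G) X a q) \<and>
        (\<forall>q s. is_quotient C (carr G) X a q \<and> is_section C s q \<longrightarrow>
           (let A = carr G; c = stab_map C A X a
            in is_coequaliser C
                 (cross C (Idt C A) (pbr C c s))
                 (cross C (mul G) q \<cdot>\<^bsub>C\<^esub> assoc C A A X \<cdot>\<^bsub>C\<^esub>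
                   cross C (Idt C A) (stab_incl C A X a) \<cdot>\<^bsub>C\<^esub> cross C (Idt C A) (pbl C c s))
                 (a \<cdot>\<^bsub>C\<^esub> cross C (Idt C A) s))))"


section \<open>Internal graphs\<close>

record ('o, 'm) graph =
  edges :: 'o
  verts :: 'o
  d0 :: 'm
  d1 :: 'm

record ('o, 'm) gmap =
  gsrc :: "('o, 'm) graph"
  gtgt :: "('o, 'm) graph"
  emap :: 'm
  vmap :: 'm

definition is_graph :: "('o, 'm, 'z) cat_scheme \<Rightarrow> ('o, 'm) graph \<Rightarrow> bool" where
  "is_graph C X \<longleftrightarrow> edges X \<in> Ob C \<and> verts X \<in> Ob C \<and>
     d0 X \<in> hom C (edges X) (verts X) \<and> d1 X \<in> hom C (edges X) (verts X)"

definition is_gmap :: "('o, 'm, 'z) cat_scheme \<Rightarrow> ('o, 'm) gmap \<Rightarrow> bool" where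
  "is_gmap C f \<longleftrightarrow> is_graph C (gsrc f) \<and> is_graph C (gtgt f) \<and>
     emap f \<in> hom C (edges (gsrc f)) (edges (gtgt f)) \<and>
     vmap f \<in> hom C (verts (gsrc f)) (verts (gtgt f)) \<and>
     d0 (gtgt f) \<cdot>\<^bsub>C\<^esub> emap f = vmap f \<cdot>\<^bsub>C\<^esub> d0 (gsrc f) \<and>
     d1 (gtgt f) \<cdot>\<^bsub>C\<^esub> emap f = vmap f \<cdot>\<^bsub>C\<^esub> d1 (gsrc f)"

definition const_graph :: "('o, 'm, 'z) cat_scheme \<Rightarrow> 'o \<Rightarrow> ('o, 'm) graph" where
  "const_graph C A = \<lparr>edges = A, verts = A, d0 = Idt C A, d1 = Idt C A\<rparr>"

definition const_gmap :: "('o, 'm, 'z) cat_scheme \<Rightarrow> 'm \<Rightarrow> ('o, 'm) gmap" where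
  "const_gmap C f = \<lparr>gsrc = const_graph C (Dom C f), gtgt = const_graph C (Cod C f),
     emap = f, vmap = f\<rparr>"

definition prd_graph ::
  "('o, 'm, 'z) pcat_scheme \<Rightarrow> ('o, 'm) graph \<Rightarrow> ('o, 'm) graph \<Rightarrow> ('o, 'm) graph" where
  "prd_graph C X Y = \<lparr>edges = prd C (edges X) (edges Y), verts = prd C (verts X) (verts Y),
     d0 = cross C (d0 X) (d0 Y), d1 = cross C (d1 X) (d1 Y)\<rparr>"

definition eqz_graph ::
  "('o, 'm, 'z) lcat_scheme \<Rightarrow> ('o, 'm) gmap \<Rightarrow> ('o, 'm) gmap \<Rightarrow> ('o, 'm) graph" where
  "eqz_graph C f g =
     (let ee = eqz C (emap f) (emap g); lift = eqlift C (vmap f) (vmap g)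
      in \<lparr>edges = Dom C ee, verts = Dom C (eqz C (vmap f) (vmap g)),
          d0 = lift (d0 (gsrc f) \<cdot>\<^bsub>C\<^esub> ee), d1 = lift (d1 (gsrc f) \<cdot>\<^bsub>C\<^esub> ee)\<rparr>)"

definition Graph :: "('o, 'm, 'z) lcat_scheme \<Rightarrow> (('o, 'm) graph, ('o, 'm) gmap) lcat" where
  "Graph C =
     \<lparr>Ob = {X. is_graph C X},
      Ar = {f. is_gmap C f},
      Dom = gsrc,
      Cod = gtgt,
      Idt = (\<lambda>X. \<lparr>gsrc = X, gtgt = X, emap = Idt C (edges X), vmap = Idt C (verts X)\<rparr>),
      Comp = (\<lambda>g f. \<lparr>gsrc = gsrc f, gtgt = gtgt g,
                emap = emap g \<cdot>\<^bsub>C\<^esub> emap f, vmap = vmap g \<cdot>\<^bsub>C\<^esub> vmap f\<rparr>),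
      one = const_graph C (one C),
      prd = prd_graph C,
      prl = (\<lambda>X Y. \<lparr>gsrc = prd_graph C X Y, gtgt = X,
               emap = prl C (edges X) (edges Y), vmap = prl C (verts X) (verts Y)\<rparr>),
      prr = (\<lambda>X Y. \<lparr>gsrc = prd_graph C X Y, gtgt = Y,
               emap = prr C (edges X) (edges Y), vmap = prr C (verts X) (verts Y)\<rparr>),
      eqz = (\<lambda>f g. \<lparr>gsrc = eqz_graph C f g, gtgt = gsrc f,
               emap = eqz C (emap f) (emap g), vmap = eqz C (vmap f) (vmap g)\<rparr>)\<rparr>"

definition connected :: "('o, 'm, 'z) cat_scheme \<Rightarrow> ('o, 'm) graph \<Rightarrow> bool" where
  "connected C X \<longleftrightarrow> (\<exists>l. is_coequaliser C (d0 X) (d1 X) l \<and> is_terminal C (Cod C l))"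

definition const_grp ::
  "('o, 'm, 'z) cat_scheme \<Rightarrow> ('o, 'm) grp \<Rightarrow> (('o, 'm) graph, ('o, 'm) gmap) grp" where
  "const_grp C G = \<lparr>carr = const_graph C (carr G), mul = const_gmap C (mul G),
     inverse_map = const_gmap C (inverse_map G), unit_map = const_gmap C (unit_map G)\<rparr>"

definition G_graph ::
  "('o, 'm, 'z) lcat_scheme \<Rightarrow> ('o, 'm) grp \<Rightarrow> ('o, 'm) graph \<Rightarrow> 'm \<Rightarrow> 'm \<Rightarrow> bool" where
  "G_graph C G X aE aV \<longleftrightarrow> is_graph C X \<and> action C G (edges X) aE \<and> action C G (verts X) aV \<and>
     d0 X \<cdot>\<^bsub>C\<^esub> aE = aV \<cdot>\<^bsub>C\<^esub> cross C (Idt C (carr G)) (d0 X) \<and>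
     d1 X \<cdot>\<^bsub>C\<^esub> aE = aV \<cdot>\<^bsub>C\<^esub> cross C (Idt C (carr G)) (d1 X)"

definition action_gmap ::
  "('o, 'm, 'z) lcat_scheme \<Rightarrow> ('o, 'm) grp \<Rightarrow> ('o, 'm) graph \<Rightarrow> 'm \<Rightarrow> 'm \<Rightarrow> ('o, 'm) gmap" where
  "action_gmap C G X aE aV =
     \<lparr>gsrc = prd_graph C (const_graph C (carr G)) X, gtgt = X, emap = aE, vmap = aV\<rparr>"


section \<open>The diagonal functor and the standard graph\<close>

type_synonym ('o, 'm) slice_grp =
  "(('o, 'm) gmap, ('o, 'm) gmap \<times> ('o, 'm) gmap \<times> ('o, 'm) gmap) grp"

type_synonym ('o, 'm) slice_grp_map =
  "('o, 'm) slice_grp \<times> (('o, 'm) gmap \<times> ('o, 'm) gmap \<times> ('o, 'm) gmap) \<times> ('o, 'm) slice_grp"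

definition Delta ::
  "('o, 'm, 'z) lcat_scheme \<Rightarrow> ('o, 'm) graph \<Rightarrow> ('o, 'm) grp \<Rightarrow> ('o, 'm) slice_grp" where
  "Delta C Q H = times_grp (Graph C) Q (const_grp C H)"

definition Delta_map ::
  "('o, 'm, 'z) lcat_scheme \<Rightarrow> ('o, 'm) graph \<Rightarrow> ('o, 'm) grp \<times> 'm \<times> ('o, 'm) grp \<Rightarrow>
   ('o, 'm) slice_grp_map" where
  "Delta_map C Q = (\<lambda>(H, f, K).
     times_grp_map (Graph C) Q (const_grp C H, const_gmap C f, const_grp C K))"

text \<open>
  In the rest of this section \<open>a\<close> is the action map of a \<open>G\<close>-graph \<open>X\<close>, \<open>q\<close> its quotient map and
  \<open>s\<close> a section of \<open>q\<close>. The standard graph is formed from a group object \<open>S\<close> over \<open>Q\<close>, a group object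
  \<open>P\<close> of \<open>C\<close> and a homomorphism \<open>n\<close> from \<open>S\<close> to \<open>Delta C Q P\<close> (the unit, for \<open>P\<close> the colimit of \<open>S\<close>);
  \<open>t\<close> is the quotient map from \<open>P \<times> Q\<close> onto it.
\<close>

definition section_stab ::
  "('o, 'm, 'z) lcat_scheme \<Rightarrow> ('o, 'm) grp \<Rightarrow> ('o, 'm) graph \<Rightarrow> ('o, 'm) gmap \<Rightarrow> ('o, 'm) gmap
   \<Rightarrow> ('o, 'm) slice_grp" where
  "section_stab C G X a s = pullback_grp (Graph C) s (stab_grp (Graph C) (const_grp C G) X a)"

definition stab_to_Delta ::
  "('o, 'm, 'z) lcat_scheme \<Rightarrow> ('o, 'm) grp \<Rightarrow> ('o, 'm) graph \<Rightarrow> ('o, 'm) gmap \<Rightarrow> ('o, 'm) gmap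
   \<Rightarrow> ('o, 'm) gmap \<Rightarrow> ('o, 'm) slice_grp_map" where
  "stab_to_Delta C G X a q s =
     (let D = Graph C; A = const_graph C (carr G); Q = Cod D q; S = section_stab C G X a s;
          f = cross D (Idt D A) q \<cdot>\<^bsub>D\<^esub> stab_incl D A X a \<cdot>\<^bsub>D\<^esub> pbl D (stab_map D A X a) s
      in (S, (carr S, f, carr (Delta C Q G)), Delta C Q G))"

definition is_standard_graph ::
  "('o, 'm, 'z) lcat_scheme \<Rightarrow> ('o, 'm) graph \<Rightarrow> ('o, 'm) slice_grp \<Rightarrow> ('o, 'm) grp
   \<Rightarrow> ('o, 'm) slice_grp_map \<Rightarrow> ('o, 'm) gmap \<Rightarrow> bool" where
  "is_standard_graph C Q S P n t \<longleftrightarrow>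
     (let D = Graph C; A = const_graph C (carr P); m = const_gmap C (mul P)
      in is_coequaliser D
           (cross D (Idt D A) (carr S))
           (cross D m (Idt D Q) \<cdot>\<^bsub>D\<^esub> assoc D A A Q \<cdot>\<^bsub>D\<^esub> cross D (Idt D A) (mid (mid n)))
           t)"

definition standard_action ::
  "('o, 'm, 'z) lcat_scheme \<Rightarrow> ('o, 'm) graph \<Rightarrow> ('o, 'm) grp \<Rightarrow> ('o, 'm) gmap \<Rightarrow> ('o, 'm) gmap" where
  "standard_action C Q P t =
     (let D = Graph C; A = const_graph C (carr P); m = const_gmap C (mul P); T = Cod D t
      in THE b. b \<in> hom D (prd D A T) T \<and>
           b \<cdot>\<^bsub>D\<^esub> cross D (Idt D A) t = t \<cdot>\<^bsub>D\<^esub> cross D m (Idt D Q) \<cdot>\<^bsub>D\<^esub> assoc D A A Q)"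

definition kernel_incl ::
  "('o, 'm, 'z) lcat_scheme \<Rightarrow> ('o, 'm) grp \<times> 'm \<times> ('o, 'm) grp \<Rightarrow> 'm" where
  "kernel_incl C = (\<lambda>(P, f, G). eqz C f (unit_map G \<cdot>\<^bsub>C\<^esub> bang C (carr P)))"

definition standard_to ::
  "('o, 'm, 'z) lcat_scheme \<Rightarrow> ('o, 'm) graph \<Rightarrow> ('o, 'm) gmap \<Rightarrow> ('o, 'm) gmap \<Rightarrow> ('o, 'm) gmap
   \<Rightarrow> ('o, 'm) grp \<times> 'm \<times> ('o, 'm) grp \<Rightarrow> ('o, 'm) gmap \<Rightarrow> ('o, 'm) gmap" where
  "standard_to C X a q s = (\<lambda>(P, f, G) t.
     (let D = Graph C; A = const_graph C (carr G); Q = Cod D q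
      in THE h. h \<in> hom D (Cod D t) X \<and>
           h \<cdot>\<^bsub>D\<^esub> t = (a \<cdot>\<^bsub>D\<^esub> cross D (Idt D A) s) \<cdot>\<^bsub>D\<^esub> cross D (const_gmap C f) (Idt D Q)))"

end

theory Submission
  imports Defs
begin

text \<open>
  Write \<open>D\<close> for the category of graphs in \<open>C\<close>. Finite limits and coequalisers of graphs are formed on
  edges and vertices separately, so \<open>D\<close> inherits from \<open>C\<close> finite limits, coequalisers, their preservation
  by products, and \<open>OST\<close>, since the diagram in \<open>OST\<close> is built from finite limits
  (\<open>Graph_finite_limits\<close>, \<open>Graph_products_preserve_coequalisers\<close>, \<open>Graph_OST\<close>). A group of \<open>C\<close> is a
  constant group of \<open>D\<close>, and almost everything happens in \<open>D\<close> with generalised elements. In these terms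
  \<open>OST\<close> says that \<open>X\<close> is \<open>G \<times> Q\<close> with \<open>(g k, y)\<close> and \<open>(g, y)\<close> identified whenever \<open>k\<close> stabilises
  \<open>s y\<close> (\<open>OST_lift\<close>), while \<open>T\<close> is \<open>\<pi> \<times> Q\<close> with \<open>(p l, y)\<close> and \<open>(p, y)\<close> identified for the labels \<open>l\<close> of
  these \<open>k\<close>, which satisfy \<open>\<phi> l = k\<close>; \<open>\<Phi>\<close> sends the class of \<open>(p, y)\<close> to \<open>\<phi>(p) s(y)\<close>.

  If \<open>\<phi>\<close> is an isomorphism, the two descriptions agree, so \<open>\<Phi>\<close> is an isomorphism
  (\<open>iso_if_hom_iso\<close>), and an isomorphism has a section. The substance is that a section \<open>\<sigma>\<close> of \<open>\<Phi>\<close>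
  forces \<open>\<phi>\<close> to be an isomorphism.

  Since \<open>X\<close> is connected, \<open>\<pi>\<close> acts transitively on \<open>G\<close> through \<open>\<phi>\<close>: sending \<open>g s(y)\<close> to the coset of
  \<open>g\<inverse>\<close> maps \<open>X\<close> to a constant graph, so this map is constant (\<open>transitive\<close>). Applying \<open>OST\<close> to that
  transitive action, with the unit of \<open>G\<close> as section of its quotient, exhibits \<open>\<phi>\<close> as the quotient of \<open>\<pi>\<close>
  by its kernel \<open>K\<close> (\<open>transitive_hom_coequaliser\<close>). This replaces the surjectivity of \<open>\<phi>\<close>, which has no
  elementary meaning in \<open>C\<close>. Consequently \<open>\<Phi>\<close> is the quotient of \<open>T\<close> by \<open>K\<close> (\<open>Phi_quotient\<close>).

  So \<open>\<sigma>\<close> is a section of a quotient by a free action, and \<open>OST\<close> once more gives \<open>K \<times> X \<cong> T\<close>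
  (\<open>free_trivial\<close>). As \<open>T\<close> is connected, the projection of \<open>K \<times> X\<close> to the constant graph \<open>K\<close> is
  constant; as \<open>X\<close> is connected, this projection is epi against constant graphs. Hence \<open>K\<close> is trivial,
  and \<open>\<phi>\<close>, the quotient by a trivial kernel, is an isomorphism.

  For \<open>\<phi>\<close> to exist at all, \<open>s\<^sup>*G\<^sub>X\<close> has to be a group over \<open>Q\<close>; it embeds into \<open>G \<times> Q\<close>, from which it
  inherits the group laws (\<open>section_stab_in_Delta\<close>).
\<close>

section \<open>Composition and universal constructions\<close>

text \<open>
  The typing rules are phrased with \<open>Ar\<close>, \<open>Dom\<close> and \<open>Cod\<close>, so that every side condition of a rewrite
  rule is determined by its left-hand side, and composites are nested to the right. Applying an arrow
  to pairs of arrows then computes with generalised elements.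
\<close>

context category
begin

lemma Dom_Ob [simp]: "f \<in> Ar C \<Longrightarrow> Dom C f \<in> Ob C"
  and Cod_Ob [simp]: "f \<in> Ar C \<Longrightarrow> Cod C f \<in> Ob C"
  using dom_cod by auto

lemma Idt_typing [simp]:
  assumes "A \<in> Ob C"
  shows "Idt C A \<in> Ar C" "Dom C (Idt C A) = A" "Cod C (Idt C A) = A"
  using id_hom[OF assms] by (auto simp: hom_def)

lemma comp_typing [simp]:
  assumes "f \<in> Ar C" "g \<in> Ar C" "Dom C g = Cod C f"
  shows "g \<cdot> f \<in> Ar C" "Dom C (g \<cdot> f) = Dom C f" "Cod C (g \<cdot> f) = Cod C g"
  using comp_hom[of f "Dom C f" "Cod C f" g "Cod C g"] assms by (auto simp: hom_def)

lemma comp_Idt [simp]: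
  "\<lbrakk>f \<in> Ar C; Cod C f = B\<rbrakk> \<Longrightarrow> Idt C B \<cdot> f = f"
  "\<lbrakk>f \<in> Ar C; Dom C f = A\<rbrakk> \<Longrightarrow> f \<cdot> Idt C A = f"
  using comp_id_left comp_id_right by (auto simp: hom_def)

lemma comp_assoc_Ar [simp]:
  "\<lbrakk>f \<in> Ar C; g \<in> Ar C; h \<in> Ar C; Dom C g = Cod C f; Dom C h = Cod C g\<rbrakk>
    \<Longrightarrow> (h \<cdot> g) \<cdot> f = h \<cdot> g \<cdot> f"
  using comp_assoc[of f "Dom C f" "Cod C f" g "Cod C g" h "Cod C h"] by (auto simp: hom_def)

text \<open>An equation between composites, in a form that applies inside right-nested composites.\<close>

lemma comp_eq_precomp:
  assumes "f \<cdot> g = f' \<cdot> g'" "f \<in> Ar C" "g \<in> Ar C" "Dom C f = Cod C g"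
    "f' \<in> Ar C" "g' \<in> Ar C" "Dom C f' = Cod C g'" "h \<in> Ar C" "Cod C h = Dom C g"
    "Dom C g' = Dom C g"
  shows "f \<cdot> g \<cdot> h = f' \<cdot> g' \<cdot> h"
proof -
  have "(f \<cdot> g) \<cdot> h = (f' \<cdot> g') \<cdot> h" using assms(1) by simp
  thus ?thesis using assms(2-) by simp
qed

lemma is_isoI:
  assumes "f \<in> Ar C" "g \<in> Ar C" "Dom C g = Cod C f" "Cod C g = Dom C f"
    "g \<cdot> f = Idt C (Dom C f)" "f \<cdot> g = Idt C (Cod C f)"
  shows "is_iso C f"
  using assms unfolding is_iso_def hom_def by blast

lemma is_isoE:
  assumes "is_iso C f"
  obtains g where "f \<in> Ar C" "g \<in> Ar C" "Dom C g = Cod C f" "Cod C g = Dom C f"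
    "g \<cdot> f = Idt C (Dom C f)" "f \<cdot> g = Idt C (Cod C f)"
  using assms unfolding is_iso_def hom_def by blast

lemma iso_cancel_left:
  assumes "is_iso C f" "u \<in> Ar C" "v \<in> Ar C" "Cod C u = Dom C f" "Cod C v = Dom C f"
    "f \<cdot> u = f \<cdot> v"
  shows "u = v"
proof -
  obtain g where g: "f \<in> Ar C" "g \<in> Ar C" "Dom C g = Cod C f" "Cod C g = Dom C f"
    "g \<cdot> f = Idt C (Dom C f)"
    using assms(1) by (rule is_isoE)
  have "(g \<cdot> f) \<cdot> u = (g \<cdot> f) \<cdot> v"
    using assms g(1-4) by simp
  thus ?thesis using assms g by simp
qed

lemma coequaliser_typing:
  assumes "is_coequaliser C f g q"
  shows "f \<in> Ar C" "g \<in> Ar C" "q \<in> Ar C" "Dom C g = Dom C f" "Cod C g = Cod C f"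
    "Dom C q = Cod C f" "q \<cdot> f = q \<cdot> g"
  using assms unfolding is_coequaliser_def parallel_def hom_def by auto

lemma coequaliser_lift:
  assumes "is_coequaliser C f g q" "h \<in> Ar C" "Dom C h = Cod C f" "h \<cdot> f = h \<cdot> g"
  obtains k where "k \<in> Ar C" "Dom C k = Cod C q" "Cod C k = Cod C h" "k \<cdot> q = h"
  using assms unfolding is_coequaliser_def hom_def by blast

lemma coequaliser_epi:
  assumes "is_coequaliser C f g q" "u \<in> Ar C" "v \<in> Ar C" "Dom C u = Cod C q" "Dom C v = Cod C q"
    "u \<cdot> q = v \<cdot> q"
  shows "u = v"
proof -
  note q = coequaliser_typing[OF assms(1)]
  have c: "Cod C u = Cod C v"
    using assms q comp_typing(3)[of q u, symmetric] comp_typing(3)[of q v] by simp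
  have "u \<cdot> q \<in> Ar C" "Dom C (u \<cdot> q) = Cod C f" "(u \<cdot> q) \<cdot> f = (u \<cdot> q) \<cdot> g"
    "Cod C (u \<cdot> q) = Cod C u"
    using assms q c by simp_all
  hence "\<exists>!k. k \<in> hom C (Cod C q) (Cod C u) \<and> k \<cdot> q = u \<cdot> q"
    using assms(1) unfolding is_coequaliser_def by metis
  thus ?thesis using assms c by (auto simp: hom_def)
qed

lemma coequaliserI:
  assumes "f \<in> Ar C" "g \<in> Ar C" "q \<in> Ar C" "Dom C g = Dom C f" "Cod C g = Cod C f"
    "Dom C q = Cod C f" "q \<cdot> f = q \<cdot> g"
    and lift: "\<And>h. \<lbrakk>h \<in> Ar C; Dom C h = Cod C f; h \<cdot> f = h \<cdot> g\<rbrakk>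
      \<Longrightarrow> \<exists>k \<in> Ar C. Dom C k = Cod C q \<and> Cod C k = Cod C h \<and> k \<cdot> q = h"
    and epi: "\<And>u v. \<lbrakk>u \<in> Ar C; v \<in> Ar C; Dom C u = Cod C q; Dom C v = Cod C q; u \<cdot> q = v \<cdot> q\<rbrakk>
      \<Longrightarrow> u = v"
  shows "is_coequaliser C f g q"
  unfolding is_coequaliser_def parallel_def hom_def
proof (intro conjI ballI impI)
  fix h
  assume h: "h \<in> Ar C" "Dom C h = Cod C f \<and> h \<cdot> f = h \<cdot> g"
  obtain k where k: "k \<in> Ar C" "Dom C k = Cod C q" "Cod C k = Cod C h" "k \<cdot> q = h"
    using lift[of h] h by blast
  show "\<exists>!k. k \<in> {fa \<in> Ar C. Dom C fa = Cod C q \<and> Cod C fa = Cod C h} \<and> k \<cdot> q = h"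
  proof (rule ex1I[of _ k])
    fix k'
    assume "k' \<in> {fa \<in> Ar C. Dom C fa = Cod C q \<and> Cod C fa = Cod C h} \<and> k' \<cdot> q = h"
    thus "k' = k" using k by (simp add: epi)
  qed (use k in auto)
qed (use assms in auto)

end

context finite_products
begin

lemma one_Ob [simp]: "one C \<in> Ob C"
  using terminal_one unfolding is_terminal_def by blast

lemma bang_typing [simp]:
  assumes "A \<in> Ob C"
  shows "bang C A \<in> Ar C" "Dom C (bang C A) = A" "Cod C (bang C A) = one C"
proof -
  have "\<exists>!f. f \<in> hom C A (one C)" using terminal_one assms unfolding is_terminal_def by blast
  hence "bang C A \<in> hom C A (one C)" unfolding bang_def by (rule theI')
  thus "bang C A \<in> Ar C" "Dom C (bang C A) = A" "Cod C (bang C A) = one C"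
    by (auto simp: hom_def)
qed

lemma bang_unique:
  assumes "f \<in> Ar C" "Cod C f = one C"
  shows "f = bang C (Dom C f)"
proof -
  have "\<exists>!g. g \<in> hom C (Dom C f) (one C)"
    using terminal_one assms unfolding is_terminal_def by simp
  thus ?thesis using assms bang_typing[of "Dom C f"] by (auto simp: hom_def)
qed

lemma bang_comp [simp]: "\<lbrakk>f \<in> Ar C; Cod C f = A\<rbrakk> \<Longrightarrow> bang C A \<cdot> f = bang C (Dom C f)"
  by (rule trans[OF bang_unique]) auto

lemma bang_one [simp]: "bang C (one C) = Idt C (one C)"
  by (rule sym, rule trans[OF bang_unique]) simp_all

lemma prd_typing [simp]:
  assumes "A \<in> Ob C" "B \<in> Ob C"
  shows "prl C A B \<in> Ar C" "Dom C (prl C A B) = prd C A B" "Cod C (prl C A B) = A"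
    "prr C A B \<in> Ar C" "Dom C (prr C A B) = prd C A B" "Cod C (prr C A B) = B"
  using product_prd[OF assms] by (auto simp: is_product_def hom_def)

lemma prd_Ob [simp]: "\<lbrakk>A \<in> Ob C; B \<in> Ob C\<rbrakk> \<Longrightarrow> prd C A B \<in> Ob C"
  using Dom_Ob[of "prl C A B"] by simp

lemma product_ex1:
  assumes "f \<in> Ar C" "g \<in> Ar C" "Dom C f = Dom C g"
  shows "\<exists>!h. h \<in> hom C (Dom C f) (prd C (Cod C f) (Cod C g)) \<and>
     prl C (Cod C f) (Cod C g) \<cdot> h = f \<and> prr C (Cod C f) (Cod C g) \<cdot> h = g"
proof -
  have "f \<in> hom C (Dom C f) (Cod C f)" "g \<in> hom C (Dom C f) (Cod C g)"
    using assms by (auto simp: hom_def)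
  thus ?thesis
    using product_prd[of "Cod C f" "Cod C g"] assms unfolding is_product_def by simp
qed

lemma pair_props:
  assumes "f \<in> Ar C" "g \<in> Ar C" "Dom C f = Dom C g"
  shows "pair C f g \<in> hom C (Dom C f) (prd C (Cod C f) (Cod C g)) \<and>
     prl C (Cod C f) (Cod C g) \<cdot> pair C f g = f \<and> prr C (Cod C f) (Cod C g) \<cdot> pair C f g = g"
  unfolding pair_def by (rule theI'[OF product_ex1[OF assms]])

lemma pair_typing [simp]:
  assumes "f \<in> Ar C" "g \<in> Ar C" "Dom C f = Dom C g"
  shows "pair C f g \<in> Ar C" "Dom C (pair C f g) = Dom C g"
    "Cod C (pair C f g) = prd C (Cod C f) (Cod C g)"
  using pair_props[OF assms] assms(3) by (auto simp: hom_def)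

lemma prj_pair [simp]:
  assumes "f \<in> Ar C" "g \<in> Ar C" "Dom C f = Dom C g" "Cod C f = A" "Cod C g = B"
  shows "prl C A B \<cdot> pair C f g = f" "prr C A B \<cdot> pair C f g = g"
  using pair_props[OF assms(1-3)] assms(4,5) by auto

lemma prd_eqI:
  assumes "h \<in> Ar C" "k \<in> Ar C" "Cod C h = prd C A B" "Cod C k = prd C A B" "A \<in> Ob C" "B \<in> Ob C"
    "prl C A B \<cdot> h = prl C A B \<cdot> k" "prr C A B \<cdot> h = prr C A B \<cdot> k"
  shows "h = k"
proof -
  have d: "Dom C h = Dom C k"
    using assms comp_typing(2)[of h "prl C A B"] comp_typing(2)[of k "prl C A B"] by simp
  have "\<exists>!h. h \<in> hom C (Dom C k) (prd C A B) \<and>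
     prl C A B \<cdot> h = prl C A B \<cdot> k \<and> prr C A B \<cdot> h = prr C A B \<cdot> k"
    using product_ex1[of "prl C A B \<cdot> k" "prr C A B \<cdot> k"] assms(1-6) by simp
  moreover have "h \<in> hom C (Dom C k) (prd C A B)" "k \<in> hom C (Dom C k) (prd C A B)"
    using assms d by (simp_all add: hom_def)
  ultimately show ?thesis using assms(7,8) by blast
qed

lemma pair_eta [simp]:
  assumes "h \<in> Ar C" "Cod C h = prd C A B" "A \<in> Ob C" "B \<in> Ob C"
  shows "pair C (prl C A B \<cdot> h) (prr C A B \<cdot> h) = h"
  by (rule prd_eqI[of _ _ A B]) (use assms in simp_all)

lemma pair_prj [simp]:
  assumes "A \<in> Ob C" "B \<in> Ob C"
  shows "pair C (prl C A B) (prr C A B) = Idt C (prd C A B)"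
  by (rule prd_eqI[of _ _ A B]) (use assms in simp_all)

lemma pair_comp [simp]:
  assumes "f \<in> Ar C" "g \<in> Ar C" "Dom C f = Dom C g" "h \<in> Ar C" "Cod C h = Dom C g"
  shows "pair C f g \<cdot> h = pair C (f \<cdot> h) (g \<cdot> h)"
proof (rule prd_eqI[of _ _ "Cod C f" "Cod C g"])
  have "prl C (Cod C f) (Cod C g) \<cdot> pair C f g \<cdot> h = (prl C (Cod C f) (Cod C g) \<cdot> pair C f g) \<cdot> h"
    "prr C (Cod C f) (Cod C g) \<cdot> pair C f g \<cdot> h = (prr C (Cod C f) (Cod C g) \<cdot> pair C f g) \<cdot> h"
    using assms by (simp_all del: prj_pair)
  thus "prl C (Cod C f) (Cod C g) \<cdot> pair C f g \<cdot> h
      = prl C (Cod C f) (Cod C g) \<cdot> pair C (f \<cdot> h) (g \<cdot> h)"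
    "prr C (Cod C f) (Cod C g) \<cdot> pair C f g \<cdot> h
      = prr C (Cod C f) (Cod C g) \<cdot> pair C (f \<cdot> h) (g \<cdot> h)"
    using assms by simp_all
qed (use assms in simp_all)

lemma pair_inject:
  assumes "pair C f g = pair C f' g'" "f \<in> Ar C" "g \<in> Ar C" "Dom C f = Dom C g"
    "f' \<in> Ar C" "g' \<in> Ar C" "Dom C f' = Dom C g'" "Cod C f' = Cod C f" "Cod C g' = Cod C g"
  shows "f = f'" "g = g'"
  using prj_pair[OF assms(2-4) refl refl] prj_pair[OF assms(5-9)] assms(1) by simp_all

lemma cross_typing [simp]:
  assumes "f \<in> Ar C" "g \<in> Ar C"
  shows "cross C f g \<in> Ar C" "Dom C (cross C f g) = prd C (Dom C f) (Dom C g)"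
    "Cod C (cross C f g) = prd C (Cod C f) (Cod C g)"
  using assms by (simp_all add: cross_def)

lemma cross_pair [simp]:
  assumes "f \<in> Ar C" "g \<in> Ar C" "u \<in> Ar C" "v \<in> Ar C" "Dom C u = Dom C v"
    "Cod C u = Dom C f" "Cod C v = Dom C g"
  shows "cross C f g \<cdot> pair C u v = pair C (f \<cdot> u) (g \<cdot> v)"
  using assms by (simp add: cross_def)

lemma assoc_typing [simp]:
  assumes "A \<in> Ob C" "B \<in> Ob C" "D \<in> Ob C"
  shows "assoc C A B D \<in> Ar C" "Dom C (assoc C A B D) = prd C A (prd C B D)"
    "Cod C (assoc C A B D) = prd C (prd C A B) D"
  using assms by (simp_all add: assoc_def Let_def)

lemma assoc_pair [simp]:
  assumes "x \<in> Ar C" "y \<in> Ar C" "z \<in> Ar C" "Dom C x = Dom C z" "Dom C y = Dom C z"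
    "Cod C x = A" "Cod C y = B" "Cod C z = D"
  shows "assoc C A B D \<cdot> pair C x (pair C y z) = pair C (pair C x y) z"
  using assms by (auto simp: assoc_def Let_def)

text \<open>Arrows out of a product are determined by their values on pairs of generalised elements.\<close>

lemma prd_extensionality:
  assumes "f \<in> Ar C" "g \<in> Ar C" "Dom C f = prd C A B" "Dom C g = prd C A B" "A \<in> Ob C" "B \<in> Ob C"
    and "\<And>x y. \<lbrakk>x \<in> Ar C; y \<in> Ar C; Dom C x = Dom C y; Cod C x = A; Cod C y = B\<rbrakk>
      \<Longrightarrow> f \<cdot> pair C x y = g \<cdot> pair C x y"
  shows "f = g"
  using assms(7)[of "prl C A B" "prr C A B"] assms(1-6) by simp

lemma prd3_extensionality:
  assumes "f \<in> Ar C" "g \<in> Ar C" "Dom C f = prd C A (prd C B D)" "Dom C g = prd C A (prd C B D)"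
    "A \<in> Ob C" "B \<in> Ob C" "D \<in> Ob C"
    and "\<And>x y z. \<lbrakk>x \<in> Ar C; y \<in> Ar C; z \<in> Ar C; Dom C x = Dom C z; Dom C y = Dom C z;
        Cod C x = A; Cod C y = B; Cod C z = D\<rbrakk>
      \<Longrightarrow> f \<cdot> pair C x (pair C y z) = g \<cdot> pair C x (pair C y z)"
  shows "f = g"
proof (rule prd_extensionality[of f g A "prd C B D"])
  fix x y
  assume xy: "x \<in> Ar C" "y \<in> Ar C" "Dom C x = Dom C y" "Cod C x = A" "Cod C y = prd C B D"
  show "f \<cdot> pair C x y = g \<cdot> pair C x y"
    using assms(8)[of x "prl C B D \<cdot> y" "prr C B D \<cdot> y"] xy assms(5-7) by simp
qed (use assms in auto)

end

context finite_limits
begin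

lemma eqz_props:
  assumes "f \<in> Ar C" "g \<in> Ar C" "Dom C g = Dom C f" "Cod C g = Cod C f"
  shows "eqz C f g \<in> Ar C" "Cod C (eqz C f g) = Dom C f" "f \<cdot> eqz C f g = g \<cdot> eqz C f g"
proof -
  have "is_equaliser C f g (eqz C f g)"
    using assms by (intro equaliser_eqz) (auto simp: parallel_def hom_def)
  thus "eqz C f g \<in> Ar C" "Cod C (eqz C f g) = Dom C f" "f \<cdot> eqz C f g = g \<cdot> eqz C f g"
    by (auto simp: is_equaliser_def)
qed

lemma eqlift_ex1:
  assumes "f \<in> Ar C" "g \<in> Ar C" "Dom C g = Dom C f" "Cod C g = Cod C f"
    "h \<in> Ar C" "Cod C h = Dom C f" "f \<cdot> h = g \<cdot> h"
  shows "\<exists>!k. k \<in> hom C (Dom C h) (Dom C (eqz C f g)) \<and> eqz C f g \<cdot> k = h"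
proof -
  have "is_equaliser C f g (eqz C f g)"
    using assms by (intro equaliser_eqz) (auto simp: parallel_def hom_def)
  thus ?thesis using assms unfolding is_equaliser_def by blast
qed

lemma eqlift_props:
  assumes "f \<in> Ar C" "g \<in> Ar C" "Dom C g = Dom C f" "Cod C g = Cod C f"
    "h \<in> Ar C" "Cod C h = Dom C f" "f \<cdot> h = g \<cdot> h"
  shows "eqlift C f g h \<in> Ar C" "Dom C (eqlift C f g h) = Dom C h"
    "Cod C (eqlift C f g h) = Dom C (eqz C f g)" "eqz C f g \<cdot> eqlift C f g h = h"
  using theI'[OF eqlift_ex1[OF assms]] by (auto simp: eqlift_def hom_def)

lemma eqz_mono:
  assumes "f \<in> Ar C" "g \<in> Ar C" "Dom C g = Dom C f" "Cod C g = Cod C f"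
    "u \<in> Ar C" "v \<in> Ar C" "Cod C u = Dom C (eqz C f g)" "Cod C v = Dom C (eqz C f g)"
    "eqz C f g \<cdot> u = eqz C f g \<cdot> v"
  shows "u = v"
proof -
  note e = eqz_props[OF assms(1-4)]
  have d: "Dom C u = Dom C v"
    using assms e comp_typing(2)[of u "eqz C f g"] comp_typing(2)[of v "eqz C f g"] by simp
  have "f \<cdot> eqz C f g \<cdot> u = g \<cdot> eqz C f g \<cdot> u"
    using assms e by (intro comp_eq_precomp) simp_all
  hence "\<exists>!k. k \<in> hom C (Dom C (eqz C f g \<cdot> u)) (Dom C (eqz C f g)) \<and> eqz C f g \<cdot> k = eqz C f g \<cdot> u"
    using assms(1-7) e(1,2) by (intro eqlift_ex1) simp_all
  moreover have "u \<in> hom C (Dom C (eqz C f g \<cdot> u)) (Dom C (eqz C f g))"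
    "v \<in> hom C (Dom C (eqz C f g \<cdot> u)) (Dom C (eqz C f g))"
    using assms(1-8) e d by (simp_all add: hom_def)
  ultimately show ?thesis using assms(9) by metis
qed

lemma pb_typing [simp]:
  assumes "p \<in> Ar C" "r \<in> Ar C" "Cod C p = Cod C r"
  shows "pbeq C p r \<in> Ar C" "Cod C (pbeq C p r) = prd C (Dom C p) (Dom C r)"
    "pbl C p r \<in> Ar C" "Dom C (pbl C p r) = Dom C (pbeq C p r)" "Cod C (pbl C p r) = Dom C p"
    "pbr C p r \<in> Ar C" "Dom C (pbr C p r) = Dom C (pbeq C p r)" "Cod C (pbr C p r) = Dom C r"
  using assms eqz_props[of "p \<cdot> prl C (Dom C p) (Dom C r)" "r \<cdot> prr C (Dom C p) (Dom C r)"]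
  by (simp_all add: pbeq_def pbl_def pbr_def)

lemma pb_commutes:
  assumes "p \<in> Ar C" "r \<in> Ar C" "Cod C p = Cod C r"
  shows "p \<cdot> pbl C p r = r \<cdot> pbr C p r"
proof -
  have "(p \<cdot> prl C (Dom C p) (Dom C r)) \<cdot> pbeq C p r = (r \<cdot> prr C (Dom C p) (Dom C r)) \<cdot> pbeq C p r"
    using assms unfolding pbeq_def by (intro eqz_props) simp_all
  thus ?thesis using assms pb_typing(1,2)[OF assms] unfolding pbl_def pbr_def by simp
qed

lemma pb_mono:
  assumes "p \<in> Ar C" "r \<in> Ar C" "Cod C p = Cod C r"
    "h \<in> Ar C" "k \<in> Ar C" "Cod C h = Dom C (pbeq C p r)" "Cod C k = Dom C (pbeq C p r)"
    "pbl C p r \<cdot> h = pbl C p r \<cdot> k" "pbr C p r \<cdot> h = pbr C p r \<cdot> k"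
  shows "h = k"
proof -
  have "pbeq C p r \<cdot> h = pbeq C p r \<cdot> k"
    using assms pb_typing[OF assms(1-3)]
    by (rule_tac prd_eqI[of _ _ "Dom C p" "Dom C r"]) (simp_all add: pbl_def pbr_def)
  thus ?thesis
    using assms eqz_mono[of "p \<cdot> prl C (Dom C p) (Dom C r)" "r \<cdot> prr C (Dom C p) (Dom C r)" h k]
    by (simp add: pbeq_def)
qed

lemma pblift_ex1:
  assumes "p \<in> Ar C" "r \<in> Ar C" "Cod C p = Cod C r" "u \<in> Ar C" "v \<in> Ar C" "Dom C u = Dom C v"
    "Cod C u = Dom C p" "Cod C v = Dom C r" "p \<cdot> u = r \<cdot> v"
  shows "\<exists>!k. k \<in> hom C (Dom C u) (Dom C (pbeq C p r)) \<and> pbl C p r \<cdot> k = u \<and> pbr C p r \<cdot> k = v"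
proof -
  let ?f = "p \<cdot> prl C (Dom C p) (Dom C r)" and ?g = "r \<cdot> prr C (Dom C p) (Dom C r)"
  have "eqlift C ?f ?g (pair C u v) \<in> Ar C" "Dom C (eqlift C ?f ?g (pair C u v)) = Dom C u"
    "Cod C (eqlift C ?f ?g (pair C u v)) = Dom C (pbeq C p r)"
    "pbeq C p r \<cdot> eqlift C ?f ?g (pair C u v) = pair C u v"
    using eqlift_props[of ?f ?g "pair C u v"] assms by (simp_all add: pbeq_def)
  moreover from this have "pbl C p r \<cdot> eqlift C ?f ?g (pair C u v) = u"
    "pbr C p r \<cdot> eqlift C ?f ?g (pair C u v) = v"
    using assms pb_typing[OF assms(1-3)] by (simp_all add: pbl_def pbr_def)
  ultimately have k: "eqlift C ?f ?g (pair C u v) \<in> hom C (Dom C u) (Dom C (pbeq C p r)) \<and>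
      pbl C p r \<cdot> eqlift C ?f ?g (pair C u v) = u \<and> pbr C p r \<cdot> eqlift C ?f ?g (pair C u v) = v"
    by (simp add: hom_def)
  show ?thesis
  proof (rule ex1I[of _ "eqlift C ?f ?g (pair C u v)"], rule k)
    fix k
    assume k': "k \<in> hom C (Dom C u) (Dom C (pbeq C p r)) \<and> pbl C p r \<cdot> k = u \<and> pbr C p r \<cdot> k = v"
    show "k = eqlift C ?f ?g (pair C u v)"
      by (rule pb_mono[OF assms(1-3)]) (use k k' in \<open>simp_all add: hom_def\<close>)
  qed
qed

lemma pblift_props [simp]:
  assumes "p \<in> Ar C" "r \<in> Ar C" "Cod C p = Cod C r" "u \<in> Ar C" "v \<in> Ar C" "Dom C u = Dom C v"
    "Cod C u = Dom C p" "Cod C v = Dom C r" "p \<cdot> u = r \<cdot> v"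
  shows "pblift C p r u v \<in> Ar C" "Dom C (pblift C p r u v) = Dom C v"
    "Cod C (pblift C p r u v) = Dom C (pbeq C p r)"
    "pbl C p r \<cdot> pblift C p r u v = u" "pbr C p r \<cdot> pblift C p r u v = v"
  using theI'[OF pblift_ex1[OF assms]] assms(6) by (auto simp: pblift_def hom_def)

end

section \<open>Group objects, homomorphisms and actions\<close>

context finite_products
begin

lemma group_object_typing [simp]:
  assumes "group_object C G"
  shows "carr G \<in> Ob C"
    "mul G \<in> Ar C" "Dom C (mul G) = prd C (carr G) (carr G)" "Cod C (mul G) = carr G"
    "inverse_map G \<in> Ar C" "Dom C (inverse_map G) = carr G" "Cod C (inverse_map G) = carr G"
    "unit_map G \<in> Ar C" "Dom C (unit_map G) = one C" "Cod C (unit_map G) = carr G"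
  using assms unfolding group_object_def Let_def hom_def by auto

lemma mul_assoc [simp]:
  assumes "group_object C G" "x \<in> Ar C" "y \<in> Ar C" "z \<in> Ar C"
    "Cod C x = carr G" "Cod C y = carr G" "Cod C z = carr G" "Dom C x = Dom C z" "Dom C y = Dom C z"
  shows "mul G \<cdot> pair C (mul G \<cdot> pair C x y) z = mul G \<cdot> pair C x (mul G \<cdot> pair C y z)"
proof -
  let ?A = "carr G"
  have "mul G \<cdot> cross C (mul G) (Idt C ?A) \<cdot> assoc C ?A ?A ?A = mul G \<cdot> cross C (Idt C ?A) (mul G)"
    using assms(1) unfolding group_object_def Let_def by blast
  hence "(mul G \<cdot> cross C (mul G) (Idt C ?A) \<cdot> assoc C ?A ?A ?A) \<cdot> pair C x (pair C y z)
    = (mul G \<cdot> cross C (Idt C ?A) (mul G)) \<cdot> pair C x (pair C y z)"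
    by simp
  thus ?thesis using assms by simp
qed

lemma mul_one [simp]:
  assumes "group_object C G" "x \<in> Ar C" "Cod C x = carr G" "Dom C x = Y"
  shows "mul G \<cdot> pair C (unit_map G \<cdot> bang C Y) x = x"
    "mul G \<cdot> pair C x (unit_map G \<cdot> bang C Y) = x"
proof -
  let ?A = "carr G"
  have "mul G \<cdot> pair C (unit_map G \<cdot> bang C ?A) (Idt C ?A) = Idt C ?A"
    "mul G \<cdot> pair C (Idt C ?A) (unit_map G \<cdot> bang C ?A) = Idt C ?A"
    using assms(1) unfolding group_object_def Let_def by blast+
  hence "(mul G \<cdot> pair C (unit_map G \<cdot> bang C ?A) (Idt C ?A)) \<cdot> x = Idt C ?A \<cdot> x"
    "(mul G \<cdot> pair C (Idt C ?A) (unit_map G \<cdot> bang C ?A)) \<cdot> x = Idt C ?A \<cdot> x"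
    by simp_all
  thus "mul G \<cdot> pair C (unit_map G \<cdot> bang C Y) x = x"
    "mul G \<cdot> pair C x (unit_map G \<cdot> bang C Y) = x"
    using assms by simp_all
qed

lemma mul_inverse [simp]:
  assumes "group_object C G" "x \<in> Ar C" "Cod C x = carr G"
  shows "mul G \<cdot> pair C (inverse_map G \<cdot> x) x = unit_map G \<cdot> bang C (Dom C x)"
    "mul G \<cdot> pair C x (inverse_map G \<cdot> x) = unit_map G \<cdot> bang C (Dom C x)"
proof -
  let ?A = "carr G"
  have "mul G \<cdot> pair C (inverse_map G) (Idt C ?A) = unit_map G \<cdot> bang C ?A"
    "mul G \<cdot> pair C (Idt C ?A) (inverse_map G) = unit_map G \<cdot> bang C ?A"
    using assms(1) unfolding group_object_def Let_def by blast+
  hence "(mul G \<cdot> pair C (inverse_map G) (Idt C ?A)) \<cdot> x = (unit_map G \<cdot> bang C ?A) \<cdot> x"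
    "(mul G \<cdot> pair C (Idt C ?A) (inverse_map G)) \<cdot> x = (unit_map G \<cdot> bang C ?A) \<cdot> x"
    by simp_all
  thus "mul G \<cdot> pair C (inverse_map G \<cdot> x) x = unit_map G \<cdot> bang C (Dom C x)"
    "mul G \<cdot> pair C x (inverse_map G \<cdot> x) = unit_map G \<cdot> bang C (Dom C x)"
    using assms by simp_all
qed

lemma mul_inverse_cancel [simp]:
  assumes "group_object C G" "x \<in> Ar C" "y \<in> Ar C" "Cod C x = carr G" "Cod C y = carr G"
    "Dom C x = Dom C y"
  shows "mul G \<cdot> pair C (inverse_map G \<cdot> x) (mul G \<cdot> pair C x y) = y"
    "mul G \<cdot> pair C x (mul G \<cdot> pair C (inverse_map G \<cdot> x) y) = y"
proof -
  have "mul G \<cdot> pair C (mul G \<cdot> pair C (inverse_map G \<cdot> x) x) y = y"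
    "mul G \<cdot> pair C (mul G \<cdot> pair C x (inverse_map G \<cdot> x)) y = y"
    using assms by (simp_all del: mul_assoc)
  thus "mul G \<cdot> pair C (inverse_map G \<cdot> x) (mul G \<cdot> pair C x y) = y"
    "mul G \<cdot> pair C x (mul G \<cdot> pair C (inverse_map G \<cdot> x) y) = y"
    using assms by (simp_all del: mul_inverse)
qed

lemma mul_cancel_left:
  assumes "group_object C G" "x \<in> Ar C" "y \<in> Ar C" "z \<in> Ar C"
    "Cod C x = carr G" "Cod C y = carr G" "Cod C z = carr G" "Dom C x = Dom C y" "Dom C z = Dom C y"
    "mul G \<cdot> pair C x y = mul G \<cdot> pair C x z"
  shows "y = z"
proof -
  have "y = mul G \<cdot> pair C (inverse_map G \<cdot> x) (mul G \<cdot> pair C x y)"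
    using assms(1-9) by simp
  also have "\<dots> = z"
    unfolding assms(10) using assms(1-9) by simp
  finally show ?thesis .
qed

lemma inverse_unique:
  assumes "group_object C G" "x \<in> Ar C" "y \<in> Ar C" "Cod C x = carr G" "Cod C y = carr G"
    "Dom C x = Dom C y" "mul G \<cdot> pair C x y = unit_map G \<cdot> bang C (Dom C y)"
  shows "y = inverse_map G \<cdot> x"
  using mul_cancel_left[of G x y "inverse_map G \<cdot> x"] assms by simp

lemma inverse_inverse [simp]:
  assumes "group_object C G" "x \<in> Ar C" "Cod C x = carr G"
  shows "inverse_map G \<cdot> inverse_map G \<cdot> x = x"
  using inverse_unique[of G "inverse_map G \<cdot> x" x] assms by simp

lemma inverse_one [simp]:
  assumes "group_object C G" "Y \<in> Ob C"
  shows "inverse_map G \<cdot> unit_map G \<cdot> bang C Y = unit_map G \<cdot> bang C Y"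
  by (rule inverse_unique[symmetric]) (use assms in simp_all)

lemma inverse_mul:
  assumes "group_object C G" "x \<in> Ar C" "y \<in> Ar C" "Cod C x = carr G" "Cod C y = carr G"
    "Dom C x = Dom C y"
  shows "inverse_map G \<cdot> mul G \<cdot> pair C x y
    = mul G \<cdot> pair C (inverse_map G \<cdot> y) (inverse_map G \<cdot> x)"
  using inverse_unique[of G "mul G \<cdot> pair C x y" "mul G \<cdot> pair C (inverse_map G \<cdot> y) (inverse_map G \<cdot> x)"]
    assms by simp

lemma Grp_Ar:
  "(G, f, H) \<in> Ar (Grp C) \<longleftrightarrow> group_object C G \<and> group_object C H \<and> f \<in> hom C (carr G) (carr H) \<and>
     f \<cdot> mul G = mul H \<cdot> cross C f f"
  by (simp add: Grp_def)

lemma group_hom_typing: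
  assumes "(G, f, H) \<in> Ar (Grp C)"
  shows "group_object C G" "group_object C H" "f \<in> Ar C" "Dom C f = carr G" "Cod C f = carr H"
  using assms by (auto simp: Grp_Ar hom_def)

lemma group_hom_mul:
  assumes "(G, f, H) \<in> Ar (Grp C)" "x \<in> Ar C" "y \<in> Ar C" "Cod C x = carr G" "Cod C y = carr G"
    "Dom C x = Dom C y"
  shows "f \<cdot> mul G \<cdot> pair C x y = mul H \<cdot> pair C (f \<cdot> x) (f \<cdot> y)"
proof -
  note f = group_hom_typing[OF assms(1)]
  have "(f \<cdot> mul G) \<cdot> pair C x y = (mul H \<cdot> cross C f f) \<cdot> pair C x y"
    using assms(1) by (simp add: Grp_Ar)
  thus ?thesis using assms f by simp
qed

lemma group_hom_one:
  assumes "(G, f, H) \<in> Ar (Grp C)" "Y \<in> Ob C"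
  shows "f \<cdot> unit_map G \<cdot> bang C Y = unit_map H \<cdot> bang C Y"
proof -
  note f = group_hom_typing[OF assms(1)]
  let ?e = "unit_map G \<cdot> bang C Y"
  have "mul H \<cdot> pair C (f \<cdot> ?e) (f \<cdot> ?e) = f \<cdot> mul G \<cdot> pair C ?e ?e"
    using assms(2) f by (intro group_hom_mul[OF assms(1), symmetric]) simp_all
  also have "\<dots> = mul H \<cdot> pair C (f \<cdot> ?e) (unit_map H \<cdot> bang C Y)"
    using assms(2) f by simp
  finally have "mul H \<cdot> pair C (f \<cdot> ?e) (f \<cdot> ?e) = mul H \<cdot> pair C (f \<cdot> ?e) (unit_map H \<cdot> bang C Y)" .
  \<comment> \<open>Each underscore leaves a typing premise that precedes the equation as a subgoal.\<close>
  with _ _ _ _ _ _ _ _ _ show ?thesis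
    by (rule mul_cancel_left[of H "f \<cdot> ?e"]) (use assms(2) f in simp_all)
qed

lemma group_hom_inverse:
  assumes "(G, f, H) \<in> Ar (Grp C)" "x \<in> Ar C" "Cod C x = carr G"
  shows "f \<cdot> inverse_map G \<cdot> x = inverse_map H \<cdot> f \<cdot> x"
proof -
  note f = group_hom_typing[OF assms(1)]
  have "mul H \<cdot> pair C (f \<cdot> x) (f \<cdot> inverse_map G \<cdot> x) = unit_map H \<cdot> bang C (Dom C x)"
    using group_hom_mul[OF assms(1), of x "inverse_map G \<cdot> x"] group_hom_one[OF assms(1), of "Dom C x"]
      assms f by simp
  thus ?thesis using assms f by (intro inverse_unique[of H "f \<cdot> x"]) simp_all
qed

text \<open>
  Since \<open>j\<close> is mono, each group law of \<open>S\<close> may be checked after composing with \<open>j\<close>, where it is a law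
  of \<open>H\<close>. This yields both the kernel and the group \<open>s\<^sup>*G\<^sub>X\<close> over \<open>Q\<close>.
\<close>

lemma subgroup_object:
  assumes H: "group_object C H"
    and j: "j \<in> Ar C" "Dom C j = carr S" "Cod C j = carr H"
    and mono: "\<And>u v. \<lbrakk>u \<in> Ar C; v \<in> Ar C; Cod C u = carr S; Cod C v = carr S; j \<cdot> u = j \<cdot> v\<rbrakk> \<Longrightarrow> u = v"
    and S: "mul S \<in> hom C (prd C (carr S) (carr S)) (carr S)"
      "inverse_map S \<in> hom C (carr S) (carr S)" "unit_map S \<in> hom C (one C) (carr S)"
    and closed: "j \<cdot> mul S = mul H \<cdot> cross C j j" "j \<cdot> inverse_map S = inverse_map H \<cdot> j"
      "j \<cdot> unit_map S = unit_map H"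
  shows "group_object C S"
proof -
  have A [simp]: "carr S \<in> Ob C" using j Dom_Ob[of j] by simp
  have S' [simp]: "mul S \<in> Ar C" "Dom C (mul S) = prd C (carr S) (carr S)" "Cod C (mul S) = carr S"
    "inverse_map S \<in> Ar C" "Dom C (inverse_map S) = carr S" "Cod C (inverse_map S) = carr S"
    "unit_map S \<in> Ar C" "Dom C (unit_map S) = one C" "Cod C (unit_map S) = carr S"
    using S by (auto simp: hom_def)
  note [simp] = H j
  have m: "j \<cdot> mul S \<cdot> pair C x y = mul H \<cdot> pair C (j \<cdot> x) (j \<cdot> y)"
    if "x \<in> Ar C" "y \<in> Ar C" "Cod C x = carr S" "Cod C y = carr S" "Dom C x = Dom C y" for x y
  proof -
    have "(j \<cdot> mul S) \<cdot> pair C x y = (mul H \<cdot> cross C j j) \<cdot> pair C x y"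
      by (simp only: closed)
    thus ?thesis using that by simp
  qed
  have i: "j \<cdot> inverse_map S \<cdot> x = inverse_map H \<cdot> j \<cdot> x" if "x \<in> Ar C" "Cod C x = carr S" for x
    using that by (intro comp_eq_precomp[OF closed(2)]) simp_all
  have e: "j \<cdot> unit_map S \<cdot> x = unit_map H \<cdot> x" if "x \<in> Ar C" "Cod C x = one C" for x
  proof -
    have "(j \<cdot> unit_map S) \<cdot> x = unit_map H \<cdot> x" by (simp only: closed)
    thus ?thesis using that by simp
  qed
  have "mul S \<cdot> cross C (mul S) (Idt C (carr S)) \<cdot> assoc C (carr S) (carr S) (carr S)
      = mul S \<cdot> cross C (Idt C (carr S)) (mul S)"
  proof (rule prd3_extensionality)
    fix x y z
    assume xyz: "x \<in> Ar C" "y \<in> Ar C" "z \<in> Ar C" "Dom C x = Dom C z" "Dom C y = Dom C z"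
      "Cod C x = carr S" "Cod C y = carr S" "Cod C z = carr S"
    have "mul S \<cdot> pair C (mul S \<cdot> pair C x y) z = mul S \<cdot> pair C x (mul S \<cdot> pair C y z)"
      by (rule mono) (use xyz in \<open>simp_all add: m\<close>)
    thus "(mul S \<cdot> cross C (mul S) (Idt C (carr S)) \<cdot> assoc C (carr S) (carr S) (carr S)) \<cdot>
          pair C x (pair C y z)
        = (mul S \<cdot> cross C (Idt C (carr S)) (mul S)) \<cdot> pair C x (pair C y z)"
      using xyz by simp
  qed simp_all
  moreover have "mul S \<cdot> pair C (unit_map S \<cdot> bang C (carr S)) (Idt C (carr S)) = Idt C (carr S)"
    "mul S \<cdot> pair C (Idt C (carr S)) (unit_map S \<cdot> bang C (carr S)) = Idt C (carr S)"
    "mul S \<cdot> pair C (inverse_map S) (Idt C (carr S)) = unit_map S \<cdot> bang C (carr S)"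
    "mul S \<cdot> pair C (Idt C (carr S)) (inverse_map S) = unit_map S \<cdot> bang C (carr S)"
    by (rule mono; simp add: m e closed(2))+
  ultimately show ?thesis
    using S A unfolding group_object_def Let_def by blast
qed

lemma action_typing [simp]:
  assumes "action C G X a"
  shows "X \<in> Ob C" "a \<in> Ar C" "Dom C a = prd C (carr G) X" "Cod C a = X"
  using assms by (auto simp: action_def hom_def)

lemma action_one:
  assumes "group_object C G" "action C G X a" "x \<in> Ar C" "Cod C x = X" "Dom C x = Y"
  shows "a \<cdot> pair C (unit_map G \<cdot> bang C Y) x = x"
proof -
  have "(a \<cdot> pair C (unit_map G \<cdot> bang C X) (Idt C X)) \<cdot> x = Idt C X \<cdot> x"
    using assms(2) unfolding action_def by simp
  thus ?thesis using assms action_typing[OF assms(2)] by simp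
qed

lemma action_mul:
  assumes "group_object C G" "action C G X a" "g \<in> Ar C" "h \<in> Ar C" "x \<in> Ar C"
    "Cod C g = carr G" "Cod C h = carr G" "Cod C x = X" "Dom C g = Dom C x" "Dom C h = Dom C x"
  shows "a \<cdot> pair C (mul G \<cdot> pair C g h) x = a \<cdot> pair C g (a \<cdot> pair C h x)"
proof -
  have "(a \<cdot> cross C (mul G) (Idt C X) \<cdot> assoc C (carr G) (carr G) X) \<cdot> pair C g (pair C h x)
     = (a \<cdot> cross C (Idt C (carr G)) a) \<cdot> pair C g (pair C h x)"
    using assms(2) unfolding action_def by simp
  thus ?thesis using assms action_typing[OF assms(2)] by simp
qed

lemma actionI:
  assumes "group_object C G" "X \<in> Ob C" "a \<in> Ar C" "Dom C a = prd C (carr G) X" "Cod C a = X"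
    and one: "\<And>x. \<lbrakk>x \<in> Ar C; Cod C x = X\<rbrakk> \<Longrightarrow> a \<cdot> pair C (unit_map G \<cdot> bang C (Dom C x)) x = x"
    and mul: "\<And>g h x. \<lbrakk>g \<in> Ar C; h \<in> Ar C; x \<in> Ar C; Cod C g = carr G; Cod C h = carr G; Cod C x = X;
        Dom C g = Dom C x; Dom C h = Dom C x\<rbrakk>
      \<Longrightarrow> a \<cdot> pair C (mul G \<cdot> pair C g h) x = a \<cdot> pair C g (a \<cdot> pair C h x)"
  shows "action C G X a"
  unfolding action_def
proof (intro conjI)
  show "a \<cdot> pair C (unit_map G \<cdot> bang C X) (Idt C X) = Idt C X"
    using one[of "Idt C X"] assms by simp
  show "a \<cdot> cross C (mul G) (Idt C X) \<cdot> assoc C (carr G) (carr G) X = a \<cdot> cross C (Idt C (carr G)) a"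
    by (rule prd3_extensionality[of _ _ "carr G" "carr G" X]) (use assms(1-5) in \<open>simp_all add: mul\<close>)
qed (use assms in \<open>simp_all add: hom_def\<close>)

text \<open>
  The preservation hypothesis has the constant factor on the left; conjugating with the swap of the two
  factors moves it to the right.
\<close>

lemma cross_right_coequaliser:
  assumes ppc: "products_preserve_coequalisers C" and q: "is_coequaliser C f g q" and A: "A \<in> Ob C"
  shows "is_coequaliser C (cross C f (Idt C A)) (cross C g (Idt C A)) (cross C q (Idt C A))"
proof -
  note [simp] = coequaliser_typing(1-6)[OF q] A
  have l: "is_coequaliser C (cross C (Idt C A) f) (cross C (Idt C A) g) (cross C (Idt C A) q)"
    using ppc q A unfolding products_preserve_coequalisers_def by blast
  have qe: "q \<cdot> f \<cdot> x = q \<cdot> g \<cdot> x" if "x \<in> Ar C" "Cod C x = Dom C f" for x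
    using that by (intro comp_eq_precomp[OF coequaliser_typing(7)[OF q]]) simp_all
  show ?thesis
  proof (rule coequaliserI)
    show "cross C q (Idt C A) \<cdot> cross C f (Idt C A) = cross C q (Idt C A) \<cdot> cross C g (Idt C A)"
      by (rule prd_extensionality[of _ _ "Dom C f" A]) (simp_all add: qe)
  next
    fix h
    assume h: "h \<in> Ar C" "Dom C h = Cod C (cross C f (Idt C A))"
      "h \<cdot> cross C f (Idt C A) = h \<cdot> cross C g (Idt C A)"
    let ?sw = "pair C (prr C A (Cod C f)) (prl C A (Cod C f))"
    have he: "h \<cdot> pair C (f \<cdot> x) y = h \<cdot> pair C (g \<cdot> x) y"
      if "x \<in> Ar C" "y \<in> Ar C" "Cod C x = Dom C f" "Cod C y = A" "Dom C x = Dom C y" for x y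
      using comp_eq_precomp[OF h(3), of "pair C x y"] h(1,2) that by simp
    have "(h \<cdot> ?sw) \<cdot> cross C (Idt C A) f = (h \<cdot> ?sw) \<cdot> cross C (Idt C A) g"
      by (rule prd_extensionality[of _ _ A "Dom C f"]) (use h(1,2) in \<open>simp_all add: he\<close>)
    then obtain k where k: "k \<in> Ar C" "Dom C k = Cod C (cross C (Idt C A) q)" "Cod C k = Cod C h"
      "k \<cdot> cross C (Idt C A) q = h \<cdot> ?sw"
      using coequaliser_lift[OF l, of "h \<cdot> ?sw"] h(1,2) by auto
    let ?sw' = "pair C (prr C (Cod C q) A) (prl C (Cod C q) A)"
    have ke: "k \<cdot> pair C x (q \<cdot> y) = h \<cdot> pair C y x"
      if "x \<in> Ar C" "y \<in> Ar C" "Cod C x = A" "Cod C y = Cod C f" "Dom C x = Dom C y" for x y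
      using comp_eq_precomp[OF k(4), of "pair C x y"] k(1,2) h(1,2) that by simp
    have "(k \<cdot> ?sw') \<cdot> cross C q (Idt C A) = h"
      by (rule prd_extensionality[of _ _ "Cod C f" A]) (use h(1,2) k(1-3) in \<open>simp_all add: ke\<close>)
    thus "\<exists>k\<in>Ar C. Dom C k = Cod C (cross C q (Idt C A)) \<and> Cod C k = Cod C h \<and> k \<cdot> cross C q (Idt C A) = h"
      using k(1-3) by (intro bexI[of _ "k \<cdot> ?sw'"]) simp_all
  next
    fix u v
    assume uv: "u \<in> Ar C" "v \<in> Ar C" "Dom C u = Cod C (cross C q (Idt C A))"
      "Dom C v = Cod C (cross C q (Idt C A))" "u \<cdot> cross C q (Idt C A) = v \<cdot> cross C q (Idt C A)"
    let ?sw = "pair C (prr C A (Cod C q)) (prl C A (Cod C q))"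
    have e: "u \<cdot> pair C (q \<cdot> x) y = v \<cdot> pair C (q \<cdot> x) y"
      if "x \<in> Ar C" "y \<in> Ar C" "Cod C x = Cod C f" "Cod C y = A" "Dom C x = Dom C y" for x y
      using comp_eq_precomp[OF uv(5), of "pair C x y"] uv(1-4) that by simp
    have "(u \<cdot> ?sw) \<cdot> cross C (Idt C A) q = (v \<cdot> ?sw) \<cdot> cross C (Idt C A) q"
      by (rule prd_extensionality[of _ _ A "Cod C f"]) (use uv(1-4) in \<open>simp_all add: e\<close>)
    with _ _ _ _ have *: "u \<cdot> ?sw = v \<cdot> ?sw"
      by (rule coequaliser_epi[OF l]) (use uv(1-4) in simp_all)
    show "u = v"
    proof (rule prd_extensionality[of u v "Cod C q" A])
      fix x y
      assume xy: "x \<in> Ar C" "y \<in> Ar C" "Dom C x = Dom C y" "Cod C x = Cod C q" "Cod C y = A"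
      show "u \<cdot> pair C x y = v \<cdot> pair C x y"
        using comp_eq_precomp[OF *, of "pair C y x"] uv(1-4) xy by simp
    qed (use uv in simp_all)
  qed simp_all
qed

end

section \<open>The condition OST on generalised elements\<close>

context finite_limits
begin

lemma stab_typing [simp]:
  assumes "A \<in> Ob C" "X \<in> Ob C" "a \<in> Ar C" "Dom C a = prd C A X" "Cod C a = X"
  shows "stab_incl C A X a \<in> Ar C" "Cod C (stab_incl C A X a) = prd C A X"
    "stab_map C A X a \<in> Ar C" "Dom C (stab_map C A X a) = Dom C (stab_incl C A X a)"
    "Cod C (stab_map C A X a) = X"
  using eqz_props[of a "prr C A X"] assms by (simp_all add: stab_incl_def stab_map_def)

lemma stab_incl_fixes:
  assumes "A \<in> Ob C" "X \<in> Ob C" "a \<in> Ar C" "Dom C a = prd C A X" "Cod C a = X"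
  shows "a \<cdot> stab_incl C A X a = prr C A X \<cdot> stab_incl C A X a"
  using eqz_props(3)[of a "prr C A X"] assms by (simp add: stab_incl_def)

lemma stab_element:
  assumes "A \<in> Ob C" "X \<in> Ob C" "a \<in> Ar C" "Dom C a = prd C A X" "Cod C a = X"
    and "k \<in> Ar C" "x \<in> Ar C" "Dom C k = Dom C x" "Cod C k = A" "Cod C x = X" "a \<cdot> pair C k x = x"
  obtains z where "z \<in> Ar C" "Dom C z = Dom C x" "Cod C z = Dom C (stab_incl C A X a)"
    "stab_incl C A X a \<cdot> z = pair C k x"
  using eqlift_props[of a "prr C A X" "pair C k x"] assms that[of "eqlift C a (prr C A X) (pair C k x)"]
  by (simp add: stab_incl_def)

lemma stab_mono:
  assumes "A \<in> Ob C" "X \<in> Ob C" "a \<in> Ar C" "Dom C a = prd C A X" "Cod C a = X"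
    and "u \<in> Ar C" "v \<in> Ar C" "Cod C u = Dom C (stab_incl C A X a)"
    "Cod C v = Dom C (stab_incl C A X a)"
    "stab_incl C A X a \<cdot> u = stab_incl C A X a \<cdot> v"
  shows "u = v"
  by (rule eqz_mono[of a "prr C A X"]) (use assms in \<open>simp_all add: stab_incl_def\<close>)

end

locale fixed_section = finite_limits C for C :: "('o, 'm, 'z) lcat_scheme" (structure) +
  fixes G :: "('o, 'm) grp" and X :: 'o and a q s :: 'm
  assumes OST: "OST C"
    and group [simp]: "group_object C G"
    and action [simp]: "action C G X a"
    and quotient: "is_quotient C (carr G) X a q"
    and "section": "is_section C s q"
begin

abbreviation "Q \<equiv> Cod C q"
abbreviation "incl \<equiv> stab_incl C (carr G) X a"
abbreviation "stab \<equiv> stab_map C (carr G) X a"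

text \<open>The underlying object of \<open>s\<^sup>*G\<^sub>X\<close>, its projection to the quotient and its projection to \<open>G\<close>.\<close>

abbreviation "fibre \<equiv> Dom C (pbeq C stab s)"
abbreviation "base \<equiv> pbr C stab s"
abbreviation "grp_part \<equiv> prl C (carr G) X \<cdot> incl \<cdot> pbl C stab s"

lemmas action_rules [simp] = action_typing[OF action] action_one[OF group action]
  action_mul[OF group action]

lemma qs_typing [simp]:
  "q \<in> Ar C" "Dom C q = X" "s \<in> Ar C" "Dom C s = Q" "Cod C s = X" "Q \<in> Ob C"
  using quotient "section" Cod_Ob[of q]
  by (auto simp: is_quotient_def is_coequaliser_def is_section_def hom_def)

lemma q_s [simp]: "\<lbrakk>y \<in> Ar C; Cod C y = Q\<rbrakk> \<Longrightarrow> q \<cdot> s \<cdot> y = y"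
proof -
  assume y: "y \<in> Ar C" "Cod C y = Q"
  have "(q \<cdot> s) \<cdot> y = Idt C Q \<cdot> y" using "section" by (simp add: is_section_def)
  thus ?thesis using y by simp
qed

lemma q_action [simp]:
  assumes "g \<in> Ar C" "x \<in> Ar C" "Dom C g = Dom C x" "Cod C g = carr G" "Cod C x = X"
  shows "q \<cdot> a \<cdot> pair C g x = q \<cdot> x"
proof -
  have "q \<cdot> a = q \<cdot> prr C (carr G) X"
    using quotient coequaliser_typing(7) unfolding is_quotient_def by blast
  from comp_eq_precomp[OF this, of "pair C g x"] show ?thesis using assms by simp
qed

lemma fibre_typing [simp]:
  "base \<in> Ar C" "Dom C base = fibre" "Cod C base = Q"
  "pbl C stab s \<in> Ar C" "Dom C (pbl C stab s) = fibre" "Cod C (pbl C stab s) = Dom C incl"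
  "fibre \<in> Ob C"
  using pb_typing[of stab s] Dom_Ob[of base] by simp_all

lemma fibre_incl:
  assumes "z \<in> Ar C" "Cod C z = fibre"
  shows "incl \<cdot> pbl C stab s \<cdot> z = pair C (grp_part \<cdot> z) (s \<cdot> base \<cdot> z)"
proof (rule prd_eqI[of _ _ "carr G" X])
  have "stab \<cdot> pbl C stab s \<cdot> z = s \<cdot> base \<cdot> z"
    using pb_commutes[of stab s] assms by (intro comp_eq_precomp) simp_all
  hence "prr C (carr G) X \<cdot> incl \<cdot> pbl C stab s \<cdot> z = s \<cdot> base \<cdot> z"
    using assms by (simp add: stab_map_def)
  thus "prr C (carr G) X \<cdot> incl \<cdot> pbl C stab s \<cdot> z
      = prr C (carr G) X \<cdot> pair C (grp_part \<cdot> z) (s \<cdot> base \<cdot> z)"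
    using assms by simp
qed (use assms in simp_all)

lemma fibre_stabilises:
  assumes "z \<in> Ar C" "Cod C z = fibre"
  shows "a \<cdot> pair C (grp_part \<cdot> z) (s \<cdot> base \<cdot> z) = s \<cdot> base \<cdot> z"
proof -
  have "a \<cdot> incl \<cdot> pbl C stab s \<cdot> z = prr C (carr G) X \<cdot> incl \<cdot> pbl C stab s \<cdot> z"
    using assms stab_incl_fixes[of "carr G" X a] by (intro comp_eq_precomp) simp_all
  also have "\<dots> = prr C (carr G) X \<cdot> pair C (grp_part \<cdot> z) (s \<cdot> base \<cdot> z)"
    by (simp only: fibre_incl[OF assms, symmetric])
  also have "\<dots> = s \<cdot> base \<cdot> z" using assms by simp
  finally show ?thesis by (simp only: fibre_incl[OF assms])
qed

lemma fibre_element: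
  assumes "k \<in> Ar C" "y \<in> Ar C" "Dom C k = Dom C y" "Cod C k = carr G" "Cod C y = Q"
    "a \<cdot> pair C k (s \<cdot> y) = s \<cdot> y"
  obtains z where "z \<in> Ar C" "Dom C z = Dom C y" "Cod C z = fibre" "base \<cdot> z = y" "grp_part \<cdot> z = k"
proof -
  obtain w where w: "w \<in> Ar C" "Dom C w = Dom C y" "Cod C w = Dom C incl" "incl \<cdot> w = pair C k (s \<cdot> y)"
    using stab_element[of "carr G" X a k "s \<cdot> y"] assms by auto
  have "stab \<cdot> w = s \<cdot> y" using w assms by (simp add: stab_map_def)
  with w(1-3) have "pblift C stab s w y \<in> Ar C" "Dom C (pblift C stab s w y) = Dom C y"
    "Cod C (pblift C stab s w y) = fibre" "pbl C stab s \<cdot> pblift C stab s w y = w"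
    "base \<cdot> pblift C stab s w y = y"
    using assms pblift_props[of stab s w y] by simp_all
  thus ?thesis using that[of "pblift C stab s w y"] w(4) assms by simp
qed

lemma OST_coequaliser:
  "is_coequaliser C (cross C (Idt C (carr G)) base)
     (cross C (mul G) q \<cdot> assoc C (carr G) (carr G) X \<cdot>
       cross C (Idt C (carr G)) incl \<cdot> cross C (Idt C (carr G)) (pbl C stab s))
     (a \<cdot> cross C (Idt C (carr G)) s)"
  using OST group action quotient "section" unfolding OST_def Let_def by blast

text \<open>
  In terms of generalised elements \<open>OST\<close> says that \<open>X\<close> is \<open>G \<times> Q\<close> with \<open>(g k, y)\<close> and \<open>(g, y)\<close>
  identified whenever \<open>k\<close> stabilises \<open>s y\<close>.
\<close>

lemma OST_lift:
  assumes h: "h \<in> Ar C" "Dom C h = prd C (carr G) Q"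
    and inv: "\<And>g k y. \<lbrakk>g \<in> Ar C; k \<in> Ar C; y \<in> Ar C; Dom C g = Dom C y; Dom C k = Dom C y;
        Cod C g = carr G; Cod C k = carr G; Cod C y = Q; a \<cdot> pair C k (s \<cdot> y) = s \<cdot> y\<rbrakk>
      \<Longrightarrow> h \<cdot> pair C (mul G \<cdot> pair C g k) y = h \<cdot> pair C g y"
  obtains h' where "h' \<in> Ar C" "Dom C h' = X" "Cod C h' = Cod C h"
    "\<And>g y. \<lbrakk>g \<in> Ar C; y \<in> Ar C; Dom C g = Dom C y; Cod C g = carr G; Cod C y = Q\<rbrakk>
      \<Longrightarrow> h' \<cdot> a \<cdot> pair C g (s \<cdot> y) = h \<cdot> pair C g y"
proof -
  have "h \<cdot> cross C (Idt C (carr G)) base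
    = h \<cdot> cross C (mul G) q \<cdot> assoc C (carr G) (carr G) X \<cdot>
       cross C (Idt C (carr G)) incl \<cdot> cross C (Idt C (carr G)) (pbl C stab s)"
  proof (rule prd_extensionality[of _ _ "carr G" fibre])
    fix g z
    assume gz: "g \<in> Ar C" "z \<in> Ar C" "Dom C g = Dom C z" "Cod C g = carr G" "Cod C z = fibre"
    define k where "k = grp_part \<cdot> z"
    have [simp]: "k \<in> Ar C" "Dom C k = Dom C z" "Cod C k = carr G"
      using gz unfolding k_def by simp_all
    have k: "incl \<cdot> pbl C stab s \<cdot> z = pair C k (s \<cdot> base \<cdot> z)"
      unfolding k_def using gz by (intro fibre_incl)
    have "a \<cdot> pair C k (s \<cdot> base \<cdot> z) = s \<cdot> base \<cdot> z"
      unfolding k_def using gz by (intro fibre_stabilises)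
    with gz have "h \<cdot> pair C (mul G \<cdot> pair C g k) (base \<cdot> z) = h \<cdot> pair C g (base \<cdot> z)"
      by (intro inv) simp_all
    thus "(h \<cdot> cross C (Idt C (carr G)) base) \<cdot> pair C g z
      = (h \<cdot> cross C (mul G) q \<cdot> assoc C (carr G) (carr G) X \<cdot>
         cross C (Idt C (carr G)) incl \<cdot> cross C (Idt C (carr G)) (pbl C stab s)) \<cdot> pair C g z"
      using gz h by (simp add: k)
  qed (use h in simp_all)
  then obtain k where k: "k \<in> Ar C" "Dom C k = X" "Cod C k = Cod C h"
    "k \<cdot> a \<cdot> cross C (Idt C (carr G)) s = h"
    using coequaliser_lift[OF OST_coequaliser, of h] h by auto
  have "k \<cdot> a \<cdot> pair C g (s \<cdot> y) = h \<cdot> pair C g y"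
    if "g \<in> Ar C" "y \<in> Ar C" "Dom C g = Dom C y" "Cod C g = carr G" "Cod C y = Q" for g y
  proof -
    have "(k \<cdot> a \<cdot> cross C (Idt C (carr G)) s) \<cdot> pair C g y = h \<cdot> pair C g y"
      by (simp only: k)
    thus ?thesis using that k(1-3) by simp
  qed
  thus ?thesis using that k by blast
qed

lemma OST_epi:
  assumes "u \<in> Ar C" "v \<in> Ar C" "Dom C u = X" "Dom C v = X"
    and "\<And>g y. \<lbrakk>g \<in> Ar C; y \<in> Ar C; Dom C g = Dom C y; Cod C g = carr G; Cod C y = Q\<rbrakk>
      \<Longrightarrow> u \<cdot> a \<cdot> pair C g (s \<cdot> y) = v \<cdot> a \<cdot> pair C g (s \<cdot> y)"
  shows "u = v"
proof -
  have "u \<cdot> a \<cdot> cross C (Idt C (carr G)) s = v \<cdot> a \<cdot> cross C (Idt C (carr G)) s"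
    by (rule prd_extensionality[of _ _ "carr G" Q]) (use assms in simp_all)
  with _ _ _ _ show ?thesis
    by (rule coequaliser_epi[OF OST_coequaliser]) (use assms in simp_all)
qed

text \<open>
  A free action whose quotient map has a section is trivial: the stabilisers impose no
  identification.
\<close>

lemma free_trivial:
  assumes "free_action C (carr G) X a"
  shows "is_iso C (a \<cdot> cross C (Idt C (carr G)) s)"
proof -
  let ?psi = "a \<cdot> cross C (Idt C (carr G)) s"
  have stab_trivial: "k = unit_map G \<cdot> bang C (Dom C y)"
    if y: "k \<in> Ar C" "y \<in> Ar C" "Dom C k = Dom C y" "Cod C k = carr G" "Cod C y = Q"
      "a \<cdot> pair C k (s \<cdot> y) = s \<cdot> y" for k y
  proof -
    let ?e = "unit_map G \<cdot> bang C (Dom C y)"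
    obtain u where u: "u \<in> Ar C" "Dom C u = Dom C (s \<cdot> y)" "Cod C u = Dom C incl"
      "incl \<cdot> u = pair C k (s \<cdot> y)"
      by (rule stab_element[of "carr G" X a k "s \<cdot> y"]) (use y in simp_all)
    obtain v where v: "v \<in> Ar C" "Dom C v = Dom C (s \<cdot> y)" "Cod C v = Dom C incl"
      "incl \<cdot> v = pair C ?e (s \<cdot> y)"
      by (rule stab_element[of "carr G" X a ?e "s \<cdot> y"]) (use y(1-5) in simp_all)
    have "stab \<cdot> u = stab \<cdot> v" using u v y(1-5) by (simp add: stab_map_def)
    with _ _ _ _ _ have "u = v"
      by (rule iso_cancel_left) (use assms u v in \<open>simp_all add: free_action_def\<close>)
    hence "pair C k (s \<cdot> y) = pair C ?e (s \<cdot> y)" using u v by simp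
    thus ?thesis by (rule pair_inject) (use y(1-5) in simp_all)
  qed
  obtain r where r: "r \<in> Ar C" "Dom C r = X" "Cod C r = Cod C (Idt C (prd C (carr G) Q))"
    "\<And>g y. \<lbrakk>g \<in> Ar C; y \<in> Ar C; Dom C g = Dom C y; Cod C g = carr G; Cod C y = Q\<rbrakk>
      \<Longrightarrow> r \<cdot> a \<cdot> pair C g (s \<cdot> y) = Idt C (prd C (carr G) Q) \<cdot> pair C g y"
  proof (rule OST_lift[of "Idt C (prd C (carr G) Q)"])
    fix g k y
    assume gky: "g \<in> Ar C" "k \<in> Ar C" "y \<in> Ar C" "Dom C g = Dom C y" "Dom C k = Dom C y"
        "Cod C g = carr G" "Cod C k = carr G" "Cod C y = Q" "a \<cdot> pair C k (s \<cdot> y) = s \<cdot> y"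
    show "Idt C (prd C (carr G) Q) \<cdot> pair C (mul G \<cdot> pair C g k) y
        = Idt C (prd C (carr G) Q) \<cdot> pair C g y"
      using gky(1,3-6,8) by (simp add: stab_trivial[OF gky(2,3,5,7,8,9)])
  qed simp_all
  show ?thesis
  proof (rule is_isoI[of _ r])
    show "r \<cdot> ?psi = Idt C (Dom C ?psi)"
      by (rule prd_extensionality[of _ _ "carr G" Q]) (use r(1-3) in \<open>simp_all add: r(4)\<close>)
    show "?psi \<cdot> r = Idt C (Cod C ?psi)"
      by (rule OST_epi) (use r(1-3) in \<open>simp_all add: r(4)\<close>)
  qed (use r(1-3) in simp_all)
qed

end

context finite_limits
begin

lemma kernel_incl_typing:
  assumes "(P, f, G) \<in> Ar (Grp C)"
  shows "kernel_incl C (P, f, G) \<in> Ar C" "Cod C (kernel_incl C (P, f, G)) = carr P"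
  using eqz_props[of f "unit_map G \<cdot> bang C (carr P)"] group_hom_typing[OF assms]
  by (simp_all add: kernel_incl_def)

lemma kernel_incl_kills:
  assumes "(P, f, G) \<in> Ar (Grp C)" "x \<in> Ar C" "Cod C x = Dom C (kernel_incl C (P, f, G))"
  shows "f \<cdot> kernel_incl C (P, f, G) \<cdot> x = unit_map G \<cdot> bang C (Dom C x)"
proof -
  let ?k = "kernel_incl C (P, f, G)"
  note [simp] = group_hom_typing[OF assms(1)] kernel_incl_typing[OF assms(1)]
  have "f \<cdot> ?k = (unit_map G \<cdot> bang C (carr P)) \<cdot> ?k"
    using eqz_props(3)[of f "unit_map G \<cdot> bang C (carr P)"] by (simp add: kernel_incl_def)
  from comp_eq_precomp[OF this, of x] show ?thesis using assms(2,3) by simp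
qed

lemma kernel_element:
  assumes "(P, f, G) \<in> Ar (Grp C)" "c \<in> Ar C" "Cod C c = carr P"
    "f \<cdot> c = unit_map G \<cdot> bang C (Dom C c)"
  obtains x where "x \<in> Ar C" "Dom C x = Dom C c" "Cod C x = Dom C (kernel_incl C (P, f, G))"
    "kernel_incl C (P, f, G) \<cdot> x = c"
  using eqlift_props[of f "unit_map G \<cdot> bang C (carr P)" c] group_hom_typing[OF assms(1)] assms(2-)
    that[of "eqlift C f (unit_map G \<cdot> bang C (carr P)) c"]
  by (simp add: kernel_incl_def)

text \<open>
  The kernel is closed under the operations of \<open>P\<close>, so they lift through the equaliser.
\<close>

lemma kernel_group_object:
  assumes hom: "(P, f, G) \<in> Ar (Grp C)"
  defines "k \<equiv> kernel_incl C (P, f, G)"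
  obtains K where "group_object C K" "carr K = Dom C k" "(K, k, P) \<in> Ar (Grp C)"
proof -
  note [simp] = group_hom_typing[OF hom] kernel_incl_typing[OF hom, folded k_def]
    kernel_incl_kills[OF hom, folded k_def]
  have K [simp]: "Dom C k \<in> Ob C" by simp
  have "f \<cdot> mul P \<cdot> cross C k k = unit_map G \<cdot> bang C (Dom C (mul P \<cdot> cross C k k))"
    by (rule prd_extensionality[of _ _ "Dom C k" "Dom C k"]) (simp_all add: group_hom_mul[OF hom])
  then obtain m where m: "m \<in> Ar C" "Dom C m = prd C (Dom C k) (Dom C k)" "Cod C m = Dom C k"
    "k \<cdot> m = mul P \<cdot> cross C k k"
    using kernel_element[OF hom, folded k_def, of "mul P \<cdot> cross C k k"] by auto
  have "f \<cdot> inverse_map P \<cdot> k = inverse_map G \<cdot> f \<cdot> k \<cdot> Idt C (Dom C k)"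
    by (simp add: group_hom_inverse[OF hom] del: kernel_incl_kills)
  also have "\<dots> = unit_map G \<cdot> bang C (Dom C (inverse_map P \<cdot> k))"
    by (subst kernel_incl_kills[OF hom, folded k_def]) simp_all
  finally obtain i where i: "i \<in> Ar C" "Dom C i = Dom C k" "Cod C i = Dom C k"
    "k \<cdot> i = inverse_map P \<cdot> k"
    using kernel_element[OF hom, folded k_def, of "inverse_map P \<cdot> k"] by auto
  have "f \<cdot> unit_map P = unit_map G \<cdot> bang C (Dom C (unit_map P))"
    using group_hom_one[OF hom, of "one C"] by simp
  then obtain e where e: "e \<in> Ar C" "Dom C e = one C" "Cod C e = Dom C k" "k \<cdot> e = unit_map P"
    using kernel_element[OF hom, folded k_def, of "unit_map P"] by auto
  let ?K = "\<lparr>carr = Dom C k, mul = m, inverse_map = i, unit_map = e\<rparr>"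
  have "group_object C ?K"
  proof (rule subgroup_object[of P k])
    fix u v
    assume "u \<in> Ar C" "v \<in> Ar C" "Cod C u = carr ?K" "Cod C v = carr ?K" "k \<cdot> u = k \<cdot> v"
    thus "u = v"
      using eqz_mono[of f "unit_map G \<cdot> bang C (carr P)" u v] by (simp add: k_def kernel_incl_def)
  qed (use m i e in \<open>simp_all add: hom_def\<close>)
  moreover from this have "(?K, k, P) \<in> Ar (Grp C)"
    using m unfolding Grp_Ar by (simp add: hom_def)
  ultimately show ?thesis using that by simp
qed

end

section \<open>The comparison map from the standard graph\<close>

context finite_products
begin

lemma prd_elementE:
  assumes "w \<in> Ar C" "Cod C w = prd C A B" "A \<in> Ob C" "B \<in> Ob C"
  obtains x y where "x \<in> Ar C" "y \<in> Ar C" "Dom C x = Dom C w" "Dom C y = Dom C w"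
    "Cod C x = A" "Cod C y = B" "w = pair C x y"
  by (rule that[of "prl C A B \<cdot> w" "prr C A B \<cdot> w"]) (use assms in simp_all)

lemma left_multiplication_action:
  "group_object C G \<Longrightarrow> action C G (carr G) (mul G)"
  by (rule actionI) simp_all

lemma action_restrict:
  assumes "action C P X b" "(K, k, P) \<in> Ar (Grp C)"
  shows "action C K X (b \<cdot> cross C k (Idt C X))"
proof -
  note [simp] = group_hom_typing[OF assms(2)] group_hom_mul[OF assms(2)] group_hom_one[OF assms(2)]
    action_typing[OF assms(1)]
  note [simp] = action_one[OF _ assms(1)] action_mul[OF _ assms(1)]
  show ?thesis by (rule actionI) simp_all
qed

end

context finite_limits
begin

text \<open>
  A homomorphism whose image acts transitively on the target is the quotient by its kernel: \<open>OST\<close> for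
  this action and the section \<open>*\<close> to \<open>G\<close> given by the unit, whose stabiliser is the kernel.
\<close>

lemma transitive_hom_coequaliser:
  assumes OST: "OST C" and hom: "(P, f, G) \<in> Ar (Grp C)"
    and transitive: "is_quotient C (carr P) (carr G) (mul G \<cdot> cross C f (Idt C (carr G))) (bang C (carr G))"
  defines "k \<equiv> kernel_incl C (P, f, G)"
  shows "is_coequaliser C (prl C (carr P) (Dom C k)) (mul P \<cdot> cross C (Idt C (carr P)) k) f"
proof -
  note [simp] = group_hom_typing[OF hom] kernel_incl_typing[OF hom, folded k_def]
    kernel_incl_kills[OF hom, folded k_def]
  interpret orbit: fixed_section C P "carr G" "mul G \<cdot> cross C f (Idt C (carr G))" "bang C (carr G)" "unit_map G"
  proof
    show "is_section C (unit_map G) (bang C (carr G))"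
      by (simp add: is_section_def hom_def)
    show "action C P (carr G) (mul G \<cdot> cross C f (Idt C (carr G)))"
      by (rule action_restrict[OF left_multiplication_action hom]) simp
  qed (use OST transitive in simp_all)
  have orbit_map: "(mul G \<cdot> cross C f (Idt C (carr G))) \<cdot> pair C p (unit_map G \<cdot> y) = f \<cdot> p"
    if "p \<in> Ar C" "y \<in> Ar C" "Dom C p = Dom C y" "Cod C p = carr P" "Cod C y = one C" for p y
    using that bang_unique[of y] mul_one(2)[of G "f \<cdot> p" "Dom C y"] by (simp del: mul_one)
  show ?thesis
  proof (rule coequaliserI)
    show "f \<cdot> prl C (carr P) (Dom C k) = f \<cdot> mul P \<cdot> cross C (Idt C (carr P)) k"
      by (rule prd_extensionality[of _ _ "carr P" "Dom C k"])
        (simp_all add: group_hom_mul[OF hom])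
  next
    fix h
    assume h: "h \<in> Ar C" "Dom C h = Cod C (prl C (carr P) (Dom C k))"
      "h \<cdot> prl C (carr P) (Dom C k) = h \<cdot> mul P \<cdot> cross C (Idt C (carr P)) k"
    have hk: "h \<cdot> mul P \<cdot> pair C p (k \<cdot> x) = h \<cdot> p"
      if "p \<in> Ar C" "x \<in> Ar C" "Dom C p = Dom C x" "Cod C p = carr P" "Cod C x = Dom C k" for p x
      using comp_eq_precomp[OF h(3), of "pair C p x"] h(1,2) that by simp
    obtain h' where h': "h' \<in> Ar C" "Dom C h' = carr G" "Cod C h' = Cod C (h \<cdot> prl C (carr P) (one C))"
      "\<And>p y. \<lbrakk>p \<in> Ar C; y \<in> Ar C; Dom C p = Dom C y; Cod C p = carr P; Cod C y = Cod C (bang C (carr G))\<rbrakk>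
      \<Longrightarrow> h' \<cdot> (mul G \<cdot> cross C f (Idt C (carr G))) \<cdot> pair C p (unit_map G \<cdot> y)
        = (h \<cdot> prl C (carr P) (one C)) \<cdot> pair C p y"
    proof (rule orbit.OST_lift[of "h \<cdot> prl C (carr P) (one C)"])
      fix p c y
      assume pcy: "p \<in> Ar C" "c \<in> Ar C" "y \<in> Ar C" "Dom C p = Dom C y" "Dom C c = Dom C y"
        "Cod C p = carr P" "Cod C c = carr P" "Cod C y = Cod C (bang C (carr G))"
        "(mul G \<cdot> cross C f (Idt C (carr G))) \<cdot> pair C c (unit_map G \<cdot> y) = unit_map G \<cdot> y"
      have y: "y = bang C (Dom C y)" using pcy(3,8) by (intro bang_unique) simp_all
      have "f \<cdot> c = (mul G \<cdot> cross C f (Idt C (carr G))) \<cdot> pair C c (unit_map G \<cdot> y)"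
        using pcy(1-8) by (intro orbit_map[symmetric]) simp_all
      also have "\<dots> = unit_map G \<cdot> bang C (Dom C c)"
        unfolding pcy(9) using y pcy(5) by simp
      finally obtain x where x: "x \<in> Ar C" "Dom C x = Dom C c" "Cod C x = Dom C k" "k \<cdot> x = c"
        using kernel_element[OF hom pcy(2,7)] unfolding k_def by blast
      show "(h \<cdot> prl C (carr P) (one C)) \<cdot> pair C (mul P \<cdot> pair C p c) y
          = (h \<cdot> prl C (carr P) (one C)) \<cdot> pair C p y"
        using hk[of p x] x pcy(1-8) h(1,2) by simp
    qed (use h(1,2) in simp_all)
    have "h' \<cdot> f = h' \<cdot> (mul G \<cdot> cross C f (Idt C (carr G))) \<cdot> pair C (Idt C (carr P)) (unit_map G \<cdot> bang C (carr P))"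
      by (subst orbit_map) simp_all
    also have "\<dots> = (h \<cdot> prl C (carr P) (one C)) \<cdot> pair C (Idt C (carr P)) (bang C (carr P))"
      by (rule h'(4)) simp_all
    also have "\<dots> = h" using h(1,2) by simp
    finally have "h' \<cdot> f = h" .
    thus "\<exists>h'\<in>Ar C. Dom C h' = Cod C f \<and> Cod C h' = Cod C h \<and> h' \<cdot> f = h"
      using h(1,2) h'(1-3) by auto
  next
    fix u v
    assume uv: "u \<in> Ar C" "v \<in> Ar C" "Dom C u = Cod C f" "Dom C v = Cod C f" "u \<cdot> f = v \<cdot> f"
    show "u = v"
    proof (rule orbit.OST_epi)
      fix p y
      assume py: "p \<in> Ar C" "y \<in> Ar C" "Dom C p = Dom C y" "Cod C p = carr P"
        "Cod C y = Cod C (bang C (carr G))"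
      have "u \<cdot> f \<cdot> p = v \<cdot> f \<cdot> p"
        using uv py by (intro comp_eq_precomp) simp_all
      thus "u \<cdot> (mul G \<cdot> cross C f (Idt C (carr G))) \<cdot> pair C p (unit_map G \<cdot> y)
          = v \<cdot> (mul G \<cdot> cross C f (Idt C (carr G))) \<cdot> pair C p (unit_map G \<cdot> y)"
        using py by (simp only: orbit_map bang_typing group_hom_typing[OF hom] group_object_typing)
    qed (use uv in simp_all)
  qed simp_all
qed

lemma transitive_trivial_kernel_iso:
  assumes OST: "OST C" and hom: "(P, f, G) \<in> Ar (Grp C)"
    and transitive: "is_quotient C (carr P) (carr G) (mul G \<cdot> cross C f (Idt C (carr G))) (bang C (carr G))"
  defines "k \<equiv> kernel_incl C (P, f, G)"
  assumes trivial: "k = unit_map P \<cdot> bang C (Dom C k)"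
  shows "is_iso C f"
proof -
  note [simp] = group_hom_typing[OF hom] kernel_incl_typing[OF hom, folded k_def]
  have coeq: "is_coequaliser C (prl C (carr P) (Dom C k)) (mul P \<cdot> cross C (Idt C (carr P)) k) f"
    unfolding k_def by (rule transitive_hom_coequaliser[OF OST hom transitive])
  have k: "k \<cdot> x = unit_map P \<cdot> bang C (Dom C x)" if "x \<in> Ar C" "Cod C x = Dom C k" for x
  proof -
    have "k \<cdot> x = (unit_map P \<cdot> bang C (Dom C k)) \<cdot> x" by (simp only: trivial[symmetric])
    thus ?thesis using that by simp
  qed
  have "Idt C (carr P) \<cdot> prl C (carr P) (Dom C k)
      = Idt C (carr P) \<cdot> mul P \<cdot> cross C (Idt C (carr P)) k"
    by (rule prd_extensionality[of _ _ "carr P" "Dom C k"]) (simp_all add: k)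
  then obtain g where g: "g \<in> Ar C" "Dom C g = carr G" "Cod C g = carr P" "g \<cdot> f = Idt C (carr P)"
    using coequaliser_lift[OF coeq, of "Idt C (carr P)"] by auto
  have "(f \<cdot> g) \<cdot> f = Idt C (carr G) \<cdot> f" using g by simp
  with _ _ _ _ have "f \<cdot> g = Idt C (carr G)"
    by (rule coequaliser_epi[OF coeq]) (use g in simp_all)
  thus ?thesis using g by (intro is_isoI[of f g]) simp_all
qed

end

text \<open>
  The data from which the standard graph is formed, in any category with \<open>OST\<close>: \<open>n\<close> labels the
  elements of \<open>s\<^sup>*G\<^sub>X\<close> by elements of a group \<open>P\<close>, and \<open>\<phi>\<close> recovers from the label the element of \<open>G\<close>.
\<close>

locale labelled_section = fixed_section C G X a q s
  for C :: "('o, 'm, 'z) lcat_scheme" (structure) and G X a q s +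
  fixes P :: "('o, 'm) grp" and \<phi> n t :: 'm
  assumes ppc: "products_preserve_coequalisers C"
    and hom: "(P, \<phi>, G) \<in> Ar (Grp C)"
    and n_typing [simp]: "n \<in> Ar C" "Dom C n = fibre" "Cod C n = prd C (carr P) Q"
    and n_base: "prr C (carr P) Q \<cdot> n = base"
    and n_grp: "\<phi> \<cdot> prl C (carr P) Q \<cdot> n = grp_part"
    and standard: "is_coequaliser C (cross C (Idt C (carr P)) base)
       (cross C (mul P) (Idt C Q) \<cdot> assoc C (carr P) (carr P) Q \<cdot> cross C (Idt C (carr P)) n) t"
begin

abbreviation "T \<equiv> Cod C t"
abbreviation "ker \<equiv> kernel_incl C (P, \<phi>, G)"

lemmas hom_rules [simp] = group_hom_typing[OF hom] group_hom_mul[OF hom] group_hom_one[OF hom]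
  group_hom_inverse[OF hom] kernel_incl_typing[OF hom] kernel_incl_kills[OF hom]

lemma t_typing [simp]: "t \<in> Ar C" "Dom C t = prd C (carr P) Q" "T \<in> Ob C"
  using coequaliser_typing[OF standard] by simp_all

lemma n_element:
  assumes "z \<in> Ar C" "Cod C z = fibre"
  obtains l where "l \<in> Ar C" "Dom C l = Dom C z" "Cod C l = carr P" "n \<cdot> z = pair C l (base \<cdot> z)"
    "\<phi> \<cdot> l = grp_part \<cdot> z"
proof (rule that[of "prl C (carr P) Q \<cdot> n \<cdot> z"])
  show "n \<cdot> z = pair C (prl C (carr P) Q \<cdot> n \<cdot> z) (base \<cdot> z)"
  proof (rule prd_eqI[of _ _ "carr P" Q])
    have "(prr C (carr P) Q \<cdot> n) \<cdot> z = base \<cdot> z" by (simp only: n_base)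
    thus "prr C (carr P) Q \<cdot> n \<cdot> z = prr C (carr P) Q \<cdot> pair C (prl C (carr P) Q \<cdot> n \<cdot> z) (base \<cdot> z)"
      using assms by simp
  qed (use assms in simp_all)
  have "(\<phi> \<cdot> prl C (carr P) Q \<cdot> n) \<cdot> z = grp_part \<cdot> z" by (simp only: n_grp)
  thus "\<phi> \<cdot> prl C (carr P) Q \<cdot> n \<cdot> z = grp_part \<cdot> z" using assms by simp
qed (use assms in simp_all)

text \<open>The elements stabilising \<open>s y\<close> are the values of \<open>\<phi>\<close> on the labels over \<open>y\<close>.\<close>

lemma stabiliser_label:
  assumes "k \<in> Ar C" "y \<in> Ar C" "Dom C k = Dom C y" "Cod C k = carr G" "Cod C y = Q"
    "a \<cdot> pair C k (s \<cdot> y) = s \<cdot> y"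
  obtains l where "l \<in> Ar C" "Dom C l = Dom C y" "Cod C l = carr P" "\<phi> \<cdot> l = k"
    "\<And>p. \<lbrakk>p \<in> Ar C; Dom C p = Dom C y; Cod C p = carr P\<rbrakk>
       \<Longrightarrow> t \<cdot> pair C (mul P \<cdot> pair C p l) y = t \<cdot> pair C p y"
proof -
  obtain z where z: "z \<in> Ar C" "Dom C z = Dom C y" "Cod C z = fibre" "base \<cdot> z = y" "grp_part \<cdot> z = k"
    using fibre_element[OF assms] by blast
  obtain l where l: "l \<in> Ar C" "Dom C l = Dom C z" "Cod C l = carr P"
    "n \<cdot> z = pair C l (base \<cdot> z)" "\<phi> \<cdot> l = grp_part \<cdot> z"
    using n_element[OF z(1,3)] by blast
  have "t \<cdot> pair C (mul P \<cdot> pair C p l) y = t \<cdot> pair C p y"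
    if p: "p \<in> Ar C" "Dom C p = Dom C y" "Cod C p = carr P" for p
  proof -
    have "t \<cdot> cross C (Idt C (carr P)) base \<cdot> pair C p z
      = t \<cdot> (cross C (mul P) (Idt C Q) \<cdot> assoc C (carr P) (carr P) Q \<cdot> cross C (Idt C (carr P)) n) \<cdot> pair C p z"
      using coequaliser_typing(7)[OF standard] p z(1-3) by (intro comp_eq_precomp) simp_all
    thus ?thesis using p z(1-4) l(1-4) assms(2,5) by simp
  qed
  thus ?thesis using that[of l] l z(2,5) by simp
qed

lemma comparison_map_ex1:
  "\<exists>!h. h \<in> hom C T X \<and> h \<cdot> t = (a \<cdot> cross C (Idt C (carr G)) s) \<cdot> cross C \<phi> (Idt C Q)"
proof -
  let ?h = "(a \<cdot> cross C (Idt C (carr G)) s) \<cdot> cross C \<phi> (Idt C Q)"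
  have "?h \<cdot> cross C (Idt C (carr P)) base = ?h \<cdot>
      cross C (mul P) (Idt C Q) \<cdot> assoc C (carr P) (carr P) Q \<cdot> cross C (Idt C (carr P)) n"
  proof (rule prd_extensionality[of _ _ "carr P" fibre])
    fix p z
    assume *: "p \<in> Ar C" "z \<in> Ar C" "Dom C p = Dom C z" "Cod C p = carr P" "Cod C z = fibre"
    obtain l where l: "l \<in> Ar C" "Dom C l = Dom C z" "Cod C l = carr P" "n \<cdot> z = pair C l (base \<cdot> z)"
      "\<phi> \<cdot> l = grp_part \<cdot> z"
      using n_element[OF *(2,5)] by blast
    have "a \<cdot> pair C (\<phi> \<cdot> l) (s \<cdot> base \<cdot> z) = s \<cdot> base \<cdot> z"
      unfolding l(5) by (rule fibre_stabilises[OF *(2,5)])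
    thus "(?h \<cdot> cross C (Idt C (carr P)) base) \<cdot> pair C p z = (?h \<cdot>
      cross C (mul P) (Idt C Q) \<cdot> assoc C (carr P) (carr P) Q \<cdot> cross C (Idt C (carr P)) n) \<cdot> pair C p z"
      using * l(1-4) by simp
  qed simp_all
  then obtain h where h: "h \<in> Ar C" "Dom C h = T" "Cod C h = X" "h \<cdot> t = ?h"
    using coequaliser_lift[OF standard, of ?h] by auto
  show ?thesis
  proof (rule ex1I[of _ h])
    fix h'
    assume "h' \<in> hom C T X \<and> h' \<cdot> t = ?h"
    thus "h' = h" using h by (intro coequaliser_epi[OF standard, of h' h]) (auto simp: hom_def)
  qed (use h in \<open>simp add: hom_def\<close>)
qed

text \<open>
  The parameter \<open>A\<close> allows equations between arrows of several variables to be checked on classes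
  \<open>[p, y]\<close>, because products preserve the coequaliser \<open>t\<close>.
\<close>

lemma T_extensionality:
  assumes "u \<in> Ar C" "v \<in> Ar C" "Dom C u = prd C A T" "Dom C v = prd C A T" "A \<in> Ob C"
    and "\<And>x p y. \<lbrakk>x \<in> Ar C; p \<in> Ar C; y \<in> Ar C; Dom C x = Dom C y; Dom C p = Dom C y;
        Cod C x = A; Cod C p = carr P; Cod C y = Q\<rbrakk>
      \<Longrightarrow> u \<cdot> pair C x (t \<cdot> pair C p y) = v \<cdot> pair C x (t \<cdot> pair C p y)"
  shows "u = v"
proof -
  have coeq: "is_coequaliser C (cross C (Idt C A) (cross C (Idt C (carr P)) base))
       (cross C (Idt C A) (cross C (mul P) (Idt C Q) \<cdot> assoc C (carr P) (carr P) Q \<cdot> cross C (Idt C (carr P)) n))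
       (cross C (Idt C A) t)"
    using ppc standard assms(5) unfolding products_preserve_coequalisers_def by blast
  have "u \<cdot> cross C (Idt C A) t = v \<cdot> cross C (Idt C A) t"
    by (rule prd3_extensionality[of _ _ A "carr P" Q]) (use assms in simp_all)
  with _ _ _ _ show ?thesis
    by (rule coequaliser_epi[OF coeq]) (use assms in simp_all)
qed

lemma T_extensionality_unary:
  assumes "u \<in> Ar C" "v \<in> Ar C" "Dom C u = T" "Dom C v = T"
    and "\<And>p y. \<lbrakk>p \<in> Ar C; y \<in> Ar C; Dom C p = Dom C y; Cod C p = carr P; Cod C y = Q\<rbrakk>
      \<Longrightarrow> u \<cdot> t \<cdot> pair C p y = v \<cdot> t \<cdot> pair C p y"
  shows "u = v"
proof -
  have "u \<cdot> t = v \<cdot> t"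
    by (rule prd_extensionality[of _ _ "carr P" Q]) (use assms in simp_all)
  with _ _ _ _ show ?thesis
    by (rule coequaliser_epi[OF standard]) (use assms in simp_all)
qed

text \<open>On generalised elements, \<open>p [p', y] = [p p', y]\<close>.\<close>

definition act :: 'm where
  "act = (THE b. b \<in> hom C (prd C (carr P) T) T \<and>
     b \<cdot> cross C (Idt C (carr P)) t = t \<cdot> cross C (mul P) (Idt C Q) \<cdot> assoc C (carr P) (carr P) Q)"

lemma act_ex1:
  "\<exists>!b. b \<in> hom C (prd C (carr P) T) T \<and>
     b \<cdot> cross C (Idt C (carr P)) t = t \<cdot> cross C (mul P) (Idt C Q) \<cdot> assoc C (carr P) (carr P) Q"
proof -
  let ?P = "carr P"
  let ?h = "t \<cdot> cross C (mul P) (Idt C Q) \<cdot> assoc C ?P ?P Q"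
  have coeq: "is_coequaliser C (cross C (Idt C ?P) (cross C (Idt C ?P) base))
       (cross C (Idt C ?P) (cross C (mul P) (Idt C Q) \<cdot> assoc C ?P ?P Q \<cdot> cross C (Idt C ?P) n))
       (cross C (Idt C ?P) t)"
    using ppc standard hom_rules(1) unfolding products_preserve_coequalisers_def
    by (meson group_object_typing(1))
  have "?h \<cdot> cross C (Idt C ?P) (cross C (Idt C ?P) base) = ?h \<cdot>
      cross C (Idt C ?P) (cross C (mul P) (Idt C Q) \<cdot> assoc C ?P ?P Q \<cdot> cross C (Idt C ?P) n)"
  proof (rule prd3_extensionality[of _ _ ?P ?P fibre])
    fix x p z
    assume *: "x \<in> Ar C" "p \<in> Ar C" "z \<in> Ar C" "Dom C x = Dom C z" "Dom C p = Dom C z"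
      "Cod C x = ?P" "Cod C p = ?P" "Cod C z = fibre"
    obtain l where l: "l \<in> Ar C" "Dom C l = Dom C z" "Cod C l = carr P" "n \<cdot> z = pair C l (base \<cdot> z)"
      using n_element[OF *(3,8)] by blast
    have "t \<cdot> cross C (Idt C ?P) base \<cdot> pair C (mul P \<cdot> pair C x p) z
      = t \<cdot> (cross C (mul P) (Idt C Q) \<cdot> assoc C ?P ?P Q \<cdot> cross C (Idt C ?P) n) \<cdot> pair C (mul P \<cdot> pair C x p) z"
      using coequaliser_typing(7)[OF standard] * by (intro comp_eq_precomp) simp_all
    thus "(?h \<cdot> cross C (Idt C ?P) (cross C (Idt C ?P) base)) \<cdot> pair C x (pair C p z) = (?h \<cdot>
      cross C (Idt C ?P) (cross C (mul P) (Idt C Q) \<cdot> assoc C ?P ?P Q \<cdot> cross C (Idt C ?P) n))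
        \<cdot> pair C x (pair C p z)"
      using * l by simp
  qed simp_all
  then obtain b where b: "b \<in> Ar C" "Dom C b = prd C ?P T" "Cod C b = T" "b \<cdot> cross C (Idt C ?P) t = ?h"
    using coequaliser_lift[OF coeq, of ?h] by auto
  show ?thesis
  proof (rule ex1I[of _ b])
    fix b'
    assume b': "b' \<in> hom C (prd C ?P T) T \<and> b' \<cdot> cross C (Idt C ?P) t = ?h"
    show "b' = b"
      by (rule coequaliser_epi[OF coeq]) (use b b' in \<open>simp_all add: hom_def\<close>)
  qed (use b in \<open>simp add: hom_def\<close>)
qed

lemma act_typing [simp]: "act \<in> Ar C" "Dom C act = prd C (carr P) T" "Cod C act = T"
  using theI'[OF act_ex1] unfolding act_def by (auto simp: hom_def)

lemma act_t [simp]: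
  assumes "p \<in> Ar C" "x \<in> Ar C" "y \<in> Ar C" "Dom C p = Dom C y" "Dom C x = Dom C y"
    "Cod C p = carr P" "Cod C x = carr P" "Cod C y = Q"
  shows "act \<cdot> pair C x (t \<cdot> pair C p y) = t \<cdot> pair C (mul P \<cdot> pair C x p) y"
proof -
  have "act \<cdot> cross C (Idt C (carr P)) t = t \<cdot> cross C (mul P) (Idt C Q) \<cdot> assoc C (carr P) (carr P) Q"
    using theI'[OF act_ex1] unfolding act_def by blast
  from comp_eq_precomp[OF this, of "pair C x (pair C p y)"] show ?thesis using assms by simp
qed

lemma act_action: "action C P T act"
proof (rule actionI)
  fix x
  assume x: "x \<in> Ar C" "Cod C x = T"
  have "act \<cdot> pair C (unit_map P \<cdot> bang C T) (Idt C T) = Idt C T"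
    by (rule T_extensionality_unary) simp_all
  hence "(act \<cdot> pair C (unit_map P \<cdot> bang C T) (Idt C T)) \<cdot> x = Idt C T \<cdot> x"
    by (simp only:)
  thus "act \<cdot> pair C (unit_map P \<cdot> bang C (Dom C x)) x = x" using x by simp
next
  fix g h x
  assume *: "g \<in> Ar C" "h \<in> Ar C" "x \<in> Ar C" "Cod C g = carr P" "Cod C h = carr P" "Cod C x = T"
    "Dom C g = Dom C x" "Dom C h = Dom C x"
  let ?PP = "prd C (carr P) (carr P)"
  let ?g = "prl C (carr P) (carr P) \<cdot> prl C ?PP T" and ?h = "prr C (carr P) (carr P) \<cdot> prl C ?PP T"
  have "act \<cdot> cross C (mul P) (Idt C T) = act \<cdot> pair C ?g (act \<cdot> pair C ?h (prr C ?PP T))"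
  proof (rule T_extensionality[of _ _ ?PP])
    fix w p y
    assume w: "w \<in> Ar C" "p \<in> Ar C" "y \<in> Ar C" "Dom C w = Dom C y" "Dom C p = Dom C y"
      "Cod C w = ?PP" "Cod C p = carr P" "Cod C y = Q"
    obtain g h where gh: "g \<in> Ar C" "h \<in> Ar C" "Dom C g = Dom C w" "Dom C h = Dom C w"
      "Cod C g = carr P" "Cod C h = carr P" "w = pair C g h"
      by (rule prd_elementE[OF w(1,6)], simp, simp) blast
    show "(act \<cdot> cross C (mul P) (Idt C T)) \<cdot> pair C w (t \<cdot> pair C p y)
      = (act \<cdot> pair C ?g (act \<cdot> pair C ?h (prr C ?PP T))) \<cdot> pair C w (t \<cdot> pair C p y)"
      unfolding gh(7) using w(2-5,7,8) gh(1-6) by simp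
  qed simp_all
  hence "(act \<cdot> cross C (mul P) (Idt C T)) \<cdot> pair C (pair C g h) x
      = (act \<cdot> pair C ?g (act \<cdot> pair C ?h (prr C ?PP T))) \<cdot> pair C (pair C g h) x"
    by (simp only:)
  thus "act \<cdot> pair C (mul P \<cdot> pair C g h) x = act \<cdot> pair C g (act \<cdot> pair C h x)"
    using * by simp
qed simp_all

end

locale comparison = labelled_section C G X a q s P \<phi> n t
  for C :: "('o, 'm, 'z) lcat_scheme" (structure) and G X a q s P \<phi> n t +
  fixes \<Phi> :: 'm
  assumes Phi_typing: "\<Phi> \<in> hom C T X"
    and Phi_def: "\<Phi> \<cdot> t = (a \<cdot> cross C (Idt C (carr G)) s) \<cdot> cross C \<phi> (Idt C Q)"
begin

lemma Phi_types [simp]: "\<Phi> \<in> Ar C" "Dom C \<Phi> = T" "Cod C \<Phi> = X"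
  using Phi_typing by (simp_all add: hom_def)

lemma Phi_t [simp]:
  assumes "p \<in> Ar C" "y \<in> Ar C" "Dom C p = Dom C y" "Cod C p = carr P" "Cod C y = Q"
  shows "\<Phi> \<cdot> t \<cdot> pair C p y = a \<cdot> pair C (\<phi> \<cdot> p) (s \<cdot> y)"
  using comp_eq_precomp[OF Phi_def, of "pair C p y"] assms by simp

lemma Phi_equivariant:
  assumes "p \<in> Ar C" "x \<in> Ar C" "Dom C p = Dom C x" "Cod C p = carr P" "Cod C x = T"
  shows "\<Phi> \<cdot> act \<cdot> pair C p x = a \<cdot> pair C (\<phi> \<cdot> p) (\<Phi> \<cdot> x)"
proof -
  have "\<Phi> \<cdot> act = a \<cdot> cross C \<phi> \<Phi>"
    by (rule T_extensionality[of _ _ "carr P"]) simp_all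
  from comp_eq_precomp[OF this, of "pair C p x"] show ?thesis using assms by simp
qed

text \<open>
  The inverse of \<open>\<Phi>\<close> sends \<open>g s(y)\<close> to the class of \<open>(\<phi>\<inverse>(g), y)\<close>; this is well defined since an
  element that stabilises \<open>s y\<close> corresponds under \<open>\<phi>\<close> to its label.
\<close>

lemma iso_if_hom_iso:
  assumes "is_iso C \<phi>"
  shows "is_iso C \<Phi>"
proof -
  obtain \<psi> where psi: "\<psi> \<in> Ar C" "Dom C \<psi> = carr G" "Cod C \<psi> = carr P"
    "\<psi> \<cdot> \<phi> = Idt C (carr P)" "\<phi> \<cdot> \<psi> = Idt C (carr G)"
    using assms by (rule is_isoE) simp
  have psi_phi: "\<psi> \<cdot> \<phi> \<cdot> x = x" if "x \<in> Ar C" "Cod C x = carr P" for x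
  proof -
    have "(\<psi> \<cdot> \<phi>) \<cdot> x = Idt C (carr P) \<cdot> x" by (simp only: psi)
    thus ?thesis using that psi(1-3) by simp
  qed
  have phi_psi: "\<phi> \<cdot> \<psi> \<cdot> x = x" if "x \<in> Ar C" "Cod C x = carr G" for x
  proof -
    have "(\<phi> \<cdot> \<psi>) \<cdot> x = Idt C (carr G) \<cdot> x" by (simp only: psi)
    thus ?thesis using that psi(1-3) by simp
  qed
  let ?h = "t \<cdot> cross C \<psi> (Idt C Q)"
  obtain r where r: "r \<in> Ar C" "Dom C r = X" "Cod C r = Cod C ?h"
    "\<And>g y. \<lbrakk>g \<in> Ar C; y \<in> Ar C; Dom C g = Dom C y; Cod C g = carr G; Cod C y = Q\<rbrakk>
      \<Longrightarrow> r \<cdot> a \<cdot> pair C g (s \<cdot> y) = ?h \<cdot> pair C g y"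
  proof (rule OST_lift[of ?h])
    fix g k y
    assume *: "g \<in> Ar C" "k \<in> Ar C" "y \<in> Ar C" "Dom C g = Dom C y" "Dom C k = Dom C y"
      "Cod C g = carr G" "Cod C k = carr G" "Cod C y = Q" "a \<cdot> pair C k (s \<cdot> y) = s \<cdot> y"
    obtain l where l: "l \<in> Ar C" "Dom C l = Dom C y" "Cod C l = carr P" "\<phi> \<cdot> l = k"
      "\<And>p. \<lbrakk>p \<in> Ar C; Dom C p = Dom C y; Cod C p = carr P\<rbrakk>
       \<Longrightarrow> t \<cdot> pair C (mul P \<cdot> pair C p l) y = t \<cdot> pair C p y"
      using stabiliser_label[OF *(2,3,5,7,8,9)] by blast
    have "\<psi> \<cdot> mul G \<cdot> pair C g k = \<psi> \<cdot> \<phi> \<cdot> mul P \<cdot> pair C (\<psi> \<cdot> g) l"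
      using *(1-8) l(1-4) psi(1-3) phi_psi by simp
    also have "\<dots> = mul P \<cdot> pair C (\<psi> \<cdot> g) l"
      using *(1-8) l(1-3) psi(1-3) by (intro psi_phi) simp_all
    finally have "\<psi> \<cdot> mul G \<cdot> pair C g k = mul P \<cdot> pair C (\<psi> \<cdot> g) l" .
    thus "?h \<cdot> pair C (mul G \<cdot> pair C g k) y = ?h \<cdot> pair C g y"
      using *(1-8) l(1-3) l(5)[of "\<psi> \<cdot> g"] psi(1-3) by simp
  qed (use psi(1-3) in simp_all)
  show ?thesis
  proof (rule is_isoI[of _ r])
    show "r \<cdot> \<Phi> = Idt C (Dom C \<Phi>)"
      by (rule T_extensionality_unary) (use psi(1-3) r(1-3) in \<open>simp_all add: r(4) psi_phi\<close>)
    show "\<Phi> \<cdot> r = Idt C (Cod C \<Phi>)"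
      by (rule OST_epi) (use psi(1-3) r(1-3) in \<open>simp_all add: r(4) phi_psi\<close>)
  qed (use psi(1-3) r(1-3) in simp_all)
qed

text \<open>
  A map on \<open>G\<close> that is invariant under left translation by the image of \<open>\<phi>\<close> is, after inversion,
  invariant under right translation by stabilisers, because these lie in the image of \<open>\<phi>\<close>.
\<close>

lemma invariant_extends:
  assumes r: "r \<in> Ar C" "Dom C r = carr G"
    and inv: "r \<cdot> mul G \<cdot> cross C \<phi> (Idt C (carr G)) = r \<cdot> prr C (carr P) (carr G)"
  obtains f where "f \<in> Ar C" "Dom C f = X" "Cod C f = Cod C r"
    "\<And>g y. \<lbrakk>g \<in> Ar C; y \<in> Ar C; Dom C g = Dom C y; Cod C g = carr G; Cod C y = Q\<rbrakk>
      \<Longrightarrow> f \<cdot> a \<cdot> pair C g (s \<cdot> y) = r \<cdot> inverse_map G \<cdot> g"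
proof -
  have r_inv: "r \<cdot> mul G \<cdot> pair C (\<phi> \<cdot> p) g = r \<cdot> g"
    if "p \<in> Ar C" "g \<in> Ar C" "Dom C p = Dom C g" "Cod C p = carr P" "Cod C g = carr G" for p g
    using comp_eq_precomp[OF inv, of "pair C p g"] r that by simp
  let ?h = "r \<cdot> inverse_map G \<cdot> prl C (carr G) Q"
  obtain f where f: "f \<in> Ar C" "Dom C f = X" "Cod C f = Cod C ?h"
    "\<And>g y. \<lbrakk>g \<in> Ar C; y \<in> Ar C; Dom C g = Dom C y; Cod C g = carr G; Cod C y = Q\<rbrakk>
      \<Longrightarrow> f \<cdot> a \<cdot> pair C g (s \<cdot> y) = ?h \<cdot> pair C g y"
  proof (rule OST_lift[of ?h])
    fix g k y
    assume *: "g \<in> Ar C" "k \<in> Ar C" "y \<in> Ar C" "Dom C g = Dom C y" "Dom C k = Dom C y"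
      "Cod C g = carr G" "Cod C k = carr G" "Cod C y = Q" "a \<cdot> pair C k (s \<cdot> y) = s \<cdot> y"
    obtain l where l: "l \<in> Ar C" "Dom C l = Dom C y" "Cod C l = carr P" "\<phi> \<cdot> l = k"
      using stabiliser_label[OF *(2,3,5,7,8,9)] by blast
    have "r \<cdot> inverse_map G \<cdot> mul G \<cdot> pair C g k
        = r \<cdot> mul G \<cdot> pair C (\<phi> \<cdot> inverse_map P \<cdot> l) (inverse_map G \<cdot> g)"
      using * l by (simp add: inverse_mul)
    also have "\<dots> = r \<cdot> inverse_map G \<cdot> g"
      by (rule r_inv) (use *(1-8) l(1-3) in simp_all)
    finally show "?h \<cdot> pair C (mul G \<cdot> pair C g k) y = ?h \<cdot> pair C g y"
      using *(1-8) r by simp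
  qed (use r in simp_all)
  show ?thesis
    by (rule that[of f]) (use f(1-3) r in \<open>simp_all add: f(4)\<close>)
qed

end

text \<open>
  A terminal quotient of \<open>G\<close> by \<open>P\<close> takes the place of surjectivity of \<open>\<phi>\<close>.
\<close>

locale transitive_comparison = comparison +
  assumes transitive:
    "is_quotient C (carr P) (carr G) (mul G \<cdot> cross C \<phi> (Idt C (carr G))) (bang C (carr G))"
begin

lemma hom_coequaliser:
  assumes "A \<in> Ob C"
  shows "is_coequaliser C (cross C (prl C (carr P) (Dom C ker)) (Idt C A))
    (cross C (mul P \<cdot> cross C (Idt C (carr P)) ker) (Idt C A)) (cross C \<phi> (Idt C A))"
  using transitive_hom_coequaliser[OF OST hom transitive] assms
  by (intro cross_right_coequaliser[OF ppc]) simp_all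

text \<open>
  A map \<open>f\<close> on \<open>T\<close> that is invariant under the kernel becomes a map on \<open>P \<times> Q\<close> which factors through
  \<open>\<phi> \<times> Q\<close>, as \<open>\<phi>\<close> is the quotient by the kernel. The factor is invariant under the stabilisers, so by
  \<open>OST\<close> it descends to \<open>X\<close>.
\<close>

lemma Phi_quotient:
  assumes K: "carr K = Dom C ker" "(K, ker, P) \<in> Ar (Grp C)"
  shows "is_quotient C (carr K) T (act \<cdot> cross C ker (Idt C T)) \<Phi>"
  unfolding is_quotient_def
proof (rule coequaliserI)
  note [simp] = K(1)
  show "\<Phi> \<cdot> act \<cdot> cross C ker (Idt C T) = \<Phi> \<cdot> prr C (carr K) T"
  proof (rule prd_extensionality[of _ _ "Dom C ker" T])
    fix x w
    assume "x \<in> Ar C" "w \<in> Ar C" "Dom C x = Dom C w" "Cod C x = Dom C ker" "Cod C w = T"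
    thus "(\<Phi> \<cdot> act \<cdot> cross C ker (Idt C T)) \<cdot> pair C x w = (\<Phi> \<cdot> prr C (carr K) T) \<cdot> pair C x w"
      by (simp add: Phi_equivariant)
  qed simp_all
  fix f
  assume f: "f \<in> Ar C" "Dom C f = Cod C (act \<cdot> cross C ker (Idt C T))"
    "f \<cdot> act \<cdot> cross C ker (Idt C T) = f \<cdot> prr C (carr K) T"
  have f_inv: "f \<cdot> act \<cdot> pair C (ker \<cdot> x) w = f \<cdot> w"
    if "x \<in> Ar C" "w \<in> Ar C" "Dom C x = Dom C w" "Cod C x = Dom C ker" "Cod C w = T" for x w
    using comp_eq_precomp[OF f(3), of "pair C x w"] f(1,2) that by simp
  have right: "f \<cdot> t \<cdot> pair C (mul P \<cdot> pair C p (ker \<cdot> x)) y = f \<cdot> t \<cdot> pair C p y"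
    if *: "p \<in> Ar C" "x \<in> Ar C" "y \<in> Ar C" "Dom C p = Dom C y" "Dom C x = Dom C y"
      "Cod C p = carr P" "Cod C x = Dom C ker" "Cod C y = Q" for p x y
  proof -
    \<comment> \<open>The kernel is normal, so the right translate by \<open>x\<close> is the left translate by a conjugate.\<close>
    define c where "c = mul P \<cdot> pair C p (mul P \<cdot> pair C (ker \<cdot> x) (inverse_map P \<cdot> p))"
    have c: "c \<in> Ar C" "Dom C c = Dom C y" "Cod C c = carr P" "\<phi> \<cdot> c = unit_map G \<cdot> bang C (Dom C c)"
      unfolding c_def using * by simp_all
    have cp: "mul P \<cdot> pair C c p = mul P \<cdot> pair C p (ker \<cdot> x)"
      unfolding c_def using * by simp
    obtain x' where x': "x' \<in> Ar C" "Dom C x' = Dom C c" "Cod C x' = Dom C ker" "ker \<cdot> x' = c"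
      using kernel_element[OF hom c(1,3,4)] by blast
    have "f \<cdot> act \<cdot> pair C (ker \<cdot> x') (t \<cdot> pair C p y) = f \<cdot> t \<cdot> pair C p y"
      using * c(1-3) x'(1-3) by (intro f_inv) simp_all
    thus ?thesis
      using * c(1-3) cp unfolding x'(4) by simp
  qed
  let ?KP = "prd C (carr P) (Dom C ker)"
  have "(f \<cdot> t) \<cdot> cross C (prl C (carr P) (Dom C ker)) (Idt C Q)
      = (f \<cdot> t) \<cdot> cross C (mul P \<cdot> cross C (Idt C (carr P)) ker) (Idt C Q)"
  proof (rule prd_extensionality[of _ _ ?KP Q])
    fix w y
    assume w: "w \<in> Ar C" "y \<in> Ar C" "Dom C w = Dom C y" "Cod C w = ?KP" "Cod C y = Q"
    obtain p x where px: "p \<in> Ar C" "x \<in> Ar C" "Dom C p = Dom C w" "Dom C x = Dom C w"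
      "Cod C p = carr P" "Cod C x = Dom C ker" "w = pair C p x"
      by (rule prd_elementE[OF w(1,4)], simp, simp) blast
    show "((f \<cdot> t) \<cdot> cross C (prl C (carr P) (Dom C ker)) (Idt C Q)) \<cdot> pair C w y
      = ((f \<cdot> t) \<cdot> cross C (mul P \<cdot> cross C (Idt C (carr P)) ker) (Idt C Q)) \<cdot> pair C w y"
      unfolding px(7) using w(2,3,5) px(1-6) f(1,2) by (simp add: right)
  qed (use f(1,2) in simp_all)
  then obtain f' where f': "f' \<in> Ar C" "Dom C f' = prd C (carr G) Q" "Cod C f' = Cod C f"
    "f' \<cdot> cross C \<phi> (Idt C Q) = f \<cdot> t"
    using coequaliser_lift[OF hom_coequaliser[of Q], of "f \<cdot> t"] f(1,2) by auto
  have f'_phi: "f' \<cdot> pair C (\<phi> \<cdot> p) y = f \<cdot> t \<cdot> pair C p y"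
    if "p \<in> Ar C" "y \<in> Ar C" "Dom C p = Dom C y" "Cod C p = carr P" "Cod C y = Q" for p y
    using comp_eq_precomp[OF f'(4), of "pair C p y"] f(1,2) f'(1,2) that by simp
  let ?g = "prl C (carr G) fibre" and ?z = "prr C (carr G) fibre"
  \<comment> \<open>Invariance of the factor \<open>f'\<close> under stabilisers is an equation of maps on \<open>G \<times> fibre\<close>; it may be
    checked after the epimorphism \<open>\<phi> \<times> fibre\<close>, where labels are available on both sides.\<close>
  define \<gamma> where "\<gamma> = grp_part"
  have [simp]: "\<gamma> \<in> Ar C" "Dom C \<gamma> = fibre" "Cod C \<gamma> = carr G"
    by (simp_all add: \<gamma>_def)
  have "f' \<cdot> pair C (mul G \<cdot> pair C ?g (\<gamma> \<cdot> ?z)) (base \<cdot> ?z) = f' \<cdot> pair C ?g (base \<cdot> ?z)"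
  proof (rule coequaliser_epi[OF hom_coequaliser[of fibre]])
    show "(f' \<cdot> pair C (mul G \<cdot> pair C ?g (\<gamma> \<cdot> ?z)) (base \<cdot> ?z)) \<cdot> cross C \<phi> (Idt C fibre)
      = (f' \<cdot> pair C ?g (base \<cdot> ?z)) \<cdot> cross C \<phi> (Idt C fibre)"
    proof (rule prd_extensionality[of _ _ "carr P" fibre])
      fix p z
      assume *: "p \<in> Ar C" "z \<in> Ar C" "Dom C p = Dom C z" "Cod C p = carr P" "Cod C z = fibre"
      obtain l where l: "l \<in> Ar C" "Dom C l = Dom C (base \<cdot> z)" "Cod C l = carr P" "\<phi> \<cdot> l = \<gamma> \<cdot> z"
        "\<And>p. \<lbrakk>p \<in> Ar C; Dom C p = Dom C (base \<cdot> z); Cod C p = carr P\<rbrakk>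
         \<Longrightarrow> t \<cdot> pair C (mul P \<cdot> pair C p l) (base \<cdot> z) = t \<cdot> pair C p (base \<cdot> z)"
        by (rule stabiliser_label[of "\<gamma> \<cdot> z" "base \<cdot> z"])
          (use * fibre_stabilises[OF *(2,5), folded \<gamma>_def] in simp_all)
      have "f' \<cdot> pair C (\<phi> \<cdot> mul P \<cdot> pair C p l) (base \<cdot> z) = f' \<cdot> pair C (\<phi> \<cdot> p) (base \<cdot> z)"
        using * l(1-3) l(5)[of p] by (simp add: f'_phi del: hom_rules(6))
      thus "((f' \<cdot> pair C (mul G \<cdot> pair C ?g (\<gamma> \<cdot> ?z)) (base \<cdot> ?z)) \<cdot> cross C \<phi> (Idt C fibre)) \<cdot> pair C p z
        = ((f' \<cdot> pair C ?g (base \<cdot> ?z)) \<cdot> cross C \<phi> (Idt C fibre)) \<cdot> pair C p z"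
        using * l(1-4) f'(1-3) by simp
    qed (use f'(1-3) in simp_all)
  qed (use f'(1-3) in simp_all)
  note f'_stab = comp_eq_precomp[OF this]
  obtain f'' where f'': "f'' \<in> Ar C" "Dom C f'' = X" "Cod C f'' = Cod C f'"
    "\<And>g y. \<lbrakk>g \<in> Ar C; y \<in> Ar C; Dom C g = Dom C y; Cod C g = carr G; Cod C y = Q\<rbrakk>
      \<Longrightarrow> f'' \<cdot> a \<cdot> pair C g (s \<cdot> y) = f' \<cdot> pair C g y"
  proof (rule OST_lift[of f'])
    fix g k y
    assume *: "g \<in> Ar C" "k \<in> Ar C" "y \<in> Ar C" "Dom C g = Dom C y" "Dom C k = Dom C y"
      "Cod C g = carr G" "Cod C k = carr G" "Cod C y = Q" "a \<cdot> pair C k (s \<cdot> y) = s \<cdot> y"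
    obtain z where z: "z \<in> Ar C" "Dom C z = Dom C y" "Cod C z = fibre" "base \<cdot> z = y" "grp_part \<cdot> z = k"
      using fibre_element[OF *(2,3,5,7,8,9)] by blast
    show "f' \<cdot> pair C (mul G \<cdot> pair C g k) y = f' \<cdot> pair C g y"
      using f'_stab[of "pair C g z"] *(1-8) z(1-4) z(5)[folded \<gamma>_def] f'(1-3) by simp
  qed (use f'(1,2) in simp_all)
  have "f'' \<cdot> \<Phi> = f"
    by (rule T_extensionality_unary) (use f(1,2) f''(1-3) in \<open>simp_all add: f''(4) f'_phi\<close>)
  thus "\<exists>k\<in>Ar C. Dom C k = Cod C \<Phi> \<and> Cod C k = Cod C f \<and> k \<cdot> \<Phi> = f"
    using f''(1-3) f'(3) by auto
next
  note [simp] = K(1)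
  fix u v
  assume uv: "u \<in> Ar C" "v \<in> Ar C" "Dom C u = Cod C \<Phi>" "Dom C v = Cod C \<Phi>" "u \<cdot> \<Phi> = v \<cdot> \<Phi>"
  have *: "u \<cdot> a \<cdot> pair C (\<phi> \<cdot> p) (s \<cdot> y) = v \<cdot> a \<cdot> pair C (\<phi> \<cdot> p) (s \<cdot> y)"
    if "p \<in> Ar C" "y \<in> Ar C" "Dom C p = Dom C y" "Cod C p = carr P" "Cod C y = Q" for p y
    using comp_eq_precomp[OF uv(5), of "t \<cdot> pair C p y"] uv(1-4) that by simp
  have "u \<cdot> a \<cdot> cross C (Idt C (carr G)) s = v \<cdot> a \<cdot> cross C (Idt C (carr G)) s"
  proof (rule coequaliser_epi[OF hom_coequaliser[of Q]])
    show "(u \<cdot> a \<cdot> cross C (Idt C (carr G)) s) \<cdot> cross C \<phi> (Idt C Q)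
        = (v \<cdot> a \<cdot> cross C (Idt C (carr G)) s) \<cdot> cross C \<phi> (Idt C Q)"
      by (rule prd_extensionality[of _ _ "carr P" Q]) (use uv(1-4) * in simp_all)
  qed (use uv(1-4) in simp_all)
  with _ _ _ _ show "u = v"
    by (rule coequaliser_epi[OF OST_coequaliser]) (use uv(1-4) in simp_all)
qed (simp_all add: K(1))

lemma section_splits:
  assumes K: "carr K = Dom C ker" "(K, ker, P) \<in> Ar (Grp C)"
    and free: "free_action C (Dom C ker) T (act \<cdot> cross C ker (Idt C T))"
    and sec: "is_section C \<sigma> \<Phi>"
  shows "is_iso C ((act \<cdot> cross C ker (Idt C T)) \<cdot> cross C (Idt C (Dom C ker)) \<sigma>)"
proof -
  interpret kernel: fixed_section C K T "act \<cdot> cross C ker (Idt C T)" \<Phi> \<sigma>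
  proof
    show "group_object C K" by (rule group_hom_typing(1)[OF K(2)])
    show "action C K T (act \<cdot> cross C ker (Idt C T))" by (rule action_restrict[OF act_action K(2)])
  qed (rule OST Phi_quotient[OF K] sec)+
  show ?thesis using kernel.free_trivial free unfolding K(1) by simp
qed

end

section \<open>Slices and the pulled back stabiliser\<close>

lemma slice_simps [simp]:
  "Ob (slice C X) = {p \<in> Ar C. Cod C p = X}"
  "Ar (slice C X) = {(p, f, r). p \<in> Ar C \<and> Cod C p = X \<and> r \<in> Ar C \<and> Cod C r = X \<and>
              f \<in> hom C (Dom C p) (Dom C r) \<and> r \<cdot>\<^bsub>C\<^esub> f = p}"
  "Dom (slice C X) (p, f, r) = p" "Cod (slice C X) (p, f, r) = r"
  "Idt (slice C X) p = (p, Idt C (Dom C p), p)"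
  "(r, g, t) \<cdot>\<^bsub>slice C X\<^esub> (p, f, r') = (p, g \<cdot>\<^bsub>C\<^esub> f, t)"
  "one (slice C X) = Idt C X"
  "prd (slice C X) p r = p \<cdot>\<^bsub>C\<^esub> pbl C p r"
  "prl (slice C X) p r = (p \<cdot>\<^bsub>C\<^esub> pbl C p r, pbl C p r, p)"
  "prr (slice C X) p r = (p \<cdot>\<^bsub>C\<^esub> pbl C p r, pbr C p r, r)"
  by (simp_all add: slice_def)

lemma slice_hom_iff:
  "u \<in> hom (slice C X) p r \<longleftrightarrow> (\<exists>f. u = (p, f, r) \<and> p \<in> Ar C \<and> Cod C p = X \<and> r \<in> Ar C \<and> Cod C r = X \<and>
     f \<in> Ar C \<and> Dom C f = Dom C p \<and> Cod C f = Dom C r \<and> r \<cdot>\<^bsub>C\<^esub> f = p)"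
  by (cases u) (auto simp: hom_def)

context finite_limits
begin

lemma slice_category: "X \<in> Ob C \<Longrightarrow> category (slice C X)"
proof unfold_locales
  fix u v p r t
  assume "u \<in> hom (slice C X) p r" "v \<in> hom (slice C X) r t"
  then obtain f g where u: "u = (p, f, r)" "p \<in> Ar C" "Cod C p = X" "r \<in> Ar C" "Cod C r = X" "f \<in> Ar C"
      "Dom C f = Dom C p" "Cod C f = Dom C r" "r \<cdot> f = p"
    and v: "v = (r, g, t)" "t \<in> Ar C" "Cod C t = X" "g \<in> Ar C" "Dom C g = Dom C r"
      "Cod C g = Dom C t" "t \<cdot> g = r"
    unfolding slice_hom_iff by blast
  have "t \<cdot> g \<cdot> f = (t \<cdot> g) \<cdot> f" using u(2-8) v(2-6) by simp
  also have "\<dots> = p" unfolding v(7) by (rule u(9))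
  finally show "v \<cdot>\<^bsub>slice C X\<^esub> u \<in> hom (slice C X) p t"
    unfolding slice_hom_iff u(1) v(1) using u(2-8) v(2-6) by simp
next
  fix u v w p r t y
  assume "u \<in> hom (slice C X) p r" "v \<in> hom (slice C X) r t" "w \<in> hom (slice C X) t y"
  then obtain f g h where "u = (p, f, r)" "v = (r, g, t)" "w = (t, h, y)"
      "f \<in> Ar C" "Cod C f = Dom C r" "g \<in> Ar C" "Dom C g = Dom C r" "Cod C g = Dom C t"
      "h \<in> Ar C" "Dom C h = Dom C t"
    unfolding slice_hom_iff by blast
  thus "(w \<cdot>\<^bsub>slice C X\<^esub> v) \<cdot>\<^bsub>slice C X\<^esub> u = w \<cdot>\<^bsub>slice C X\<^esub> v \<cdot>\<^bsub>slice C X\<^esub> u"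
    by simp
next
  fix u p r
  assume "u \<in> hom (slice C X) p r"
  then obtain f where "u = (p, f, r)" "f \<in> Ar C" "Dom C f = Dom C p" "Cod C f = Dom C r"
    unfolding slice_hom_iff by blast
  thus "Idt (slice C X) r \<cdot>\<^bsub>slice C X\<^esub> u = u" "u \<cdot>\<^bsub>slice C X\<^esub> Idt (slice C X) p = u"
    by simp_all
next
  fix u
  assume "u \<in> Ar (slice C X)"
  thus "Dom (slice C X) u \<in> Ob (slice C X) \<and> Cod (slice C X) u \<in> Ob (slice C X)"
    by (cases u) simp
next
  fix p
  assume "p \<in> Ob (slice C X)"
  thus "Idt (slice C X) p \<in> hom (slice C X) p p"
    by (simp add: slice_hom_iff)
qed

lemma slice_product:
  assumes "p \<in> Ar C" "Cod C p = X" "r \<in> Ar C" "Cod C r = X"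
  shows "is_product (slice C X) p r (prd (slice C X) p r) (prl (slice C X) p r) (prr (slice C X) p r)"
  unfolding is_product_def
proof (intro conjI allI ballI)
  show "prl (slice C X) p r \<in> hom (slice C X) (prd (slice C X) p r) p"
    "prr (slice C X) p r \<in> hom (slice C X) (prd (slice C X) p r) r"
    using assms pb_commutes[of p r] by (simp_all add: slice_hom_iff)
  fix y u v
  assume "u \<in> hom (slice C X) y p" "v \<in> hom (slice C X) y r"
  then obtain f g where u: "u = (y, f, p)" "y \<in> Ar C" "Cod C y = X" "f \<in> Ar C" "Dom C f = Dom C y"
      "Cod C f = Dom C p" "p \<cdot> f = y"
    and v: "v = (y, g, r)" "g \<in> Ar C" "Dom C g = Dom C y" "Cod C g = Dom C r" "r \<cdot> g = y"
    unfolding slice_hom_iff by blast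
  note k = pblift_props[of p r f g]
  let ?k = "(y, pblift C p r f g, p \<cdot> pbl C p r)"
  show "\<exists>!h. h \<in> hom (slice C X) y (prd (slice C X) p r) \<and> prl (slice C X) p r \<cdot>\<^bsub>slice C X\<^esub> h = u \<and>
      prr (slice C X) p r \<cdot>\<^bsub>slice C X\<^esub> h = v"
  proof (rule ex1I[of _ ?k])
    show "?k \<in> hom (slice C X) y (prd (slice C X) p r) \<and> prl (slice C X) p r \<cdot>\<^bsub>slice C X\<^esub> ?k = u \<and>
      prr (slice C X) p r \<cdot>\<^bsub>slice C X\<^esub> ?k = v"
      using assms u v k by (simp add: slice_hom_iff)
    fix h
    assume "h \<in> hom (slice C X) y (prd (slice C X) p r) \<and> prl (slice C X) p r \<cdot>\<^bsub>slice C X\<^esub> h = u \<and>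
      prr (slice C X) p r \<cdot>\<^bsub>slice C X\<^esub> h = v"
    then obtain h' where h: "h = (y, h', p \<cdot> pbl C p r)" "h' \<in> Ar C" "Cod C h' = Dom C (p \<cdot> pbl C p r)"
        "pbl C p r \<cdot> h' = f" "pbr C p r \<cdot> h' = g"
      unfolding slice_hom_iff u(1) v(1) using assms by auto
    have "h' = pblift C p r f g"
      by (rule pb_mono[of p r]) (use assms u v k h in simp_all)
    thus "h = ?k" using h(1) by simp
  qed
qed

lemma slice_finite_products:
  assumes "X \<in> Ob C"
  shows "finite_products (slice C X)"
proof -
  interpret L: category "slice C X" by (rule slice_category[OF assms])
  show ?thesis
  proof unfold_locales
    have "\<exists>!u. u \<in> hom (slice C X) p (Idt C X)" if "p \<in> Ob (slice C X)" for p
      using that assms unfolding slice_hom_iff by (intro ex1I[of _ "(p, p, Idt C X)"]) auto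
    thus "is_terminal (slice C X) (one (slice C X))"
      unfolding is_terminal_def using assms by simp
  qed (simp add: slice_product[simplified])
qed

lemma slice_pair:
  assumes "(p, f, r) \<in> Ar (slice C X)" "(p, g, t) \<in> Ar (slice C X)"
  shows "pair (slice C X) (p, f, r) (p, g, t) = (p, pblift C r t f g, r \<cdot> pbl C r t)"
proof -
  have *: "p \<in> Ar C" "Cod C p = X" "r \<in> Ar C" "Cod C r = X" "f \<in> Ar C" "Dom C f = Dom C p"
    "Cod C f = Dom C r" "r \<cdot> f = p" "t \<in> Ar C" "Cod C t = X" "g \<in> Ar C" "Dom C g = Dom C p"
    "Cod C g = Dom C t" "t \<cdot> g = p"
    using assms by (auto simp: hom_def)
  interpret L: finite_products "slice C X"
    by (rule slice_finite_products) (use *(1,2) Cod_Ob in blast)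
  have k: "pblift C r t f g \<in> Ar C" "Dom C (pblift C r t f g) = Dom C p"
    "Cod C (pblift C r t f g) = Dom C (pbeq C r t)" "pbl C r t \<cdot> pblift C r t f g = f"
    "pbr C r t \<cdot> pblift C r t f g = g"
    using pblift_props[of r t f g] * by simp_all
  have rk: "r \<cdot> pbl C r t \<cdot> pblift C r t f g = p" using k(4) *(8) by simp
  have dom: "Dom (slice C X) (p, f, r) = Dom (slice C X) (p, g, t)" by simp
  show ?thesis
    unfolding pair_def
    by (rule the1_equality[OF L.product_ex1[OF assms dom]])
      (use * k rk in \<open>simp add: slice_hom_iff\<close>)
qed

lemma slice_cross:
  assumes "(p, f, r) \<in> Ar (slice C X)" "(p', g, t) \<in> Ar (slice C X)"
  shows "cross (slice C X) (p, f, r) (p', g, t)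
    = (p \<cdot> pbl C p p', pblift C r t (f \<cdot> pbl C p p') (g \<cdot> pbr C p p'), r \<cdot> pbl C r t)"
proof -
  have *: "p \<in> Ar C" "Cod C p = X" "r \<in> Ar C" "Cod C r = X" "f \<in> Ar C" "Dom C f = Dom C p"
    "Cod C f = Dom C r" "r \<cdot> f = p" "t \<in> Ar C" "Cod C t = X" "g \<in> Ar C" "Dom C g = Dom C p'"
    "Cod C g = Dom C t" "t \<cdot> g = p'" "p' \<in> Ar C" "Cod C p' = X"
    using assms by (auto simp: hom_def)
  have rf: "r \<cdot> f \<cdot> pbl C p p' = p \<cdot> pbl C p p'"
    using * comp_assoc_Ar[of "pbl C p p'" f r] by simp
  have "t \<cdot> g \<cdot> pbr C p p' = p' \<cdot> pbr C p p'"
    using * comp_assoc_Ar[of "pbr C p p'" g t] by simp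
  also have "\<dots> = p \<cdot> pbl C p p'" using * pb_commutes[of p p'] by simp
  finally have "(p \<cdot> pbl C p p', g \<cdot> pbr C p p', t) \<in> Ar (slice C X)"
    "(p \<cdot> pbl C p p', f \<cdot> pbl C p p', r) \<in> Ar (slice C X)"
    using * rf by (simp_all add: hom_def)
  from slice_pair[OF this(2,1)] show ?thesis by (simp add: cross_def)
qed

end

context fixed_section
begin

abbreviation "S \<equiv> pullback_grp C s (stab_grp C G X a)"
abbreviation "to_Delta \<equiv> cross C (Idt C (carr G)) q \<cdot> incl \<cdot> pbl C stab s"
abbreviation "stab_part \<equiv> prl C (carr G) X \<cdot> incl"

lemma stab_types [simp]:
  "incl \<in> Ar C" "Cod C incl = prd C (carr G) X" "stab \<in> Ar C" "Dom C stab = Dom C incl" "Cod C stab = X"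
  by (rule stab_typing; simp)+

lemma stab_fixes:
  assumes "z \<in> Ar C" "Cod C z = Dom C incl"
  shows "a \<cdot> pair C (prl C (carr G) X \<cdot> incl \<cdot> z) (stab \<cdot> z) = stab \<cdot> z"
proof -
  have "a \<cdot> incl \<cdot> z = prr C (carr G) X \<cdot> incl \<cdot> z"
    using assms by (intro comp_eq_precomp[OF stab_incl_fixes]) simp_all
  thus ?thesis using assms by (simp add: stab_map_def)
qed

lemma stab_lift:
  assumes "g \<in> Ar C" "x \<in> Ar C" "Dom C g = Dom C x" "Cod C g = carr G" "Cod C x = X"
    "a \<cdot> pair C g x = x" "r \<in> Ar C" "Cod C r = Dom C x"
  defines "l \<equiv> eqlift C a (prr C (carr G) X) (pair C g x)"
  shows "l \<cdot> r \<in> Ar C" "Dom C (l \<cdot> r) = Dom C r" "Cod C (l \<cdot> r) = Dom C incl"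
    "incl \<cdot> l \<cdot> r = pair C (g \<cdot> r) (x \<cdot> r)"
proof -
  have l: "l \<in> Ar C" "Dom C l = Dom C x" "Cod C l = Dom C incl" "incl \<cdot> l = pair C g x"
    using eqlift_props[of a "prr C (carr G) X" "pair C g x"] assms by (simp_all add: stab_incl_def)
  show "l \<cdot> r \<in> Ar C" "Dom C (l \<cdot> r) = Dom C r" "Cod C (l \<cdot> r) = Dom C incl"
    using l(1-3) assms(7,8) by simp_all
  have "incl \<cdot> l \<cdot> r = (incl \<cdot> l) \<cdot> r" using l(1-3) assms(7,8) by simp
  thus "incl \<cdot> l \<cdot> r = pair C (g \<cdot> r) (x \<cdot> r)" unfolding l(4) using assms by simp
qed

abbreviation "stab_mul \<equiv> eqlift C a (prr C (carr G) X)
  (pair C (mul G \<cdot> pair C (stab_part \<cdot> pbl C stab stab) (stab_part \<cdot> pbr C stab stab))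
     (stab \<cdot> pbl C stab stab))"
abbreviation "stab_inv \<equiv> eqlift C a (prr C (carr G) X) (pair C (inverse_map G \<cdot> stab_part) stab)"
abbreviation "stab_unit \<equiv> eqlift C a (prr C (carr G) X) (pair C (unit_map G \<cdot> bang C X) (Idt C X))"

lemma stab_mul_element:
  assumes "y \<in> Ar C" "z \<in> Ar C" "Dom C y = Dom C z" "Cod C y = Dom C incl" "Cod C z = Dom C incl"
    and "g \<in> Ar C" "h \<in> Ar C" "x \<in> Ar C" "Dom C g = Dom C z" "Dom C h = Dom C z" "Dom C x = Dom C z"
    "Cod C g = carr G" "Cod C h = carr G" "Cod C x = X"
    "incl \<cdot> y = pair C g x" "incl \<cdot> z = pair C h x"
  shows "stab_mul \<cdot> pblift C stab stab y z \<in> Ar C"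
    "Dom C (stab_mul \<cdot> pblift C stab stab y z) = Dom C z"
    "Cod C (stab_mul \<cdot> pblift C stab stab y z) = Dom C incl"
    "incl \<cdot> stab_mul \<cdot> pblift C stab stab y z = pair C (mul G \<cdot> pair C g h) x"
proof -
  let ?u = "pbl C stab stab" and ?v = "pbr C stab stab" and ?r = "pblift C stab stab y z"
  have uv [simp]: "?u \<in> Ar C" "?v \<in> Ar C" "Cod C ?u = Dom C incl" "Cod C ?v = Dom C incl"
    "Dom C ?v = Dom C (pbeq C stab stab)" "Dom C ?u = Dom C (pbeq C stab stab)"
    using pb_typing[of stab stab] by simp_all
  have vu: "stab \<cdot> ?v = stab \<cdot> ?u" using pb_commutes[of stab stab] by simp
  have st: "stab \<cdot> y = x" "stab \<cdot> z = x" using assms by (simp_all add: stab_map_def)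
  hence r: "?r \<in> Ar C" "Dom C ?r = Dom C z" "Cod C ?r = Dom C (pbeq C stab stab)" "?u \<cdot> ?r = y" "?v \<cdot> ?r = z"
    using pblift_props[of stab stab y z] assms(1-5) by simp_all
  have fixed: "a \<cdot> pair C (mul G \<cdot> pair C (stab_part \<cdot> ?u) (stab_part \<cdot> ?v)) (stab \<cdot> ?u) = stab \<cdot> ?u"
    using stab_fixes[of ?u] stab_fixes[of ?v, unfolded vu] by simp
  note l = stab_lift[OF _ _ _ _ _ fixed r(1)]
  show "stab_mul \<cdot> ?r \<in> Ar C" "Dom C (stab_mul \<cdot> ?r) = Dom C z" "Cod C (stab_mul \<cdot> ?r) = Dom C incl"
    using l(1-3) r(2,3) by simp_all
  have "incl \<cdot> stab_mul \<cdot> ?r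
      = pair C ((mul G \<cdot> pair C (stab_part \<cdot> ?u) (stab_part \<cdot> ?v)) \<cdot> ?r) ((stab \<cdot> ?u) \<cdot> ?r)"
    by (rule l(4)) (use r(3) in simp_all)
  also have "\<dots> = pair C (mul G \<cdot> pair C g h) x"
    using assms r st by simp
  finally show "incl \<cdot> stab_mul \<cdot> ?r = pair C (mul G \<cdot> pair C g h) x" .
qed

lemma stab_inv_element:
  assumes "z \<in> Ar C" "Cod C z = Dom C incl"
    and "g \<in> Ar C" "x \<in> Ar C" "Dom C g = Dom C z" "Dom C x = Dom C z"
    "Cod C g = carr G" "Cod C x = X" "incl \<cdot> z = pair C g x"
  shows "stab_inv \<cdot> z \<in> Ar C" "Dom C (stab_inv \<cdot> z) = Dom C z" "Cod C (stab_inv \<cdot> z) = Dom C incl"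
    "incl \<cdot> stab_inv \<cdot> z = pair C (inverse_map G \<cdot> g) x"
proof -
  have st: "stab \<cdot> z = x" using assms by (simp add: stab_map_def)
  have part: "a \<cdot> pair C stab_part stab = stab"
    using stab_fixes[of "Idt C (Dom C incl)"] by simp
  have "a \<cdot> pair C (inverse_map G \<cdot> stab_part) stab
      = a \<cdot> pair C (mul G \<cdot> pair C (inverse_map G \<cdot> stab_part) stab_part) stab"
    by (subst action_mul[OF group action]) (simp_all add: part)
  also have "\<dots> = stab" by (simp del: action_rules(6))
  finally have fixed: "a \<cdot> pair C (inverse_map G \<cdot> stab_part) stab = stab" .
  note l = stab_lift[OF _ _ _ _ _ fixed assms(1)]
  show "stab_inv \<cdot> z \<in> Ar C" "Dom C (stab_inv \<cdot> z) = Dom C z" "Cod C (stab_inv \<cdot> z) = Dom C incl"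
    "incl \<cdot> stab_inv \<cdot> z = pair C (inverse_map G \<cdot> g) x"
    using l assms st by simp_all
qed

lemma stab_unit_element:
  assumes "x \<in> Ar C" "Cod C x = X"
  shows "stab_unit \<cdot> x \<in> Ar C" "Dom C (stab_unit \<cdot> x) = Dom C x" "Cod C (stab_unit \<cdot> x) = Dom C incl"
    "incl \<cdot> stab_unit \<cdot> x = pair C (unit_map G \<cdot> bang C (Dom C x)) x"
  using stab_lift[of "unit_map G \<cdot> bang C X" "Idt C X" x] assms by simp_all

text \<open>Elements of \<open>s\<^sup>*G\<^sub>X\<close> are pairs \<open>(g, y)\<close> where \<open>g\<close> fixes \<open>s y\<close>.\<close>

lemma fibre_lift:
  assumes "z \<in> Ar C" "y \<in> Ar C" "Dom C z = Dom C y" "Cod C z = Dom C incl" "Cod C y = Q"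
    "incl \<cdot> z = pair C g (s \<cdot> y)" "g \<in> Ar C" "Dom C g = Dom C y" "Cod C g = carr G"
  shows "pblift C stab s z y \<in> Ar C" "Dom C (pblift C stab s z y) = Dom C y"
    "Cod C (pblift C stab s z y) = fibre" "base \<cdot> pblift C stab s z y = y"
    "to_Delta \<cdot> pblift C stab s z y = pair C g y"
proof -
  have "stab \<cdot> z = s \<cdot> y" using assms by (simp add: stab_map_def)
  hence l: "pblift C stab s z y \<in> Ar C" "Dom C (pblift C stab s z y) = Dom C y"
    "Cod C (pblift C stab s z y) = fibre" "base \<cdot> pblift C stab s z y = y"
    "pbl C stab s \<cdot> pblift C stab s z y = z"
    using pblift_props[of stab s z y] assms by simp_all
  thus "pblift C stab s z y \<in> Ar C" "Dom C (pblift C stab s z y) = Dom C y"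
    "Cod C (pblift C stab s z y) = fibre" "base \<cdot> pblift C stab s z y = y"
    "to_Delta \<cdot> pblift C stab s z y = pair C g y"
    using assms by simp_all
qed

lemma to_Delta_typing [simp]:
  "to_Delta \<in> Ar C" "Dom C to_Delta = fibre" "Cod C to_Delta = prd C (carr G) Q"
  by simp_all

lemma fibre_parts:
  assumes "z \<in> Ar C" "Cod C z = fibre"
  obtains g where "g \<in> Ar C" "Dom C g = Dom C z" "Cod C g = carr G"
    "incl \<cdot> pbl C stab s \<cdot> z = pair C g (s \<cdot> base \<cdot> z)" "a \<cdot> pair C g (s \<cdot> base \<cdot> z) = s \<cdot> base \<cdot> z"
    "to_Delta \<cdot> z = pair C g (base \<cdot> z)"
proof (rule that[of "grp_part \<cdot> z"])
  show "incl \<cdot> pbl C stab s \<cdot> z = pair C (grp_part \<cdot> z) (s \<cdot> base \<cdot> z)"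
    by (rule fibre_incl[OF assms])
  have "to_Delta \<cdot> z = cross C (Idt C (carr G)) q \<cdot> incl \<cdot> pbl C stab s \<cdot> z" using assms by simp
  also have "\<dots> = cross C (Idt C (carr G)) q \<cdot> pair C (grp_part \<cdot> z) (s \<cdot> base \<cdot> z)"
    by (simp only: fibre_incl[OF assms])
  finally show "to_Delta \<cdot> z = pair C (grp_part \<cdot> z) (base \<cdot> z)" using assms by simp
qed (use assms fibre_stabilises[OF assms] in simp_all)

text \<open>
  An element of \<open>s\<^sup>*G\<^sub>X\<close> is determined by its component in \<open>G\<close> and its base point \<open>y\<close>, since its
  component in \<open>X\<close> is \<open>s y\<close>.
\<close>

lemma to_Delta_mono:
  assumes "u \<in> Ar C" "v \<in> Ar C" "Cod C u = fibre" "Cod C v = fibre" "to_Delta \<cdot> u = to_Delta \<cdot> v"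
  shows "u = v"
proof -
  obtain g where g: "g \<in> Ar C" "Dom C g = Dom C u" "Cod C g = carr G"
    "incl \<cdot> pbl C stab s \<cdot> u = pair C g (s \<cdot> base \<cdot> u)" "to_Delta \<cdot> u = pair C g (base \<cdot> u)"
    using fibre_parts[OF assms(1,3)] by metis
  obtain h where h: "h \<in> Ar C" "Dom C h = Dom C v" "Cod C h = carr G"
    "incl \<cdot> pbl C stab s \<cdot> v = pair C h (s \<cdot> base \<cdot> v)" "to_Delta \<cdot> v = pair C h (base \<cdot> v)"
    using fibre_parts[OF assms(2,4)] by metis
  have "pair C g (base \<cdot> u) = pair C h (base \<cdot> v)" using assms(5) g(5) h(5) by metis
  hence gh: "g = h" "base \<cdot> u = base \<cdot> v"
    by (rule pair_inject; use assms(1-4) g h in simp)+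
  have "incl \<cdot> pbl C stab s \<cdot> u = incl \<cdot> pbl C stab s \<cdot> v"
    unfolding g(4) h(4) gh ..
  with _ _ _ _ _ _ _ _ _ have "pbl C stab s \<cdot> u = pbl C stab s \<cdot> v"
    by (rule stab_mono[of "carr G" X a]) (use assms(1-4) in simp_all)
  with _ _ _ _ _ _ _ show "u = v"
    by (rule pb_mono[of stab s]) (use assms(1-4) gh(2) in simp_all)
qed

text \<open>
  The projections to \<open>G\<close> and to \<open>Q\<close> embed \<open>s\<^sup>*G\<^sub>X\<close> in \<open>G \<times> Q\<close> as a subgroup over \<open>Q\<close>, so
  the group laws need not be verified in the slice.
\<close>

lemma section_stab_in_Delta:
  assumes Delta: "group_object (slice C Q) (times_grp C Q G)"
  shows "(S, (carr S, to_Delta, carr (times_grp C Q G)), times_grp C Q G) \<in> Ar (Grp (slice C Q))"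
proof -
  interpret L: finite_products "slice C Q" by (rule slice_finite_products) simp
  let ?D = "times_grp C Q G" and ?d = "prr C (carr G) Q"
  let ?j = "(base, to_Delta, ?d)"
  let ?u = "pbl C base base" and ?v = "pbr C base base"
  have c [simp]: "carr S = base" "carr ?D = ?d"
    by (simp_all add: pullback_grp_def times_grp_def stab_grp_def Let_def)
  have uv [simp]: "?u \<in> Ar C" "?v \<in> Ar C" "Cod C ?u = fibre" "Cod C ?v = fibre" "Dom C ?v = Dom C ?u"
    using pb_typing[of base base] by simp_all
  have buv: "base \<cdot> ?v = base \<cdot> ?u" using pb_commutes[of base base] by simp
  obtain g where g: "g \<in> Ar C" "Dom C g = Dom C ?u" "Cod C g = carr G"
    "incl \<cdot> pbl C stab s \<cdot> ?u = pair C g (s \<cdot> base \<cdot> ?u)" "a \<cdot> pair C g (s \<cdot> base \<cdot> ?u) = s \<cdot> base \<cdot> ?u"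
    "to_Delta \<cdot> ?u = pair C g (base \<cdot> ?u)"
    using fibre_parts[OF uv(1,3)] by blast
  obtain h where h: "h \<in> Ar C" "Dom C h = Dom C ?u" "Cod C h = carr G"
    "incl \<cdot> pbl C stab s \<cdot> ?v = pair C h (s \<cdot> base \<cdot> ?u)" "a \<cdot> pair C h (s \<cdot> base \<cdot> ?u) = s \<cdot> base \<cdot> ?u"
    "to_Delta \<cdot> ?v = pair C h (base \<cdot> ?u)"
    using fibre_parts[OF uv(2,4)] unfolding buv uv(5) by blast
  have I: "Idt C fibre \<in> Ar C" "Cod C (Idt C fibre) = fibre" "Dom C (Idt C fibre) = fibre"
    "pbl C stab s \<cdot> Idt C fibre = pbl C stab s" "base \<cdot> Idt C fibre = base" "to_Delta \<cdot> Idt C fibre = to_Delta"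
    by simp_all
  obtain k where k: "k \<in> Ar C" "Dom C k = fibre" "Cod C k = carr G"
      "incl \<cdot> pbl C stab s = pair C k (s \<cdot> base)" "a \<cdot> pair C k (s \<cdot> base) = s \<cdot> base"
      "to_Delta = pair C k base"
    using fibre_parts[OF I(1,2)] unfolding I(3-6) by blast
  have d_j: "?d \<cdot> to_Delta = base" unfolding k(6) using k(1-3) by simp
  have j: "?j \<in> Ar (slice C Q)"
    using d_j to_Delta_typing by (simp add: hom_def del: to_Delta_typing)
  let ?w = "base \<cdot> ?u"
  let ?mz = "stab_mul \<cdot> pblift C stab stab (pbl C stab s \<cdot> ?u) (pbl C stab s \<cdot> ?v)"
  have mz: "?mz \<in> Ar C" "Dom C ?mz = Dom C ?w" "Cod C ?mz = Dom C incl"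
    "incl \<cdot> ?mz = pair C (mul G \<cdot> pair C g h) (s \<cdot> ?w)"
  proof -
    have p: "pbl C stab s \<cdot> ?u \<in> Ar C" "pbl C stab s \<cdot> ?v \<in> Ar C"
      "Dom C (pbl C stab s \<cdot> ?u) = Dom C (pbl C stab s \<cdot> ?v)"
      "Cod C (pbl C stab s \<cdot> ?u) = Dom C incl" "Cod C (pbl C stab s \<cdot> ?v) = Dom C incl"
      by simp_all
    have p': "g \<in> Ar C" "h \<in> Ar C" "s \<cdot> ?w \<in> Ar C" "Dom C g = Dom C (pbl C stab s \<cdot> ?v)"
      "Dom C h = Dom C (pbl C stab s \<cdot> ?v)" "Dom C (s \<cdot> ?w) = Dom C (pbl C stab s \<cdot> ?v)"
      "Cod C g = carr G" "Cod C h = carr G" "Cod C (s \<cdot> ?w) = X"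
      using g(1-3) h(1-3) by simp_all
    have dom: "Dom C (pbl C stab s \<cdot> ?v) = Dom C ?w" by simp
    show "?mz \<in> Ar C" "Dom C ?mz = Dom C ?w" "Cod C ?mz = Dom C incl"
      "incl \<cdot> ?mz = pair C (mul G \<cdot> pair C g h) (s \<cdot> ?w)"
      using stab_mul_element[OF p p' g(4) h(4)] unfolding dom by blast+
  qed
  define M where "M = pblift C stab s ?mz ?w"
  have M: "M \<in> Ar C" "Dom C M = Dom C ?w" "Cod C M = fibre" "base \<cdot> M = ?w"
    "to_Delta \<cdot> M = pair C (mul G \<cdot> pair C g h) ?w"
    unfolding M_def
    by (rule fibre_lift[of ?mz ?w "mul G \<cdot> pair C g h", OF mz(1) _ mz(2,3) _ mz(4)];
        use g(1-3) h(1-3) in simp)+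
  let ?iz = "stab_inv \<cdot> pbl C stab s"
  have iz: "?iz \<in> Ar C" "Dom C ?iz = Dom C base" "Cod C ?iz = Dom C incl"
    "incl \<cdot> ?iz = pair C (inverse_map G \<cdot> k) (s \<cdot> base)"
  proof -
    have p: "pbl C stab s \<in> Ar C" "Cod C (pbl C stab s) = Dom C incl" "k \<in> Ar C" "s \<cdot> base \<in> Ar C"
      "Dom C k = Dom C (pbl C stab s)" "Dom C (s \<cdot> base) = Dom C (pbl C stab s)"
      "Cod C k = carr G" "Cod C (s \<cdot> base) = X"
      using k(1-3) by simp_all
    have dom: "Dom C (pbl C stab s) = Dom C base" by simp
    show "?iz \<in> Ar C" "Dom C ?iz = Dom C base" "Cod C ?iz = Dom C incl"
      "incl \<cdot> ?iz = pair C (inverse_map G \<cdot> k) (s \<cdot> base)"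
      using stab_inv_element[OF p k(4)] unfolding dom by blast+
  qed
  define I where "I = pblift C stab s ?iz base"
  have I: "I \<in> Ar C" "Dom C I = Dom C base" "Cod C I = fibre" "base \<cdot> I = base"
    "to_Delta \<cdot> I = pair C (inverse_map G \<cdot> k) base"
    unfolding I_def
    by (rule fibre_lift[of ?iz base "inverse_map G \<cdot> k", OF iz(1) _ iz(2,3) _ iz(4)];
        use k(1-3) in simp)+
  let ?ez = "stab_unit \<cdot> s"
  have ez: "?ez \<in> Ar C" "Dom C ?ez = Dom C (Idt C Q)" "Cod C ?ez = Dom C incl"
    "incl \<cdot> ?ez = pair C (unit_map G \<cdot> bang C Q) (s \<cdot> Idt C Q)"
    using stab_unit_element[of s] by simp_all
  define E where "E = pblift C stab s ?ez (Idt C Q)"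
  have E: "E \<in> Ar C" "Dom C E = Dom C (Idt C Q)" "Cod C E = fibre" "base \<cdot> E = Idt C Q"
    "to_Delta \<cdot> E = pair C (unit_map G \<cdot> bang C Q) (Idt C Q)"
    unfolding E_def
    by (rule fibre_lift[of ?ez "Idt C Q" "unit_map G \<cdot> bang C Q", OF ez(1) _ ez(2,3) _ ez(4)];
        simp)+
  have S: "mul S = (?w, M, base)" "inverse_map S = (base, I, base)" "unit_map S = (Idt C Q, E, base)"
    unfolding M_def I_def E_def by (simp_all add: pullback_grp_def stab_grp_def Let_def mid_def)
  let ?l = "prl C (carr G) Q" and ?du = "pbl C ?d ?d" and ?dv = "pbr C ?d ?d"
  have D: "mul ?D = (?d \<cdot> ?du, pair C (mul G \<cdot> pair C (?l \<cdot> ?du) (?l \<cdot> ?dv)) (?d \<cdot> ?du), ?d)"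
    "inverse_map ?D = (?d, pair C (inverse_map G \<cdot> ?l) ?d, ?d)"
    "unit_map ?D = (Idt C Q, pair C (unit_map G \<cdot> bang C Q) (Idt C Q), ?d)"
    by (simp_all add: times_grp_def Let_def)
  have hom_mul: "?j \<cdot>\<^bsub>slice C Q\<^esub> mul S = mul ?D \<cdot>\<^bsub>slice C Q\<^esub> cross (slice C Q) ?j ?j"
  proof -
    have duv [simp]: "?du \<in> Ar C" "?dv \<in> Ar C" "Cod C ?du = prd C (carr G) Q" "Cod C ?dv = prd C (carr G) Q"
      "Dom C ?dv = Dom C ?du" "Dom C ?du = Dom C (pbeq C ?d ?d)"
      using pb_typing[of ?d ?d] by simp_all
    define r where "r = pblift C ?d ?d (to_Delta \<cdot> ?u) (to_Delta \<cdot> ?v)"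
    have r: "r \<in> Ar C" "Cod C r = Dom C ?du" "?du \<cdot> r = pair C g ?w" "?dv \<cdot> r = pair C h ?w"
      unfolding r_def g(6) h(6) using g(1-3) h(1-3) pblift_props[of ?d ?d "pair C g ?w" "pair C h ?w"]
      by simp_all
    have "pair C (mul G \<cdot> pair C (?l \<cdot> ?du) (?l \<cdot> ?dv)) (?d \<cdot> ?du) \<cdot> r = pair C (mul G \<cdot> pair C g h) ?w"
      using r g(1-3) h(1-3) by simp
    also have "\<dots> = to_Delta \<cdot> M" by (rule M(5)[symmetric])
    finally show ?thesis
      unfolding S D slice_cross[OF j j] r_def by simp
  qed
  have "group_object (slice C Q) S"
  proof (rule L.subgroup_object[OF Delta, of ?j])
    show "mul S \<in> hom (slice C Q) (prd (slice C Q) (carr S) (carr S)) (carr S)"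
      unfolding S slice_hom_iff using M(1-4) g(1-3) h(1-3) by simp
    show "inverse_map S \<in> hom (slice C Q) (carr S) (carr S)"
      unfolding S slice_hom_iff using I(1-4) k(1-3) by simp
    show "unit_map S \<in> hom (slice C Q) (one (slice C Q)) (carr S)"
      unfolding S slice_hom_iff using E(1-4) by simp
    show "?j \<cdot>\<^bsub>slice C Q\<^esub> inverse_map S = inverse_map ?D \<cdot>\<^bsub>slice C Q\<^esub> ?j"
    proof -
      have "to_Delta \<cdot> I = pair C (inverse_map G \<cdot> k) base" by (rule I(5))
      also have "\<dots> = pair C (inverse_map G \<cdot> ?l) ?d \<cdot> to_Delta"
        unfolding k(6) using k(1-3) by simp
      finally show ?thesis unfolding S D by simp
    qed
    show "?j \<cdot>\<^bsub>slice C Q\<^esub> unit_map S = unit_map ?D"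
      unfolding S D using E(5) by simp
    fix x y
    assume *: "x \<in> Ar (slice C Q)" "y \<in> Ar (slice C Q)" "Cod (slice C Q) x = carr S" "Cod (slice C Q) y = carr S"
      "?j \<cdot>\<^bsub>slice C Q\<^esub> x = ?j \<cdot>\<^bsub>slice C Q\<^esub> y"
    obtain p f p' f' where xy: "x = (p, f, base)" "y = (p', f', base)" "f \<in> Ar C" "f' \<in> Ar C"
      "Cod C f = fibre" "Cod C f' = fibre"
      using *(1-4) by (cases x; cases y) (auto simp: hom_def)
    have "p = p'" "to_Delta \<cdot> f = to_Delta \<cdot> f'" using *(5) unfolding xy by simp_all
    thus "x = y" using to_Delta_mono[OF xy(3-6)] unfolding xy(1,2) by simp
  qed (use j hom_mul in simp_all)
  moreover have "?j \<in> hom (slice C Q) base ?d"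
    using j by (simp add: hom_def del: slice_simps(2))
  ultimately show ?thesis
    unfolding L.Grp_Ar using Delta hom_mul by simp
qed

end

section \<open>Limits, coequalisers and OST for graphs\<close>

declare slice_simps [simp del]

text \<open>
  Edges and vertices are two functors from graphs to \<open>C\<close> that preserve the chosen limits on the nose.
  Facts about both are obtained at once from this locale.
\<close>

locale limit_functor = A: finite_limits A + B: finite_limits B
  for A :: "('o, 'm, 'z) lcat_scheme" and B :: "('p, 'n, 'y) lcat_scheme" +
  fixes Fo :: "'o \<Rightarrow> 'p" and Fa :: "'m \<Rightarrow> 'n"
  assumes Fo_Fa: "is_functor A B Fo Fa"
    and Fo_one: "Fo (one A) = one B"
    and Fo_prd: "\<lbrakk>X \<in> Ob A; Y \<in> Ob A\<rbrakk> \<Longrightarrow> Fo (prd A X Y) = prd B (Fo X) (Fo Y)"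
    and Fa_prl: "\<lbrakk>X \<in> Ob A; Y \<in> Ob A\<rbrakk> \<Longrightarrow> Fa (prl A X Y) = prl B (Fo X) (Fo Y)"
    and Fa_prr: "\<lbrakk>X \<in> Ob A; Y \<in> Ob A\<rbrakk> \<Longrightarrow> Fa (prr A X Y) = prr B (Fo X) (Fo Y)"
    and Fa_eqz: "\<lbrakk>f \<in> Ar A; g \<in> Ar A; Dom A f = Dom A g; Cod A f = Cod A g\<rbrakk>
      \<Longrightarrow> Fa (eqz A f g) = eqz B (Fa f) (Fa g)"
begin

lemma Fo_Ob [simp]: "X \<in> Ob A \<Longrightarrow> Fo X \<in> Ob B"
  and Fa_Idt [simp]: "X \<in> Ob A \<Longrightarrow> Fa (Idt A X) = Idt B (Fo X)"
  using Fo_Fa unfolding is_functor_def by blast+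

lemma Fa_typing [simp]:
  assumes "f \<in> Ar A"
  shows "Fa f \<in> Ar B" "Dom B (Fa f) = Fo (Dom A f)" "Cod B (Fa f) = Fo (Cod A f)"
  using Fo_Fa assms unfolding is_functor_def hom_def by auto

lemma Fa_comp [simp]:
  assumes "f \<in> Ar A" "g \<in> Ar A" "Dom A g = Cod A f"
  shows "Fa (g \<cdot>\<^bsub>A\<^esub> f) = Fa g \<cdot>\<^bsub>B\<^esub> Fa f"
  using Fo_Fa assms unfolding is_functor_def hom_def by auto

declare Fo_one [simp] Fo_prd [simp] Fa_prl [simp] Fa_prr [simp] Fa_eqz [simp]

lemma Fa_pair [simp]:
  assumes "f \<in> Ar A" "g \<in> Ar A" "Dom A f = Dom A g"
  shows "Fa (pair A f g) = pair B (Fa f) (Fa g)"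
proof (rule B.prd_eqI[of _ _ "Fo (Cod A f)" "Fo (Cod A g)"])
  let ?p = "prl A (Cod A f) (Cod A g)" and ?r = "prr A (Cod A f) (Cod A g)"
  have "Fa (?p \<cdot>\<^bsub>A\<^esub> pair A f g) = Fa f" "Fa (?r \<cdot>\<^bsub>A\<^esub> pair A f g) = Fa g"
    using assms by (simp_all del: Fa_comp)
  thus "prl B (Fo (Cod A f)) (Fo (Cod A g)) \<cdot>\<^bsub>B\<^esub> Fa (pair A f g)
      = prl B (Fo (Cod A f)) (Fo (Cod A g)) \<cdot>\<^bsub>B\<^esub> pair B (Fa f) (Fa g)"
    "prr B (Fo (Cod A f)) (Fo (Cod A g)) \<cdot>\<^bsub>B\<^esub> Fa (pair A f g)
      = prr B (Fo (Cod A f)) (Fo (Cod A g)) \<cdot>\<^bsub>B\<^esub> pair B (Fa f) (Fa g)"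
    using assms by (simp_all del: A.prj_pair)
qed (use assms in simp_all)

lemma Fa_cross [simp]: "\<lbrakk>f \<in> Ar A; g \<in> Ar A\<rbrakk> \<Longrightarrow> Fa (cross A f g) = cross B (Fa f) (Fa g)"
  by (simp add: cross_def)

lemma Fa_assoc [simp]:
  "\<lbrakk>X \<in> Ob A; Y \<in> Ob A; Z \<in> Ob A\<rbrakk> \<Longrightarrow> Fa (assoc A X Y Z) = assoc B (Fo X) (Fo Y) (Fo Z)"
  by (simp add: assoc_def Let_def)

lemma Fa_bang [simp]: "X \<in> Ob A \<Longrightarrow> Fa (bang A X) = bang B (Fo X)"
  using B.bang_unique[of "Fa (bang A X)"] by simp

lemma Fa_pb [simp]:
  assumes "p \<in> Ar A" "r \<in> Ar A" "Cod A p = Cod A r"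
  shows "Fa (pbeq A p r) = pbeq B (Fa p) (Fa r)" "Fa (pbl A p r) = pbl B (Fa p) (Fa r)"
    "Fa (pbr A p r) = pbr B (Fa p) (Fa r)"
  using assms A.pb_typing[OF assms] by (simp_all add: pbeq_def pbl_def pbr_def)

lemma Fa_stab:
  assumes "U \<in> Ob A" "X \<in> Ob A" "a \<in> Ar A" "Dom A a = prd A U X" "Cod A a = X"
  shows "Fa (stab_incl A U X a) = stab_incl B (Fo U) (Fo X) (Fa a)"
    "Fa (stab_map A U X a) = stab_map B (Fo U) (Fo X) (Fa a)"
  using assms A.eqz_props[of a "prr A U X"] by (simp_all add: stab_incl_def stab_map_def)

definition image_grp :: "('o, 'm) grp \<Rightarrow> ('p, 'n) grp" where
  "image_grp G = \<lparr>carr = Fo (carr G), mul = Fa (mul G), inverse_map = Fa (inverse_map G),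
     unit_map = Fa (unit_map G)\<rparr>"

lemma image_group_object:
  assumes "group_object A G"
  shows "group_object B (image_grp G)"
proof -
  note [simp] = A.group_object_typing[OF assms]
  let ?A = "carr G"
  have *: "Fa (mul G \<cdot>\<^bsub>A\<^esub> cross A (mul G) (Idt A ?A) \<cdot>\<^bsub>A\<^esub> assoc A ?A ?A ?A)
      = Fa (mul G \<cdot>\<^bsub>A\<^esub> cross A (Idt A ?A) (mul G))"
    "Fa (mul G \<cdot>\<^bsub>A\<^esub> pair A (unit_map G \<cdot>\<^bsub>A\<^esub> bang A ?A) (Idt A ?A)) = Fa (Idt A ?A)"
    "Fa (mul G \<cdot>\<^bsub>A\<^esub> pair A (Idt A ?A) (unit_map G \<cdot>\<^bsub>A\<^esub> bang A ?A)) = Fa (Idt A ?A)"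
    "Fa (mul G \<cdot>\<^bsub>A\<^esub> pair A (inverse_map G) (Idt A ?A)) = Fa (unit_map G \<cdot>\<^bsub>A\<^esub> bang A ?A)"
    "Fa (mul G \<cdot>\<^bsub>A\<^esub> pair A (Idt A ?A) (inverse_map G)) = Fa (unit_map G \<cdot>\<^bsub>A\<^esub> bang A ?A)"
    using assms unfolding group_object_def Let_def by simp_all
  show ?thesis
    using * unfolding group_object_def Let_def image_grp_def hom_def
    by (simp del: A.mul_one A.mul_inverse)
qed

lemma image_action:
  assumes "group_object A G" "action A G X a"
  shows "action B (image_grp G) (Fo X) (Fa a)"
proof -
  note [simp] = A.group_object_typing[OF assms(1)] A.action_typing[OF assms(2)]
  have *: "Fa (a \<cdot>\<^bsub>A\<^esub> pair A (unit_map G \<cdot>\<^bsub>A\<^esub> bang A X) (Idt A X)) = Fa (Idt A X)"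
    "Fa (a \<cdot>\<^bsub>A\<^esub> cross A (mul G) (Idt A X) \<cdot>\<^bsub>A\<^esub> assoc A (carr G) (carr G) X)
       = Fa (a \<cdot>\<^bsub>A\<^esub> cross A (Idt A (carr G)) a)"
    using assms unfolding action_def by simp_all
  show ?thesis
    using * unfolding action_def hom_def image_grp_def by simp
qed

text \<open>
  All constructions in the \<open>OST\<close> diagram are finite limits, so its image is the \<open>OST\<close> diagram of the
  image of the action.
\<close>

lemma image_OST:
  assumes OST: "OST B" and G: "group_object A G" and a: "action A G X a"
    and q: "q \<in> Ar A" "Dom A q = X" and s: "is_section A s q"
    and quotient: "is_quotient B (Fo (carr G)) (Fo X) (Fa a) (Fa q)"
  shows "is_coequaliser B
     (Fa (cross A (Idt A (carr G)) (pbr A (stab_map A (carr G) X a) s)))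
     (Fa (cross A (mul G) q \<cdot>\<^bsub>A\<^esub> assoc A (carr G) (carr G) X \<cdot>\<^bsub>A\<^esub>
        cross A (Idt A (carr G)) (stab_incl A (carr G) X a) \<cdot>\<^bsub>A\<^esub>
        cross A (Idt A (carr G)) (pbl A (stab_map A (carr G) X a) s)))
     (Fa (a \<cdot>\<^bsub>A\<^esub> cross A (Idt A (carr G)) s))"
proof -
  note [simp] = A.group_object_typing[OF G] A.action_typing[OF a] q
  have s' [simp]: "s \<in> Ar A" "Dom A s = Cod A q" "Cod A s = X" and "q \<cdot>\<^bsub>A\<^esub> s = Idt A (Cod A q)"
    using s by (auto simp: is_section_def hom_def)
  hence "Fa (q \<cdot>\<^bsub>A\<^esub> s) = Fa (Idt A (Cod A q))" by simp
  hence sec: "is_section B (Fa s) (Fa q)"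
    by (simp add: is_section_def hom_def)
  let ?c = "stab_map A (carr G) X a"
  have [simp]: "?c \<in> Ar A" "Cod A ?c = X" "Dom A ?c = Dom A (stab_incl A (carr G) X a)"
    "stab_incl A (carr G) X a \<in> Ar A" "Cod A (stab_incl A (carr G) X a) = prd A (carr G) X"
    using A.eqz_props[of a "prr A (carr G) X"] by (simp_all add: stab_map_def stab_incl_def)
  show ?thesis
    using OST[unfolded OST_def, rule_format, OF conjI[OF image_group_object[OF G] image_action[OF G a]]]
      quotient sec
    by (simp add: Let_def image_grp_def Fa_stab)
qed

end

context category
begin

text \<open>
  Needed to pass from one coequaliser of graphs that is formed componentwise to all of them.
\<close>

lemma coequaliser_iso_transport:
  assumes q: "is_coequaliser C f g q" and j: "is_iso C j" "Dom C j = Cod C q"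
  shows "is_coequaliser C f g (j \<cdot> q)"
proof -
  note [simp] = coequaliser_typing(1-6)[OF q]
  obtain i where i: "j \<in> Ar C" "i \<in> Ar C" "Dom C i = Cod C j" "Cod C i = Dom C j"
    "i \<cdot> j = Idt C (Dom C j)" "j \<cdot> i = Idt C (Cod C j)"
    using j(1) by (rule is_isoE)
  show ?thesis
  proof (rule coequaliserI)
    show "(j \<cdot> q) \<cdot> f = (j \<cdot> q) \<cdot> g" using coequaliser_typing(7)[OF q] i j by simp
  next
    fix h
    assume h: "h \<in> Ar C" "Dom C h = Cod C f" "h \<cdot> f = h \<cdot> g"
    obtain k where k: "k \<in> Ar C" "Dom C k = Cod C q" "Cod C k = Cod C h" "k \<cdot> q = h"
      using coequaliser_lift[OF q h] .
    have "(i \<cdot> j) \<cdot> q = q" unfolding i(5) using j(2) by simp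
    hence "(k \<cdot> i) \<cdot> j \<cdot> q = h" using i(1-4) j(2) k by simp
    thus "\<exists>k\<in>Ar C. Dom C k = Cod C (j \<cdot> q) \<and> Cod C k = Cod C h \<and> k \<cdot> j \<cdot> q = h"
      using i(1-4) j(2) k(1-3) by (intro bexI[of _ "k \<cdot> i"]) simp_all
  next
    fix u v
    assume uv: "u \<in> Ar C" "v \<in> Ar C" "Dom C u = Cod C (j \<cdot> q)" "Dom C v = Cod C (j \<cdot> q)"
      "u \<cdot> j \<cdot> q = v \<cdot> j \<cdot> q"
    have "(u \<cdot> j) \<cdot> q = (v \<cdot> j) \<cdot> q" using uv i(1) j(2) by simp
    with _ _ _ _ have *: "u \<cdot> j = v \<cdot> j"
      by (rule coequaliser_epi[OF q]) (use uv(1-4) i(1) j(2) in simp_all)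
    have "u \<cdot> j \<cdot> i = v \<cdot> j \<cdot> i"
      by (rule comp_eq_precomp[OF *]) (use uv(1-4) i(1-4) j(2) in simp_all)
    thus "u = v" unfolding i(6) using uv(1-4) i(1) j(2) by simp
  qed (use i(1-4) j in simp_all)
qed

end

lemma Graph_simps [simp]:
  "Ob (Graph C) = {X. is_graph C X}" "Ar (Graph C) = {f. is_gmap C f}"
  "Dom (Graph C) = gsrc" "Cod (Graph C) = gtgt"
  "Idt (Graph C) X = \<lparr>gsrc = X, gtgt = X, emap = Idt C (edges X), vmap = Idt C (verts X)\<rparr>"
  "g \<cdot>\<^bsub>Graph C\<^esub> f = \<lparr>gsrc = gsrc f, gtgt = gtgt g,
     emap = emap g \<cdot>\<^bsub>C\<^esub> emap f, vmap = vmap g \<cdot>\<^bsub>C\<^esub> vmap f\<rparr>"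
  "one (Graph C) = const_graph C (one C)"
  "prd (Graph C) = prd_graph C"
  "prl (Graph C) X Y = \<lparr>gsrc = prd_graph C X Y, gtgt = X,
     emap = prl C (edges X) (edges Y), vmap = prl C (verts X) (verts Y)\<rparr>"
  "prr (Graph C) X Y = \<lparr>gsrc = prd_graph C X Y, gtgt = Y,
     emap = prr C (edges X) (edges Y), vmap = prr C (verts X) (verts Y)\<rparr>"
  "eqz (Graph C) f g = \<lparr>gsrc = eqz_graph C f g, gtgt = gsrc f,
     emap = eqz C (emap f) (emap g), vmap = eqz C (vmap f) (vmap g)\<rparr>"
  by (simp_all add: Graph_def)

lemma gmap_eqI:
  fixes f g :: "('o, 'm) gmap"
  assumes "gsrc f = gsrc g" "gtgt f = gtgt g" "emap f = emap g" "vmap f = vmap g"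
  shows "f = g"
  using assms by simp

lemma prd_graph_simps [simp]:
  "edges (prd_graph C X Y) = prd C (edges X) (edges Y)"
  "verts (prd_graph C X Y) = prd C (verts X) (verts Y)"
  "d0 (prd_graph C X Y) = cross C (d0 X) (d0 Y)" "d1 (prd_graph C X Y) = cross C (d1 X) (d1 Y)"
  by (simp_all add: prd_graph_def)

lemma const_graph_simps [simp]:
  "edges (const_graph C A) = A" "verts (const_graph C A) = A"
  "d0 (const_graph C A) = Idt C A" "d1 (const_graph C A) = Idt C A"
  by (simp_all add: const_graph_def)

lemma is_graphI:
  assumes "edges X \<in> Ob C" "verts X \<in> Ob C" "d0 X \<in> Ar C" "Dom C (d0 X) = edges X" "Cod C (d0 X) = verts X"
    "d1 X \<in> Ar C" "Dom C (d1 X) = edges X" "Cod C (d1 X) = verts X"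
  shows "is_graph C X"
  using assms by (simp add: is_graph_def hom_def)

lemma is_graph_typing [simp]:
  assumes "is_graph C X"
  shows "edges X \<in> Ob C" "verts X \<in> Ob C" "d0 X \<in> Ar C" "Dom C (d0 X) = edges X" "Cod C (d0 X) = verts X"
    "d1 X \<in> Ar C" "Dom C (d1 X) = edges X" "Cod C (d1 X) = verts X"
  using assms by (auto simp: is_graph_def hom_def)

lemma is_gmap_typing [simp]:
  assumes "is_gmap C f"
  shows "is_graph C (gsrc f)" "is_graph C (gtgt f)"
    "emap f \<in> Ar C" "Dom C (emap f) = edges (gsrc f)" "Cod C (emap f) = edges (gtgt f)"
    "vmap f \<in> Ar C" "Dom C (vmap f) = verts (gsrc f)" "Cod C (vmap f) = verts (gtgt f)"
  using assms by (auto simp: is_gmap_def hom_def)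

lemma is_gmap_natural:
  assumes "is_gmap C f"
  shows "d0 (gtgt f) \<cdot>\<^bsub>C\<^esub> emap f = vmap f \<cdot>\<^bsub>C\<^esub> d0 (gsrc f)"
    "d1 (gtgt f) \<cdot>\<^bsub>C\<^esub> emap f = vmap f \<cdot>\<^bsub>C\<^esub> d1 (gsrc f)"
  using assms unfolding is_gmap_def by blast+

lemma is_gmapI:
  assumes "is_graph C X" "is_graph C Y" "fe \<in> Ar C" "Dom C fe = edges X" "Cod C fe = edges Y"
    "fv \<in> Ar C" "Dom C fv = verts X" "Cod C fv = verts Y"
    "d0 Y \<cdot>\<^bsub>C\<^esub> fe = fv \<cdot>\<^bsub>C\<^esub> d0 X" "d1 Y \<cdot>\<^bsub>C\<^esub> fe = fv \<cdot>\<^bsub>C\<^esub> d1 X"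
  shows "is_gmap C \<lparr>gsrc = X, gtgt = Y, emap = fe, vmap = fv\<rparr>"
  using assms by (auto simp: is_gmap_def hom_def)

lemma (in category) gmap_precomp:
  assumes "is_gmap C f" "h \<in> Ar C" "Cod C h = edges (gsrc f)"
  shows "d0 (gtgt f) \<cdot> emap f \<cdot> h = vmap f \<cdot> d0 (gsrc f) \<cdot> h"
    "d1 (gtgt f) \<cdot> emap f \<cdot> h = vmap f \<cdot> d1 (gsrc f) \<cdot> h"
  by (rule comp_eq_precomp[OF is_gmap_natural(1)[OF assms(1)]]
      comp_eq_precomp[OF is_gmap_natural(2)[OF assms(1)]]; use assms in simp)+

context finite_limits
begin

abbreviation "Gr \<equiv> Graph C"

lemma Graph_category: "category Gr"
proof
  fix f A B g D
  assume f: "f \<in> hom Gr A B" and g: "g \<in> hom Gr B D"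
  have "is_gmap C \<lparr>gsrc = gsrc f, gtgt = gtgt g, emap = emap g \<cdot> emap f, vmap = vmap g \<cdot> vmap f\<rparr>"
    using f g gmap_precomp[of g "emap f"] is_gmap_natural[of C f]
    by (intro is_gmapI) (auto simp: hom_def)
  thus "g \<cdot>\<^bsub>Gr\<^esub> f \<in> hom Gr A D"
    using f g by (simp add: hom_def)
next
  fix A assume "A \<in> Ob Gr"
  thus "Idt Gr A \<in> hom Gr A A"
    by (auto simp: hom_def intro!: is_gmapI)
qed (auto simp: hom_def intro!: gmap_eqI)

lemma Graph_coequaliserI:
  assumes f: "is_gmap C f" and g: "is_gmap C g" "gsrc g = gsrc f" "gtgt g = gtgt f"
    and q: "is_gmap C q" "gsrc q = gtgt f"
    and e: "is_coequaliser C (emap f) (emap g) (emap q)"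
    and v: "is_coequaliser C (vmap f) (vmap g) (vmap q)"
  shows "is_coequaliser Gr f g q"
proof -
  interpret D: category Gr by (rule Graph_category)
  note [simp] = f g q
  show ?thesis
  proof (rule D.coequaliserI)
    show "q \<cdot>\<^bsub>Gr\<^esub> f = q \<cdot>\<^bsub>Gr\<^esub> g"
      using coequaliser_typing(7)[OF e] coequaliser_typing(7)[OF v] by simp
  next
    fix h
    assume "h \<in> Ar Gr" "Dom Gr h = Cod Gr f" "h \<cdot>\<^bsub>Gr\<^esub> f = h \<cdot>\<^bsub>Gr\<^esub> g"
    hence h [simp]: "is_gmap C h" "gsrc h = gtgt f" and hh: "emap h \<cdot> emap f = emap h \<cdot> emap g"
      "vmap h \<cdot> vmap f = vmap h \<cdot> vmap g" by simp_all
    obtain ke where ke: "ke \<in> Ar C" "Dom C ke = edges (gtgt q)" "Cod C ke = edges (gtgt h)"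
      "ke \<cdot> emap q = emap h"
      using coequaliser_lift[OF e _ _ hh(1)] by auto
    obtain kv where kv: "kv \<in> Ar C" "Dom C kv = verts (gtgt q)" "Cod C kv = verts (gtgt h)"
      "kv \<cdot> vmap q = vmap h"
      using coequaliser_lift[OF v _ _ hh(2)] by auto
    \<comment> \<open>Stated for a variable \<open>d\<close>, to be used for both \<open>d0\<close> and \<open>d1\<close>.\<close>
    have natural: "d (gtgt h) \<cdot> ke = kv \<cdot> d (gtgt q)"
      if d: "\<And>X. is_graph C X \<Longrightarrow> d X \<in> Ar C \<and> Dom C (d X) = edges X \<and> Cod C (d X) = verts X"
        "\<And>f. is_gmap C f \<Longrightarrow> d (gtgt f) \<cdot> emap f = vmap f \<cdot> d (gsrc f)" for d
    proof (rule coequaliser_epi[OF e])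
      have "kv \<cdot> d (gtgt q) \<cdot> emap q = (kv \<cdot> vmap q) \<cdot> d (gtgt f)"
        using kv(1-3) d by simp
      also have "\<dots> = d (gtgt h) \<cdot> ke \<cdot> emap q" unfolding ke(4) kv(4) using d(2)[of h] by simp
      finally show "(d (gtgt h) \<cdot> ke) \<cdot> emap q = (kv \<cdot> d (gtgt q)) \<cdot> emap q"
        using ke(1-3) kv(1-3) d(1) by simp
    qed (use ke(1-3) kv(1-3) d(1) in simp_all)
    have "d0 (gtgt h) \<cdot> ke = kv \<cdot> d0 (gtgt q)" "d1 (gtgt h) \<cdot> ke = kv \<cdot> d1 (gtgt q)"
      by (rule natural; simp add: is_gmap_natural)+
    hence "is_gmap C \<lparr>gsrc = gtgt q, gtgt = gtgt h, emap = ke, vmap = kv\<rparr>"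
      using ke(1-3) kv(1-3) by (intro is_gmapI) simp_all
    thus "\<exists>k\<in>Ar Gr. Dom Gr k = Cod Gr q \<and> Cod Gr k = Cod Gr h \<and>
        k \<cdot>\<^bsub>Gr\<^esub> q = h"
      using ke(4) kv(4)
      by (intro bexI[of _ "\<lparr>gsrc = gtgt q, gtgt = gtgt h, emap = ke, vmap = kv\<rparr>"])
        (simp_all add: gmap_eqI)
  next
    fix u w
    assume "u \<in> Ar Gr" "w \<in> Ar Gr" "Dom Gr u = Cod Gr q"
      "Dom Gr w = Cod Gr q" and eq: "u \<cdot>\<^bsub>Gr\<^esub> q = w \<cdot>\<^bsub>Gr\<^esub> q"
    hence uw: "is_gmap C u" "is_gmap C w" "gsrc u = gtgt q" "gsrc w = gtgt q" by simp_all
    have "emap u = emap w"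
      by (rule coequaliser_epi[OF e]) (use uw eq in simp_all)
    moreover have "vmap u = vmap w"
      by (rule coequaliser_epi[OF v]) (use uw eq in simp_all)
    ultimately show "u = w" using uw eq by (intro gmap_eqI) simp_all
  qed simp_all
qed

lemma Graph_coequaliserI':
  assumes "f \<in> Ar Gr" "g \<in> Ar Gr" "q \<in> Ar Gr" "Dom Gr g = Dom Gr f"
    "Cod Gr g = Cod Gr f" "Dom Gr q = Cod Gr f"
    "is_coequaliser C (emap f) (emap g) (emap q)" "is_coequaliser C (vmap f) (vmap g) (vmap q)"
  shows "is_coequaliser Gr f g q"
  using assms by (intro Graph_coequaliserI) simp_all

lemma Graph_coequaliser_exists:
  assumes "has_coequalisers C"
    and f: "is_gmap C f" and g: "is_gmap C g" "gsrc g = gsrc f" "gtgt g = gtgt f"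
  obtains q where "is_gmap C q" "gsrc q = gtgt f" "is_coequaliser C (emap f) (emap g) (emap q)"
    "is_coequaliser C (vmap f) (vmap g) (vmap q)"
proof -
  note [simp] = f g
  obtain qe where e: "is_coequaliser C (emap f) (emap g) qe"
    using assms unfolding has_coequalisers_def parallel_def hom_def by fastforce
  obtain qv where v: "is_coequaliser C (vmap f) (vmap g) qv"
    using assms unfolding has_coequalisers_def parallel_def hom_def by fastforce
  note [simp] = coequaliser_typing(3,6)[OF e] coequaliser_typing(3,6)[OF v]
  have ex: "\<exists>d' \<in> Ar C. Dom C d' = Cod C qe \<and> Cod C d' = Cod C qv \<and> d' \<cdot> qe = qv \<cdot> d (gtgt f)"
    if d: "\<And>X. is_graph C X \<Longrightarrow> d X \<in> Ar C \<and> Dom C (d X) = edges X \<and> Cod C (d X) = verts X"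
      "\<And>f. is_gmap C f \<Longrightarrow> d (gtgt f) \<cdot> emap f = vmap f \<cdot> d (gsrc f)" for d
  proof -
    have "qv \<cdot> vmap f \<cdot> d (gsrc f) = qv \<cdot> vmap g \<cdot> d (gsrc f)"
      by (rule comp_eq_precomp[OF coequaliser_typing(7)[OF v]]) (use d(1) in simp_all)
    hence "(qv \<cdot> d (gtgt f)) \<cdot> emap f = (qv \<cdot> d (gtgt f)) \<cdot> emap g"
      using d(1) d(2)[of f] d(2)[of g] by simp
    with _ _ obtain d' where "d' \<in> Ar C" "Dom C d' = Cod C qe" "Cod C d' = Cod C (qv \<cdot> d (gtgt f))"
      "d' \<cdot> qe = qv \<cdot> d (gtgt f)"
      by (rule coequaliser_lift[OF e]) (use d(1) in simp_all)
    thus ?thesis using d(1) by (intro bexI[of _ d']) simp_all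
  qed
  obtain e0 where e0: "e0 \<in> Ar C" "Dom C e0 = Cod C qe" "Cod C e0 = Cod C qv" "e0 \<cdot> qe = qv \<cdot> d0 (gtgt f)"
    using ex[of d0] by (auto simp: is_gmap_natural)
  obtain e1 where e1: "e1 \<in> Ar C" "Dom C e1 = Cod C qe" "Cod C e1 = Cod C qv" "e1 \<cdot> qe = qv \<cdot> d1 (gtgt f)"
    using ex[of d1] by (auto simp: is_gmap_natural)
  let ?Q = "\<lparr>edges = Cod C qe, verts = Cod C qv, d0 = e0, d1 = e1\<rparr>"
  have "is_graph C ?Q" using e0(1-3) e1(1-3) by (intro is_graphI) simp_all
  hence "is_gmap C \<lparr>gsrc = gtgt f, gtgt = ?Q, emap = qe, vmap = qv\<rparr>"
    using e0(4) e1(4) by (intro is_gmapI) simp_all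
  from that[OF this] e v show ?thesis by simp
qed

text \<open>
  A coequaliser of graphs is isomorphic to the one formed on edges and vertices, which exists because
  \<open>C\<close> has coequalisers.
\<close>

lemma Graph_coequaliserE:
  assumes "has_coequalisers C" and coeq: "is_coequaliser Gr f g q"
  shows "is_coequaliser C (emap f) (emap g) (emap q)" "is_coequaliser C (vmap f) (vmap g) (vmap q)"
proof -
  interpret D: category Gr by (rule Graph_category)
  have fgq [simp]: "is_gmap C f" "is_gmap C g" "gsrc g = gsrc f" "gtgt g = gtgt f"
    "is_gmap C q" "gsrc q = gtgt f"
    using D.coequaliser_typing[OF coeq] by simp_all
  obtain p where p [simp]: "is_gmap C p" "gsrc p = gtgt f"
    and pc: "is_coequaliser C (emap f) (emap g) (emap p)" "is_coequaliser C (vmap f) (vmap g) (vmap p)"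
    using Graph_coequaliser_exists[OF assms(1) fgq(1-4)] .
  have coeq': "is_coequaliser Gr f g p"
    using pc by (intro Graph_coequaliserI) simp_all
  obtain i where i: "i \<in> Ar Gr" "Dom Gr i = gtgt p" "Cod Gr i = gtgt q"
    "i \<cdot>\<^bsub>Gr\<^esub> p = q"
    using D.coequaliser_lift[OF coeq', of q] D.coequaliser_typing(7)[OF coeq] by auto
  obtain j where j: "j \<in> Ar Gr" "Dom Gr j = gtgt q" "Cod Gr j = gtgt p"
    "j \<cdot>\<^bsub>Gr\<^esub> q = p"
    using D.coequaliser_lift[OF coeq, of p] D.coequaliser_typing(7)[OF coeq'] by auto
  have ij: "is_gmap C i" "gsrc i = gtgt p" "gtgt i = gtgt q" "is_gmap C j" "gsrc j = gtgt q" "gtgt j = gtgt p"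
    using i j by simp_all
  have comps: "emap i \<cdot> emap p = emap q" "emap j \<cdot> emap q = emap p"
     "vmap i \<cdot> vmap p = vmap q" "vmap j \<cdot> vmap q = vmap p"
    using i(4) j(4) by (auto dest: arg_cong[of _ _ emap] arg_cong[of _ _ vmap])
  have "j \<cdot>\<^bsub>Gr\<^esub> i = Idt Gr (gtgt p)"
    by (rule D.coequaliser_epi[OF coeq'])
      (use ij comps D.comp_typing(1)[OF i(1) j(1)] D.Idt_typing(1)[of "gtgt p"] in \<open>simp_all add: gmap_eqI\<close>)
  moreover have "i \<cdot>\<^bsub>Gr\<^esub> j = Idt Gr (gtgt q)"
    by (rule D.coequaliser_epi[OF coeq])
      (use ij comps D.comp_typing(1)[OF j(1) i(1)] D.Idt_typing(1)[of "gtgt q"] in \<open>simp_all add: gmap_eqI\<close>)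
  ultimately have "is_iso C (emap i)" "is_iso C (vmap i)"
    using ij is_isoI[of "emap i" "emap j"] is_isoI[of "vmap i" "vmap j"] by simp_all
  thus "is_coequaliser C (emap f) (emap g) (emap q)" "is_coequaliser C (vmap f) (vmap g) (vmap q)"
    using coequaliser_iso_transport[OF pc(1), of "emap i"] coequaliser_iso_transport[OF pc(2), of "vmap i"]
      ij comps by simp_all
qed

lemma Graph_has_coequalisers:
  assumes "has_coequalisers C"
  shows "has_coequalisers Gr"
  unfolding has_coequalisers_def
proof (intro allI impI)
  fix f g
  assume "parallel Gr f g"
  hence fg: "is_gmap C f" "is_gmap C g" "gsrc g = gsrc f" "gtgt g = gtgt f"
    by (simp_all add: parallel_def hom_def)
  obtain p where "is_gmap C p" "gsrc p = gtgt f"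
    "is_coequaliser C (emap f) (emap g) (emap p)" "is_coequaliser C (vmap f) (vmap g) (vmap p)"
    using Graph_coequaliser_exists[OF assms fg] .
  with fg show "\<exists>q. is_coequaliser Gr f g q"
    by (blast intro: Graph_coequaliserI)
qed

end

context finite_limits
begin

lemma prd_is_graph [simp]: "\<lbrakk>is_graph C X; is_graph C Y\<rbrakk> \<Longrightarrow> is_graph C (prd_graph C X Y)"
  by (rule is_graphI) simp_all

lemma const_is_graph [simp]: "A \<in> Ob C \<Longrightarrow> is_graph C (const_graph C A)"
  by (rule is_graphI) simp_all

lemma prj_is_gmap:
  assumes [simp]: "is_graph C X" "is_graph C Y"
  shows "is_gmap C (prl Gr X Y)" "is_gmap C (prr Gr X Y)"
  by (auto intro!: is_gmapI simp: cross_def)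

lemma pair_is_gmap:
  assumes [simp]: "is_gmap C f" "is_gmap C g" "gsrc f = gsrc g"
  shows "is_gmap C \<lparr>gsrc = gsrc g, gtgt = prd_graph C (gtgt f) (gtgt g),
    emap = pair C (emap f) (emap g), vmap = pair C (vmap f) (vmap g)\<rparr>"
  using is_gmap_natural[of C f] is_gmap_natural[of C g] by (intro is_gmapI) simp_all

lemma Graph_terminal: "is_terminal Gr (one Gr)"
  unfolding is_terminal_def
proof (intro conjI ballI)
  fix X assume "X \<in> Ob Gr"
  hence [simp]: "is_graph C X" by simp
  let ?b = "\<lparr>gsrc = X, gtgt = const_graph C (one C), emap = bang C (edges X), vmap = bang C (verts X)\<rparr>"
  have "is_gmap C ?b" by (intro is_gmapI) simp_all
  hence "?b \<in> hom Gr X (one Gr)" by (simp add: hom_def)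
  moreover have "f = ?b" if "f \<in> hom Gr X (one Gr)" for f
    using that bang_unique[of "emap f"] bang_unique[of "vmap f"]
    by (intro gmap_eqI) (auto simp: hom_def)
  ultimately show "\<exists>!f. f \<in> hom Gr X (one Gr)" by blast
qed simp

lemma Graph_product:
  assumes "X \<in> Ob Gr" "Y \<in> Ob Gr"
  shows "is_product Gr X Y (prd Gr X Y) (prl Gr X Y) (prr Gr X Y)"
  unfolding is_product_def
proof (intro conjI allI ballI)
  have [simp]: "is_graph C X" "is_graph C Y" using assms by simp_all
  show "prl Gr X Y \<in> hom Gr (prd Gr X Y) X"
    "prr Gr X Y \<in> hom Gr (prd Gr X Y) Y"
    using prj_is_gmap[of X Y] by (simp_all add: hom_def)
  fix Z f g
  assume fg: "f \<in> hom Gr Z X" "g \<in> hom Gr Z Y"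
  let ?h = "\<lparr>gsrc = gsrc g, gtgt = prd_graph C (gtgt f) (gtgt g),
    emap = pair C (emap f) (emap g), vmap = pair C (vmap f) (vmap g)\<rparr>"
  have "?h \<in> hom Gr Z (prd Gr X Y) \<and> prl Gr X Y \<cdot>\<^bsub>Gr\<^esub> ?h = f \<and>
      prr Gr X Y \<cdot>\<^bsub>Gr\<^esub> ?h = g"
    using fg pair_is_gmap[of f g] by (auto simp: hom_def intro!: gmap_eqI)
  moreover have "h = ?h" if h: "h \<in> hom Gr Z (prd Gr X Y) \<and>
      prl Gr X Y \<cdot>\<^bsub>Gr\<^esub> h = f \<and> prr Gr X Y \<cdot>\<^bsub>Gr\<^esub> h = g" for h
  proof -
    have k [simp]: "is_gmap C h" "gsrc h = gsrc g" "gtgt h = prd_graph C X Y" "gtgt f = X" "gtgt g = Y"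
      using h fg by (simp_all add: hom_def)
    have fg_eq: "f = prl Gr X Y \<cdot>\<^bsub>Gr\<^esub> h" "g = prr Gr X Y \<cdot>\<^bsub>Gr\<^esub> h"
      using h by blast+
    have c: "emap f = prl C (edges X) (edges Y) \<cdot> emap h" "emap g = prr C (edges X) (edges Y) \<cdot> emap h"
      "vmap f = prl C (verts X) (verts Y) \<cdot> vmap h" "vmap g = prr C (verts X) (verts Y) \<cdot> vmap h"
      using fg_eq(1)[THEN arg_cong[of _ _ emap]] fg_eq(2)[THEN arg_cong[of _ _ emap]]
        fg_eq(1)[THEN arg_cong[of _ _ vmap]] fg_eq(2)[THEN arg_cong[of _ _ vmap]]
      by simp_all
    show ?thesis by (intro gmap_eqI) (simp_all add: c)
  qed
  ultimately show "\<exists>!h. h \<in> hom Gr Z (prd Gr X Y) \<and>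
      prl Gr X Y \<cdot>\<^bsub>Gr\<^esub> h = f \<and> prr Gr X Y \<cdot>\<^bsub>Gr\<^esub> h = g"
    by (rule ex1I[of _ ?h])
qed

lemma Graph_equaliser:
  assumes "parallel Gr f g"
  shows "is_equaliser Gr f g (eqz Gr f g)"
proof -
  have fg [simp]: "is_gmap C f" "is_gmap C g" "gsrc g = gsrc f" "gtgt g = gtgt f"
    using assms by (simp_all add: parallel_def hom_def)
  let ?e = "eqz C (emap f) (emap g)" and ?v = "eqz C (vmap f) (vmap g)"
  have e: "?e \<in> Ar C" "Cod C ?e = edges (gsrc f)" "emap f \<cdot> ?e = emap g \<cdot> ?e"
    by (rule eqz_props[of "emap f" "emap g", simplified])+
  have v: "?v \<in> Ar C" "Cod C ?v = verts (gsrc f)" "vmap f \<cdot> ?v = vmap g \<cdot> ?v"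
    by (rule eqz_props[of "vmap f" "vmap g", simplified])+
  let ?l = "\<lambda>d. eqlift C (vmap f) (vmap g) (d (gsrc f) \<cdot> ?e)"
  have lift: "?l d \<in> Ar C \<and> Dom C (?l d) = Dom C ?e \<and> Cod C (?l d) = Dom C ?v \<and> ?v \<cdot> ?l d = d (gsrc f) \<cdot> ?e"
    if d: "\<And>X. is_graph C X \<Longrightarrow> d X \<in> Ar C \<and> Dom C (d X) = edges X \<and> Cod C (d X) = verts X"
      "\<And>f. is_gmap C f \<Longrightarrow> d (gtgt f) \<cdot> emap f = vmap f \<cdot> d (gsrc f)" for d
  proof -
    have "vmap f \<cdot> d (gsrc f) \<cdot> ?e = d (gtgt f) \<cdot> emap f \<cdot> ?e"
      using d(1) d(2)[of f, symmetric] e(1,2) by (intro comp_eq_precomp) simp_all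
    also have "\<dots> = d (gtgt g) \<cdot> emap g \<cdot> ?e" using e(3) by simp
    also have "\<dots> = vmap g \<cdot> d (gsrc g) \<cdot> ?e"
      using d(1) d(2)[of g] e(1,2) by (intro comp_eq_precomp) simp_all
    finally show ?thesis
      using eqlift_props[of "vmap f" "vmap g" "d (gsrc f) \<cdot> ?e"] d(1) e(1,2) by simp
  qed
  have l0: "?l d0 \<in> Ar C \<and> Dom C (?l d0) = Dom C ?e \<and> Cod C (?l d0) = Dom C ?v \<and> ?v \<cdot> ?l d0 = d0 (gsrc f) \<cdot> ?e"
    by (rule lift) (simp_all add: is_gmap_natural)
  have l1: "?l d1 \<in> Ar C \<and> Dom C (?l d1) = Dom C ?e \<and> Cod C (?l d1) = Dom C ?v \<and> ?v \<cdot> ?l d1 = d1 (gsrc f) \<cdot> ?e"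
    by (rule lift) (simp_all add: is_gmap_natural)
  have E: "edges (eqz_graph C f g) = Dom C ?e" "verts (eqz_graph C f g) = Dom C ?v"
    "d0 (eqz_graph C f g) = eqlift C (vmap f) (vmap g) (d0 (gsrc f) \<cdot> ?e)"
    "d1 (eqz_graph C f g) = eqlift C (vmap f) (vmap g) (d1 (gsrc f) \<cdot> ?e)"
    by (simp_all add: eqz_graph_def Let_def)
  have Eg: "is_graph C (eqz_graph C f g)"
    by (rule is_graphI) (use l0 l1 Dom_Ob[OF e(1)] Dom_Ob[OF v(1)] in \<open>simp_all add: E\<close>)
  have eg: "is_gmap C (eqz Gr f g)"
    using Eg l0 l1 e v by (auto intro!: is_gmapI simp: E is_gmap_natural)
  show ?thesis
    unfolding is_equaliser_def
  proof (intro conjI ballI impI)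
    show "f \<cdot>\<^bsub>Gr\<^esub> eqz Gr f g = g \<cdot>\<^bsub>Gr\<^esub> eqz Gr f g"
      using e v by simp
    fix h
    assume hA: "h \<in> Ar Gr" and
      "Cod Gr h = Dom Gr f \<and> f \<cdot>\<^bsub>Gr\<^esub> h = g \<cdot>\<^bsub>Gr\<^esub> h"
    hence h [simp]: "is_gmap C h" "gtgt h = gsrc f"
      and hh: "emap f \<cdot> emap h = emap g \<cdot> emap h" "vmap f \<cdot> vmap h = vmap g \<cdot> vmap h" by simp_all
    let ?ke = "eqlift C (emap f) (emap g) (emap h)" and ?kv = "eqlift C (vmap f) (vmap g) (vmap h)"
    have ke: "?ke \<in> Ar C" "Dom C ?ke = edges (gsrc h)" "Cod C ?ke = Dom C ?e" "?e \<cdot> ?ke = emap h"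
      using eqlift_props[of "emap f" "emap g" "emap h"] hh(1) by simp_all
    have kv: "?kv \<in> Ar C" "Dom C ?kv = verts (gsrc h)" "Cod C ?kv = Dom C ?v" "?v \<cdot> ?kv = vmap h"
      using eqlift_props[of "vmap f" "vmap g" "vmap h"] hh(2) by simp_all
    have nat: "?l d \<cdot> ?ke = ?kv \<cdot> d (gsrc h)"
      if d: "\<And>X. is_graph C X \<Longrightarrow> d X \<in> Ar C \<and> Dom C (d X) = edges X \<and> Cod C (d X) = verts X"
        "\<And>f. is_gmap C f \<Longrightarrow> d (gtgt f) \<cdot> emap f = vmap f \<cdot> d (gsrc f)" for d
    proof -
      note l = lift[of d, OF d]
      have "?v \<cdot> ?l d = d (gsrc f) \<cdot> ?e" using l by blast
      hence "?v \<cdot> ?l d \<cdot> ?ke = d (gsrc f) \<cdot> ?e \<cdot> ?ke"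
        by (rule comp_eq_precomp) (use l v(1) e(1,2) ke(1-3) d(1) in simp_all)
      also have "\<dots> = d (gtgt h) \<cdot> emap h"
        by (simp add: ke(4))
      also have "\<dots> = (?v \<cdot> ?kv) \<cdot> d (gsrc h)" unfolding kv(4) by (rule d(2)) simp
      also have "\<dots> = ?v \<cdot> ?kv \<cdot> d (gsrc h)" using v(1) kv(1-3) d(1) by simp
      finally have "?v \<cdot> ?l d \<cdot> ?ke = ?v \<cdot> ?kv \<cdot> d (gsrc h)" .
      with _ _ _ _ _ _ _ _ show ?thesis
        by (rule eqz_mono[of "vmap f" "vmap g"]) (use l ke(1-3) kv(1-3) d(1) in simp_all)
    qed
    let ?k = "\<lparr>gsrc = gsrc h, gtgt = eqz_graph C f g, emap = ?ke, vmap = ?kv\<rparr>"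
    have "is_gmap C ?k"
      using Eg ke(1-3) kv(1-3) nat[of d0] nat[of d1]
      by (intro is_gmapI) (simp_all add: E is_gmap_natural)
    hence "?k \<in> hom Gr (Dom Gr h) (Dom Gr (eqz Gr f g)) \<and>
        eqz Gr f g \<cdot>\<^bsub>Gr\<^esub> ?k = h"
      using ke(4) kv(4) by (auto simp: hom_def intro!: gmap_eqI)
    moreover have "k = ?k" if "k \<in> hom Gr (Dom Gr h) (Dom Gr (eqz Gr f g)) \<and>
        eqz Gr f g \<cdot>\<^bsub>Gr\<^esub> k = h" for k
    proof -
      from that have k: "is_gmap C k" "gsrc k = gsrc h" "gtgt k = eqz_graph C f g"
        "?e \<cdot> emap k = emap h" "?v \<cdot> vmap k = vmap h" by (auto simp: hom_def)
      have "emap k = ?ke"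
        by (rule eqz_mono[of "emap f" "emap g"]) (use k ke E in simp_all)
      moreover have "vmap k = ?kv"
        by (rule eqz_mono[of "vmap f" "vmap g"]) (use k kv E in simp_all)
      ultimately show ?thesis using k by (intro gmap_eqI) simp_all
    qed
    ultimately show "\<exists>!k. k \<in> hom Gr (Dom Gr h) (Dom Gr (eqz Gr f g)) \<and>
        eqz Gr f g \<cdot>\<^bsub>Gr\<^esub> k = h"
      by (rule ex1I[of _ ?k])
  qed (use assms eg in simp_all)
qed

lemma Graph_finite_limits: "finite_limits Gr"
proof -
  interpret D: category Gr by (rule Graph_category)
  show ?thesis
    by unfold_locales (rule Graph_terminal Graph_product Graph_equaliser; assumption)+
qed

lemma edges_limit_functor: "limit_functor Gr C edges emap"
  and verts_limit_functor: "limit_functor Gr C verts vmap"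
proof -
  interpret D: finite_limits Gr by (rule Graph_finite_limits)
  show "limit_functor Gr C edges emap" "limit_functor Gr C verts vmap"
    by unfold_locales (auto simp: is_functor_def hom_def)
qed

lemma Graph_products_preserve_coequalisers:
  assumes "has_coequalisers C" "products_preserve_coequalisers C"
  shows "products_preserve_coequalisers Gr"
  unfolding products_preserve_coequalisers_def
proof (intro ballI allI impI)
  interpret D: finite_limits Gr by (rule Graph_finite_limits)
  interpret E: limit_functor Gr C edges emap by (rule edges_limit_functor)
  interpret V: limit_functor Gr C verts vmap by (rule verts_limit_functor)
  fix A f g q
  assume A: "A \<in> Ob Gr" and coeq: "is_coequaliser Gr f g q"
  let ?I = "Idt Gr A"
  note c = D.coequaliser_typing[OF coeq] Graph_coequaliserE[OF assms(1) coeq]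
  have x: "emap (cross Gr ?I h) = cross C (Idt C (edges A)) (emap h)"
      "vmap (cross Gr ?I h) = cross C (Idt C (verts A)) (vmap h)"
      "is_gmap C (cross Gr ?I h)" "gsrc (cross Gr ?I h) = prd_graph C A (gsrc h)"
      "gtgt (cross Gr ?I h) = prd_graph C A (gtgt h)"
    if "h \<in> Ar Gr" for h
    using that A E.Fa_cross[of ?I h] V.Fa_cross[of ?I h] D.cross_typing[of ?I h] D.Idt_typing[OF A]
    by simp_all
  show "is_coequaliser Gr (cross Gr ?I f) (cross Gr ?I g) (cross Gr ?I q)"
    using assms(2) A c unfolding products_preserve_coequalisers_def
    by (intro Graph_coequaliserI) (simp_all only: x, simp_all)
qed

lemma Graph_OST:
  assumes "has_coequalisers C" "OST C"
  shows "OST Gr"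
proof -
  interpret D: finite_limits Gr by (rule Graph_finite_limits)
  interpret E: limit_functor Gr C edges emap by (rule edges_limit_functor)
  interpret V: limit_functor Gr C verts vmap by (rule verts_limit_functor)
  show ?thesis
    unfolding OST_def Let_def
  proof (intro allI impI conjI; elim conjE)
    fix G X a
    assume G: "group_object Gr G" and a: "action Gr G X a"
    note [simp] = D.group_object_typing[OF G] D.action_typing[OF a]
    have par: "parallel Gr a (prr Gr (carr G) X)"
      unfolding parallel_def hom_def using D.prd_typing[of "carr G" X] by (simp del: Graph_simps)
    thus "\<exists>q. is_quotient Gr (carr G) X a q"
      using Graph_has_coequalisers[OF assms(1)] unfolding has_coequalisers_def is_quotient_def by blast
    fix q s
    assume q: "is_quotient Gr (carr G) X a q" and s: "is_section Gr s q"
    note q' = D.coequaliser_typing[OF q[unfolded is_quotient_def]]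
    have qX: "q \<in> Ar Gr" "Dom Gr q = X" using q' by (simp_all del: Graph_simps)
    have s': "s \<in> Ar Gr" "Dom Gr s = Cod Gr q" "Cod Gr s = X"
      using s qX by (auto simp: is_section_def hom_def simp del: Graph_simps)
    have prr: "emap (prr Gr (carr G) X) = prr C (edges (carr G)) (edges X)"
      "vmap (prr Gr (carr G) X) = prr C (verts (carr G)) (verts X)" by simp_all
    have quot: "is_quotient C (edges (carr G)) (edges X) (emap a) (emap q)"
      "is_quotient C (verts (carr G)) (verts X) (vmap a) (vmap q)"
      using Graph_coequaliserE[OF assms(1) q[unfolded is_quotient_def]]
      unfolding is_quotient_def prr by blast+
    let ?c = "stab_map Gr (carr G) X a"
    have [simp]: "?c \<in> Ar Gr" "Cod Gr ?c = X"
      "Dom Gr ?c = Dom Gr (stab_incl Gr (carr G) X a)"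
      "stab_incl Gr (carr G) X a \<in> Ar Gr"
      "Cod Gr (stab_incl Gr (carr G) X a) = prd Gr (carr G) X"
      using D.eqz_props[of a "prr Gr (carr G) X"]
      by (simp_all add: stab_map_def stab_incl_def del: Graph_simps)
    note E_coeq = E.image_OST[OF assms(2) G a qX s quot(1)]
      and V_coeq = V.image_OST[OF assms(2) G a qX s quot(2)]
    show "is_coequaliser Gr (cross Gr (Idt Gr (carr G)) (pbr Gr ?c s))
     (cross Gr (mul G) q \<cdot>\<^bsub>Gr\<^esub>
      assoc Gr (carr G) (carr G) X \<cdot>\<^bsub>Gr\<^esub>
      cross Gr (Idt Gr (carr G)) (stab_incl Gr (carr G) X a) \<cdot>\<^bsub>Gr\<^esub>
      cross Gr (Idt Gr (carr G)) (pbl Gr ?c s))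
     (a \<cdot>\<^bsub>Gr\<^esub> cross Gr (Idt Gr (carr G)) s)"
      by (rule Graph_coequaliserI') (rule E_coeq V_coeq | use qX s' in \<open>simp del: Graph_simps\<close>)+
  qed
qed

end

section \<open>Constant graphs and connectedness\<close>

declare Graph_simps [simp del]

lemma const_grp_simps [simp]:
  "carr (const_grp C G) = const_graph C (carr G)" "mul (const_grp C G) = const_gmap C (mul G)"
  "inverse_map (const_grp C G) = const_gmap C (inverse_map G)"
  "unit_map (const_grp C G) = const_gmap C (unit_map G)"
  by (simp_all add: const_grp_def)

lemma const_gmap_simps [simp]: "emap (const_gmap C f) = f" "vmap (const_gmap C f) = f"
  by (simp_all add: const_gmap_def)

context finite_products
begin

lemma cross_Idt [simp]:
  "\<lbrakk>A \<in> Ob C; B \<in> Ob C\<rbrakk> \<Longrightarrow> cross C (Idt C A) (Idt C B) = Idt C (prd C A B)"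
  by (simp add: cross_def)

text \<open>
  If the quotient map of an object with a point factors through the terminal object, the quotient is
  itself terminal.
\<close>

lemma coequaliser_bang:
  assumes r: "is_coequaliser C f g r" and k: "k \<in> Ar C" "Dom C k = one C" "r = k \<cdot> bang C (Cod C f)"
    and e: "e \<in> Ar C" "Dom C e = one C" "Cod C e = Cod C f"
  shows "is_coequaliser C f g (bang C (Cod C f))"
proof -
  note [simp] = coequaliser_typing(1-6)[OF r] k(1,2) e
  show ?thesis
  proof (rule coequaliserI)
    fix h
    assume h: "h \<in> Ar C" "Dom C h = Cod C f" "h \<cdot> f = h \<cdot> g"
    have c: "Cod C k = Cod C r" using k(3) by simp
    obtain h' where h': "h' \<in> Ar C" "Dom C h' = Cod C r" "Cod C h' = Cod C h" "h' \<cdot> r = h"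
      using coequaliser_lift[OF r h] .
    have "h' \<cdot> k \<cdot> bang C (Cod C f) = h" using h'(4) unfolding k(3) .
    thus "\<exists>k\<in>Ar C. Dom C k = Cod C (bang C (Cod C f)) \<and> Cod C k = Cod C h \<and> k \<cdot> bang C (Cod C f) = h"
      using h'(1-3) c by (intro bexI[of _ "h' \<cdot> k"]) simp_all
  next
    fix u v
    assume uv: "u \<in> Ar C" "v \<in> Ar C" "Dom C u = Cod C (bang C (Cod C f))"
      "Dom C v = Cod C (bang C (Cod C f))" "u \<cdot> bang C (Cod C f) = v \<cdot> bang C (Cod C f)"
    have "u \<cdot> bang C (Cod C f) \<cdot> e = v \<cdot> bang C (Cod C f) \<cdot> e"
      by (rule comp_eq_precomp[OF uv(5)]) (use uv(1-4) in simp_all)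
    thus "u = v" using uv(1-4) by simp
  qed simp_all
qed

lemma connected_constant:
  assumes "connected C X" "is_graph C X" "h \<in> Ar C" "Dom C h = verts X" "h \<cdot> d0 X = h \<cdot> d1 X"
  obtains k where "k \<in> Ar C" "Dom C k = one C" "Cod C k = Cod C h" "h = k \<cdot> bang C (verts X)"
proof -
  obtain l where l: "is_coequaliser C (d0 X) (d1 X) l" "is_terminal C (Cod C l)"
    using assms(1) unfolding connected_def by blast
  note [simp] = coequaliser_typing(3,6)[OF l(1)] is_graph_typing[OF assms(2)]
  obtain i where i [simp]: "i \<in> Ar C" "Dom C i = one C" "Cod C i = Cod C l"
    using l(2) unfolding is_terminal_def hom_def by (metis (mono_tags, lifting) mem_Collect_eq one_Ob)
  have "\<exists>!f. f \<in> hom C (verts X) (Cod C l)" using l(2) unfolding is_terminal_def by simp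
  moreover have "l \<in> hom C (verts X) (Cod C l)" "i \<cdot> bang C (verts X) \<in> hom C (verts X) (Cod C l)"
    by (simp_all add: hom_def)
  ultimately have il: "l = i \<cdot> bang C (verts X)" by blast
  have h: "Dom C h = Cod C (d0 X)" using assms(4) by simp
  obtain k where k: "k \<in> Ar C" "Dom C k = Cod C l" "Cod C k = Cod C h" "k \<cdot> l = h"
    using coequaliser_lift[OF l(1) assms(3) h assms(5)] .
  have e: "h = (k \<cdot> i) \<cdot> bang C (verts X)" using k(1,2) k(4)[symmetric] unfolding il by simp
  show ?thesis by (rule that[OF _ _ _ e]) (use k(1-3) in simp_all)
qed

text \<open>
  The projection \<open>A \<times> X \<rightarrow> A\<close> becomes the coequaliser of \<open>A \<times> d0\<close> and \<open>A \<times> d1\<close> on vertices. It need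
  not be epi on edges, so only maps between constant graphs can be compared in this way.
\<close>

lemma connected_prl_epi:
  assumes ppc: "products_preserve_coequalisers C" and "connected C X" "is_graph C X"
    and uv: "u \<in> Ar C" "v \<in> Ar C" "Dom C u = A" "Dom C v = A"
      "u \<cdot> prl C A (verts X) = v \<cdot> prl C A (verts X)"
  shows "u = v"
proof -
  obtain l where l: "is_coequaliser C (d0 X) (d1 X) l" "is_terminal C (Cod C l)"
    using assms(2) unfolding connected_def by blast
  have A [simp]: "A \<in> Ob C" using uv(1,3) by auto
  note [simp] = coequaliser_typing(3,6)[OF l(1)] is_graph_typing[OF assms(3)]
  have coeq: "is_coequaliser C (cross C (Idt C A) (d0 X)) (cross C (Idt C A) (d1 X)) (cross C (Idt C A) l)"
    using ppc l(1) A unfolding products_preserve_coequalisers_def by blast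
  have "(u \<cdot> prl C A (Cod C l)) \<cdot> cross C (Idt C A) l = (v \<cdot> prl C A (Cod C l)) \<cdot> cross C (Idt C A) l"
    using uv by (simp add: cross_def)
  with _ _ _ _ have *: "u \<cdot> prl C A (Cod C l) = v \<cdot> prl C A (Cod C l)"
    by (rule coequaliser_epi[OF coeq]) (use uv(1-4) in simp_all)
  obtain i where i [simp]: "i \<in> Ar C" "Dom C i = A" "Cod C i = Cod C l"
    using l(2) A unfolding is_terminal_def hom_def by (metis (mono_tags, lifting) mem_Collect_eq)
  have "u \<cdot> prl C A (Cod C l) \<cdot> pair C (Idt C A) i = v \<cdot> prl C A (Cod C l) \<cdot> pair C (Idt C A) i"
    by (rule comp_eq_precomp[OF *]) (use uv(1-4) in simp_all)
  thus ?thesis using uv(1-4) by simp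
qed

end

context finite_limits
begin

lemma Graph_eqI:
  assumes "f \<in> Ar Gr" "g \<in> Ar Gr" "Dom Gr f = Dom Gr g"
    "Cod Gr f = Cod Gr g" "emap f = emap g" "vmap f = vmap g"
  shows "f = g"
  using assms by (intro gmap_eqI) (simp_all add: Graph_simps)

lemma const_graph_Ob: "A \<in> Ob C \<Longrightarrow> const_graph C A \<in> Ob Gr"
  by (simp add: Graph_simps)

lemma const_gmap_typing:
  assumes "f \<in> Ar C"
  shows "const_gmap C f \<in> Ar Gr" "Dom Gr (const_gmap C f) = const_graph C (Dom C f)"
    "Cod Gr (const_gmap C f) = const_graph C (Cod C f)"
  using assms by (auto simp: Graph_simps const_gmap_def intro!: is_gmapI)

lemma prd_const_graph:
  "\<lbrakk>A \<in> Ob C; B \<in> Ob C\<rbrakk>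
    \<Longrightarrow> prd Gr (const_graph C A) (const_graph C B) = const_graph C (prd C A B)"
  by (simp add: Graph_simps prd_graph_def const_graph_def)

lemma one_Graph: "one Gr = const_graph C (one C)"
  by (simp add: Graph_simps)

lemma const_group_object:
  assumes "group_object C G"
  shows "group_object Gr (const_grp C G)"
proof -
  interpret D: finite_limits Gr by (rule Graph_finite_limits)
  interpret E: limit_functor Gr C edges emap by (rule edges_limit_functor)
  interpret V: limit_functor Gr C verts vmap by (rule verts_limit_functor)
  note [simp] = assms const_gmap_typing const_graph_Ob prd_const_graph one_Graph
  have *: "mul G \<cdot> cross C (mul G) (Idt C (carr G)) \<cdot> assoc C (carr G) (carr G) (carr G)
      = mul G \<cdot> cross C (Idt C (carr G)) (mul G)"
    using assms unfolding group_object_def Let_def by blast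
  note i = mul_inverse[OF assms, of "Idt C (carr G)"]
  show ?thesis
    unfolding group_object_def Let_def const_grp_simps
    by (intro conjI; (rule Graph_eqI)?) (use i in \<open>simp_all add: hom_def *\<close>)
qed

lemma const_group_hom:
  assumes "(P, f, G) \<in> Ar (Grp C)"
  shows "(const_grp C P, const_gmap C f, const_grp C G) \<in> Ar (Grp Gr)"
proof -
  interpret D: finite_limits Gr by (rule Graph_finite_limits)
  interpret E: limit_functor Gr C edges emap by (rule edges_limit_functor)
  interpret V: limit_functor Gr C verts vmap by (rule verts_limit_functor)
  note [simp] = group_hom_typing[OF assms] const_gmap_typing const_graph_Ob prd_const_graph one_Graph
    const_group_object
  have *: "f \<cdot> mul P = mul G \<cdot> cross C f f" using assms by (simp add: Grp_Ar)
  show ?thesis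
    unfolding D.Grp_Ar const_grp_simps
    by (intro conjI; (rule Graph_eqI)?) (simp_all add: hom_def *)
qed

lemma G_graph_action:
  assumes "group_object C G" "G_graph C G X aE aV"
  shows "action Gr (const_grp C G) X (action_gmap C G X aE aV)"
proof -
  interpret D: finite_limits Gr by (rule Graph_finite_limits)
  interpret E: limit_functor Gr C edges emap by (rule edges_limit_functor)
  interpret V: limit_functor Gr C verts vmap by (rule verts_limit_functor)
  have X: "is_graph C X" "action C G (edges X) aE" "action C G (verts X) aV"
    "d0 X \<cdot> aE = aV \<cdot> cross C (Idt C (carr G)) (d0 X)" "d1 X \<cdot> aE = aV \<cdot> cross C (Idt C (carr G)) (d1 X)"
    using assms(2) unfolding G_graph_def by blast+
  note [simp] = X(1) assms(1) action_typing[OF X(2)] action_typing[OF X(3)]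
  let ?a = "action_gmap C G X aE aV"
  have "is_gmap C ?a"
    unfolding action_gmap_def by (intro is_gmapI) (simp_all add: X(4,5))
  hence a [simp]: "?a \<in> Ar Gr" "Cod Gr ?a = X" "emap ?a = aE" "vmap ?a = aV"
    "Dom Gr ?a = prd Gr (const_graph C (carr G)) X" "X \<in> Ob Gr"
    by (simp_all add: Graph_simps action_gmap_def)
  note [simp] = const_gmap_typing const_graph_Ob one_Graph prd_const_graph
  have *: "aE \<cdot> pair C (unit_map G \<cdot> bang C (edges X)) (Idt C (edges X)) = Idt C (edges X)"
    "aE \<cdot> cross C (mul G) (Idt C (edges X)) \<cdot> assoc C (carr G) (carr G) (edges X)
       = aE \<cdot> cross C (Idt C (carr G)) aE"
    "aV \<cdot> pair C (unit_map G \<cdot> bang C (verts X)) (Idt C (verts X)) = Idt C (verts X)"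
    "aV \<cdot> cross C (mul G) (Idt C (verts X)) \<cdot> assoc C (carr G) (carr G) (verts X)
       = aV \<cdot> cross C (Idt C (carr G)) aV"
    using X(2,3) unfolding action_def by blast+
  show ?thesis
    unfolding action_def const_grp_simps
    by (intro conjI; (rule Graph_eqI)?) (simp_all add: hom_def *)
qed

lemma const_kernel_incl:
  assumes "(P, f, G) \<in> Ar (Grp C)"
  shows "kernel_incl Gr (const_grp C P, const_gmap C f, const_grp C G)
    = const_gmap C (kernel_incl C (P, f, G))"
proof -
  interpret D: finite_limits Gr by (rule Graph_finite_limits)
  interpret E: limit_functor Gr C edges emap by (rule edges_limit_functor)
  interpret V: limit_functor Gr C verts vmap by (rule verts_limit_functor)
  note [simp] = group_hom_typing[OF assms] const_gmap_typing const_graph_Ob prd_const_graph one_Graph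
    const_group_object
  let ?e = "unit_map G \<cdot> bang C (carr P)"
  have e: "unit_map (const_grp C G) \<cdot>\<^bsub>Gr\<^esub> bang Gr (carr (const_grp C P)) = const_gmap C ?e"
    unfolding const_grp_simps by (rule Graph_eqI) simp_all
  have k: "eqz C f ?e \<in> Ar C" "Cod C (eqz C f ?e) = carr P"
    using eqz_props[of f ?e] by simp_all
  have "eqz_graph C (const_gmap C f) (const_gmap C ?e) = const_graph C (Dom C (eqz C f ?e))"
  proof -
    have "eqlift C f ?e (eqz C f ?e) = Idt C (Dom C (eqz C f ?e))"
      by (rule eqz_mono[of f ?e])
        (use k eqz_props[of f ?e] eqlift_props[of f ?e "eqz C f ?e"] in simp_all)
    thus ?thesis
      using k by (simp add: eqz_graph_def const_graph_def Let_def const_gmap_def)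
  qed
  thus ?thesis
    unfolding kernel_incl_def prod.case e using k
    by (simp add: Graph_simps const_gmap_def)
qed

end

section \<open>Sections and isomorphisms\<close>

text \<open>
  The comparison map in the category of graphs, for groups that come from \<open>C\<close> and a connected graph
  \<open>X\<close>.
\<close>

locale graph_comparison = finite_limits C +
  D: comparison "Graph C" "const_grp C G" X a q s "const_grp C P" "const_gmap C \<phi>" n t \<Phi>
  for C :: "('o, 'm, 'z) lcat_scheme" (structure) and G X a q s P \<phi> n t \<Phi> +
  assumes coequalisers: "has_coequalisers C"
    and products_preserve: "products_preserve_coequalisers C"
    and OST: "OST C"
    and hom: "(P, \<phi>, G) \<in> Ar (Grp C)"
    and X_connected: "connected C X"
begin

sublocale E: limit_functor Gr C edges emap by (rule edges_limit_functor)
sublocale V: limit_functor Gr C verts vmap by (rule verts_limit_functor)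

lemmas const_rules [simp] = group_hom_typing[OF hom] const_gmap_typing const_graph_Ob
  prd_const_graph one_Graph const_group_object

lemma X_graph [simp]: "is_graph C X"
  using D.action_rules(1) by (simp add: Graph_simps)

text \<open>
  Into a constant graph, a map has the same component on edges and vertices, so its vertex component
  coequalises \<open>d0\<close> and \<open>d1\<close>.
\<close>

lemma constant_target:
  assumes "f \<in> Ar Gr" "Dom Gr f = Y" "Cod Gr f = const_graph C B" "connected C Y"
  obtains k where "k \<in> Ar C" "Dom C k = one C" "Cod C k = B" "vmap f = k \<cdot> bang C (verts Y)"
proof -
  have f: "is_gmap C f" "gsrc f = Y" "gtgt f = const_graph C B"
    using assms(1-3) by (simp_all add: Graph_simps)
  have v: "is_graph C Y" "vmap f \<in> Ar C" "Dom C (vmap f) = verts Y" "Cod C (vmap f) = B"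
    "emap f \<in> Ar C" "Cod C (emap f) = B"
    using is_gmap_typing[OF f(1)] f(2,3) by simp_all
  have "vmap f \<cdot> d0 Y = vmap f \<cdot> d1 Y"
    using is_gmap_natural[OF f(1)] v(5,6) unfolding f(2,3) by simp
  from connected_constant[OF assms(4) v(1-3) this] that v(4) show ?thesis by metis
qed

text \<open>
  The map \<open>g s(y) \<mapsto> [g\<inverse>]\<close> from \<open>X\<close> to the cosets of the image of \<open>\<phi>\<close> is constant because \<open>X\<close> is
  connected; as it reaches every coset there is only one.
\<close>

lemma transitive:
  "is_quotient C (carr P) (carr G) (mul G \<cdot> cross C \<phi> (Idt C (carr G))) (bang C (carr G))"
proof -
  let ?A = "carr G" and ?m = "mul G \<cdot> cross C \<phi> (Idt C (carr G))"
  have "parallel C ?m (prr C (carr P) ?A)" by (simp add: parallel_def hom_def)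
  then obtain r where r: "is_coequaliser C ?m (prr C (carr P) ?A) r"
    using coequalisers unfolding has_coequalisers_def by blast
  note [simp] = coequaliser_typing(3,6)[OF r, simplified]
  have r_inv: "r \<cdot> mul G \<cdot> cross C \<phi> (Idt C ?A) = r \<cdot> prr C (carr P) ?A"
    using coequaliser_typing(7)[OF r] .
  have r'_inv: "const_gmap C r \<cdot>\<^bsub>Gr\<^esub> mul (const_grp C G) \<cdot>\<^bsub>Gr\<^esub>
      cross Gr (const_gmap C \<phi>) (Idt Gr (carr (const_grp C G)))
    = const_gmap C r \<cdot>\<^bsub>Gr\<^esub> prr Gr (carr (const_grp C P)) (carr (const_grp C G))"
    by (rule Graph_eqI) (simp_all add: r_inv)
  obtain F where F: "F \<in> Ar Gr" "Dom Gr F = X" "Cod Gr F = const_graph C (Cod C r)"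
    "\<And>g y. \<lbrakk>g \<in> Ar Gr; y \<in> Ar Gr; Dom Gr g = Dom Gr y;
        Cod Gr g = carr (const_grp C G); Cod Gr y = Cod Gr q\<rbrakk>
      \<Longrightarrow> F \<cdot>\<^bsub>Gr\<^esub> a \<cdot>\<^bsub>Gr\<^esub> pair Gr g (s \<cdot>\<^bsub>Gr\<^esub> y)
        = const_gmap C r \<cdot>\<^bsub>Gr\<^esub> inverse_map (const_grp C G) \<cdot>\<^bsub>Gr\<^esub> g"
    by (rule D.invariant_extends[OF _ _ r'_inv]) simp_all
  obtain k where k: "k \<in> Ar C" "Dom C k = one C" "Cod C k = Cod C r" "vmap F = k \<cdot> bang C (verts X)"
    using constant_target[OF F(1-3) X_connected] .
  let ?A' = "const_graph C ?A"
  \<comment> \<open>The generic element \<open>g s(q x)\<close> is indexed by \<open>G \<times> X\<close> rather than \<open>G \<times> Q\<close>, so that the projection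
    to \<open>G\<close> can be cancelled by connectedness of \<open>X\<close>.\<close>
  let ?w = "a \<cdot>\<^bsub>Gr\<^esub> pair Gr (prl Gr ?A' X)
      (s \<cdot>\<^bsub>Gr\<^esub> q \<cdot>\<^bsub>Gr\<^esub> prr Gr ?A' X)"
  have w: "?w \<in> Ar Gr" "Dom Gr ?w = prd Gr ?A' X" "Cod Gr ?w = X"
    by simp_all
  have "F \<cdot>\<^bsub>Gr\<^esub> ?w = const_gmap C r \<cdot>\<^bsub>Gr\<^esub> inverse_map (const_grp C G) \<cdot>\<^bsub>Gr\<^esub> prl Gr ?A' X"
    by (rule F(4)) simp_all
  hence "vmap (F \<cdot>\<^bsub>Gr\<^esub> ?w)
      = vmap (const_gmap C r \<cdot>\<^bsub>Gr\<^esub> inverse_map (const_grp C G) \<cdot>\<^bsub>Gr\<^esub> prl Gr ?A' X)"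
    by (rule arg_cong)
  also have "vmap (const_gmap C r \<cdot>\<^bsub>Gr\<^esub> inverse_map (const_grp C G) \<cdot>\<^bsub>Gr\<^esub> prl Gr ?A' X)
      = (r \<cdot> inverse_map G) \<cdot> prl C ?A (verts X)"
    by simp
  also have "vmap (F \<cdot>\<^bsub>Gr\<^esub> ?w) = vmap F \<cdot> vmap ?w"
    by (rule V.Fa_comp) (use F(1-3) w in simp_all)
  also have "\<dots> = (k \<cdot> bang C ?A) \<cdot> prl C ?A (verts X)"
    unfolding k(4) using k(1-3) V.Fa_typing[OF w(1)] w(2,3) by simp
  finally have "(k \<cdot> bang C ?A) \<cdot> prl C ?A (verts X) = (r \<cdot> inverse_map G) \<cdot> prl C ?A (verts X)" .
  with _ _ _ _ have kr: "k \<cdot> bang C ?A = r \<cdot> inverse_map G"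
    by (rule connected_prl_epi[OF products_preserve X_connected X_graph]) (use k(1-3) in simp_all)
  have "r = r \<cdot> inverse_map G \<cdot> inverse_map G"
    using inverse_inverse[of G "Idt C ?A"] by simp
  also have "\<dots> = k \<cdot> bang C ?A \<cdot> inverse_map G"
    by (rule comp_eq_precomp[OF kr[symmetric]]) (use k(1-3) in simp_all)
  also have "\<dots> = k \<cdot> bang C ?A" by simp
  finally have "r = k \<cdot> bang C (Cod C ?m)" by simp
  from coequaliser_bang[OF r k(1,2) this, of "unit_map G"] show ?thesis
    unfolding is_quotient_def by simp
qed

sublocale D: transitive_comparison Gr "const_grp C G" X a q s "const_grp C P" "const_gmap C \<phi>" n t \<Phi>
proof
  have emap: "is_coequaliser C (mul G \<cdot> cross C \<phi> (Idt C (carr G))) (prr C (carr P) (carr G)) (bang C (carr G))"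
    using transitive unfolding is_quotient_def .
  show "is_quotient Gr (carr (const_grp C P)) (carr (const_grp C G))
     (mul (const_grp C G) \<cdot>\<^bsub>Gr\<^esub>
      cross Gr (const_gmap C \<phi>) (Idt Gr (carr (const_grp C G))))
     (bang Gr (carr (const_grp C G)))"
    unfolding is_quotient_def
    by (rule Graph_coequaliserI') (use emap in simp_all)
qed

text \<open>
  The isomorphism \<open>K \<times> X \<cong> T\<close> turns the projection to \<open>K\<close> into a map from the connected graph \<open>T\<close> to
  a constant graph. It is therefore a point \<open>c\<close> of \<open>K\<close>, and cancelling the projection from \<open>K \<times> X\<close> leaves
  the identity of \<open>K\<close> equal to the constant map with value \<open>c\<close>.
\<close>

lemma hom_iso_if_section:
  assumes T_connected: "connected C (Cod Gr t)"
    and free: "free_action Gr (const_graph C (Dom C (kernel_incl C (P, \<phi>, G)))) (Cod Gr t)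
       (D.act \<cdot>\<^bsub>Gr\<^esub> cross Gr (const_gmap C (kernel_incl C (P, \<phi>, G))) (Idt Gr (Cod Gr t)))"
    and \<sigma>: "is_section Gr \<sigma> \<Phi>"
  shows "is_iso C \<phi>"
proof -
  let ?k = "kernel_incl C (P, \<phi>, G)"
  let ?K = "Dom C ?k"
  note [simp] = kernel_incl_typing[OF hom]
  have K_const: "D.ker = const_gmap C ?k" by (rule const_kernel_incl[OF hom])
  have dom_ker: "Dom Gr D.ker = const_graph C ?K" unfolding K_const by simp
  obtain K where K: "carr K = Dom Gr D.ker" "(K, D.ker, const_grp C P) \<in> Ar (Grp Gr)"
    using D.kernel_group_object[OF D.hom] by blast
  let ?K' = "const_graph C ?K"
  let ?psi = "(D.act \<cdot>\<^bsub>Gr\<^esub> cross Gr D.ker (Idt Gr D.T)) \<cdot>\<^bsub>Gr\<^esub> cross Gr (Idt Gr ?K') \<sigma>"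
  have "is_iso Gr ?psi"
    using D.section_splits[OF K _ \<sigma>] free unfolding dom_ker K_const by simp
  then obtain r where r: "?psi \<in> Ar Gr" "r \<in> Ar Gr" "Dom Gr r = Cod Gr ?psi"
    "Cod Gr r = Dom Gr ?psi" "r \<cdot>\<^bsub>Gr\<^esub> ?psi = Idt Gr (Dom Gr ?psi)"
    by (rule D.is_isoE)
  have \<sigma>': "\<sigma> \<in> Ar Gr" "Dom Gr \<sigma> = X" "Cod Gr \<sigma> = D.T"
    using \<sigma> unfolding is_section_def hom_def by simp_all
  have psi: "Dom Gr ?psi = prd Gr ?K' X" "Cod Gr ?psi = D.T"
    using \<sigma>' dom_ker D.hom_rules by simp_all
  define \<psi> where "\<psi> = ?psi"
  note r = r[unfolded psi, folded \<psi>_def] and psi = psi[folded \<psi>_def]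
  let ?f = "prl Gr ?K' X \<cdot>\<^bsub>Gr\<^esub> r"
  have f: "?f \<in> Ar Gr" "Dom Gr ?f = D.T" "Cod Gr ?f = ?K'"
    using r(2-4) by simp_all
  obtain c where c: "c \<in> Ar C" "Dom C c = one C" "Cod C c = ?K" "vmap ?f = c \<cdot> bang C (verts D.T)"
    using constant_target[OF f T_connected] .
  have "?f \<cdot>\<^bsub>Gr\<^esub> \<psi> = prl Gr ?K' X"
    using r psi by simp
  hence "vmap (?f \<cdot>\<^bsub>Gr\<^esub> \<psi>) = prl C ?K (verts X)" by simp
  moreover have "vmap (?f \<cdot>\<^bsub>Gr\<^esub> \<psi>) = vmap ?f \<cdot> vmap \<psi>"
    by (rule V.Fa_comp) (use f r(1) psi in simp_all)
  moreover have "\<dots> = (c \<cdot> bang C ?K) \<cdot> prl C ?K (verts X)"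
    unfolding c(4) using c(1-3) V.Fa_typing[OF r(1)] psi by simp
  ultimately have "Idt C ?K \<cdot> prl C ?K (verts X) = (c \<cdot> bang C ?K) \<cdot> prl C ?K (verts X)" by simp
  with _ _ _ _ have Kc: "Idt C ?K = c \<cdot> bang C ?K"
    by (rule connected_prl_epi[OF products_preserve X_connected X_graph]) (use c(1-3) in simp_all)
  have "\<phi> \<cdot> unit_map P = unit_map G \<cdot> bang C (Dom C (unit_map P))"
    using group_hom_one[OF hom, of "one C"] by simp
  then obtain u where u: "u \<in> Ar C" "Dom C u = one C" "Cod C u = ?K" "?k \<cdot> u = unit_map P"
    using kernel_element[OF hom, of "unit_map P"] by auto
  \<comment> \<open>The only point of \<open>K\<close> is the unit, so the inclusion of \<open>K\<close> is the trivial map.\<close>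
  have "u = (c \<cdot> bang C ?K) \<cdot> u" using u(1-3) by (simp flip: Kc)
  hence "u = c" using u(1-3) c(1-3) by simp
  hence kc: "?k \<cdot> c = unit_map P" using u(4) by simp
  have "?k = ?k \<cdot> c \<cdot> bang C ?K" unfolding Kc[symmetric] by simp
  also have "\<dots> = (?k \<cdot> c) \<cdot> bang C ?K" using c(1-3) by simp
  also have "\<dots> = unit_map P \<cdot> bang C ?K" unfolding kc ..
  finally have "?k = unit_map P \<cdot> bang C ?K" .
  thus ?thesis by (rule transitive_trivial_kernel_iso[OF OST hom transitive])
qed

end

lemma Grp_hom_iff: "u \<in> hom (Grp C) G H \<longleftrightarrow> (\<exists>f. u = (G, f, H) \<and> (G, f, H) \<in> Ar (Grp C))"
  by (cases u) (auto simp: Grp_def hom_def)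

lemma (in finite_limits) const_gmap_iso:
  assumes "is_iso C f"
  shows "is_iso Gr (const_gmap C f)"
proof -
  interpret D: finite_limits Gr by (rule Graph_finite_limits)
  interpret E: limit_functor Gr C edges emap by (rule edges_limit_functor)
  interpret V: limit_functor Gr C verts vmap by (rule verts_limit_functor)
  obtain g where g: "f \<in> Ar C" "g \<in> Ar C" "Dom C g = Cod C f" "Cod C g = Dom C f"
    "g \<cdot> f = Idt C (Dom C f)" "f \<cdot> g = Idt C (Cod C f)"
    using assms by (rule is_isoE)
  note [simp] = g(1-4) const_gmap_typing const_graph_Ob
  show ?thesis
  proof (rule D.is_isoI[of _ "const_gmap C g"])
    show "const_gmap C g \<cdot>\<^bsub>Gr\<^esub> const_gmap C f = Idt Gr (Dom Gr (const_gmap C f))"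
      "const_gmap C f \<cdot>\<^bsub>Gr\<^esub> const_gmap C g = Idt Gr (Cod Gr (const_gmap C f))"
      by (rule Graph_eqI; simp add: g(5,6))+
  qed simp_all
qed

lemma (in finite_products) group_hom_iso:
  assumes hom: "(P, f, G) \<in> Ar (Grp C)" and iso: "is_iso C f"
  shows "is_iso (Grp C) (P, f, G)"
proof -
  note [simp] = group_hom_typing[OF hom]
  obtain g where g: "g \<in> Ar C" "Dom C g = carr G" "Cod C g = carr P"
    "g \<cdot> f = Idt C (carr P)" "f \<cdot> g = Idt C (carr G)"
    using iso by (rule is_isoE) simp
  have gf: "g \<cdot> f \<cdot> x = x" if "x \<in> Ar C" "Cod C x = carr P" for x
  proof -
    have "(g \<cdot> f) \<cdot> x = Idt C (carr P) \<cdot> x" by (simp only: g)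
    thus ?thesis using that g(1-3) by simp
  qed
  have fg: "f \<cdot> g \<cdot> x = x" if "x \<in> Ar C" "Cod C x = carr G" for x
  proof -
    have "(f \<cdot> g) \<cdot> x = Idt C (carr G) \<cdot> x" by (simp only: g)
    thus ?thesis using that g(1-3) by simp
  qed
  have "g \<cdot> mul G = mul P \<cdot> cross C g g"
  proof (rule prd_extensionality[of _ _ "carr G" "carr G"])
    fix x y
    assume xy: "x \<in> Ar C" "y \<in> Ar C" "Dom C x = Dom C y" "Cod C x = carr G" "Cod C y = carr G"
    have "g \<cdot> mul G \<cdot> pair C x y = g \<cdot> f \<cdot> mul P \<cdot> pair C (g \<cdot> x) (g \<cdot> y)"
      using xy g(1-3) by (simp add: group_hom_mul[OF hom] fg)
    also have "\<dots> = mul P \<cdot> pair C (g \<cdot> x) (g \<cdot> y)"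
      using xy g(1-3) by (intro gf) simp_all
    finally show "(g \<cdot> mul G) \<cdot> pair C x y = (mul P \<cdot> cross C g g) \<cdot> pair C x y"
      using xy g(1-3) by simp
  qed (use g(1-3) in simp_all)
  hence "(G, g, P) \<in> Ar (Grp C)" using g(1-3) by (simp add: Grp_Ar hom_def)
  thus ?thesis
    using hom g(4,5) unfolding is_iso_def
    by (intro conjI bexI[of _ "(G, g, P)"]) (simp_all add: Grp_def hom_def)
qed

theorem theorem4p14:
  fixes C :: "('o, 'm) lcat"
    and G \<pi> :: "('o, 'm) grp"
    and X Q T :: "('o, 'm) graph"
    and aE aV :: 'm
    and a q s t \<Phi> :: "('o, 'm) gmap"
    and colim :: "('o, 'm) slice_grp \<Rightarrow> ('o, 'm) grp"
    and colim_map :: "('o, 'm) slice_grp_map \<Rightarrow> ('o, 'm) grp \<times> 'm \<times> ('o, 'm) grp"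
    and \<eta> :: "('o, 'm) slice_grp \<Rightarrow> ('o, 'm) slice_grp_map"
    and S :: "('o, 'm) slice_grp"
    and \<phi> :: "('o, 'm) grp \<times> 'm \<times> ('o, 'm) grp"
  assumes "finite_limits C"
    and "has_coequalisers C"
    and "products_preserve_coequalisers C"
    and "OST C"
    and "group_object C G"
    and "G_graph C G X aE aV"
    and "a = action_gmap C G X aE aV"
    and "connected C X"
    and "is_quotient (Graph C) (const_graph C (carr G)) X a q"
    and "Q = Cod (Graph C) q"
    and "is_section (Graph C) s q"
    and "left_adjoint (Grp (slice (Graph C) Q)) (Grp C) colim colim_map
           (Delta C Q) (Delta_map C Q) \<eta>"
    and "S = section_stab C G X a s"
    and "\<pi> = colim S"
    and "is_standard_graph C Q S \<pi> (\<eta> S) t"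
    and "T = Cod (Graph C) t"
    and "\<phi> = (THE f. f \<in> hom (Grp C) \<pi> G \<and>
           Delta_map C Q f \<cdot>\<^bsub>Grp (slice (Graph C) Q)\<^esub> \<eta> S = stab_to_Delta C G X a q s)"
    and "\<Phi> = standard_to C X a q s \<phi> t"
    and "connected C T"
    and "free_action (Graph C) (const_graph C (Dom C (kernel_incl C \<phi>))) T
           (standard_action C Q \<pi> t \<cdot>\<^bsub>Graph C\<^esub>
              cross (Graph C) (const_gmap C (kernel_incl C \<phi>)) (Idt (Graph C) T))"
  shows "((\<exists>\<sigma>. is_section (Graph C) \<sigma> \<Phi>) \<longleftrightarrow> is_iso (Graph C) \<Phi>) \<and>
         (is_iso (Graph C) \<Phi> \<longleftrightarrow> is_iso C (mid \<phi>)) \<and>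
         (is_iso C (mid \<phi>) \<longrightarrow> is_iso (Grp C) \<phi>)"
proof -
  interpret finite_limits C by (rule assms(1))
  interpret D: finite_limits "Graph C" by (rule Graph_finite_limits)
  let ?G = "const_grp C G"
  interpret D: fixed_section "Graph C" ?G X a q s
  proof
    show "OST (Graph C)" by (rule Graph_OST[OF assms(2,4)])
    show "group_object (Graph C) ?G" by (rule const_group_object[OF assms(5)])
    show "action (Graph C) ?G X a" unfolding assms(7) by (rule G_graph_action[OF assms(5,6)])
    show "is_quotient (Graph C) (carr ?G) X a q" using assms(9) by simp
  qed (rule assms(11))
  have Q: "Cod (Graph C) q = Q" by (rule assms(10)[symmetric])
  interpret L: finite_products "slice (Graph C) Q"
    by (rule D.slice_finite_products) (use D.qs_typing(6) Q in simp)
  have colim_functor: "is_functor (Grp (slice (Graph C) Q)) (Grp C) colim colim_map"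
    and Delta_functor: "is_functor (Grp C) (Grp (slice (Graph C) Q)) (Delta C Q) (Delta_map C Q)"
    and unit: "\<forall>H \<in> Ob (Grp (slice (Graph C) Q)).
      \<eta> H \<in> hom (Grp (slice (Graph C) Q)) H (Delta C Q (colim H))"
    and universal: "\<forall>H \<in> Ob (Grp (slice (Graph C) Q)). \<forall>K \<in> Ob (Grp C).
      \<forall>g \<in> hom (Grp (slice (Graph C) Q)) H (Delta C Q K).
        \<exists>!f. f \<in> hom (Grp C) (colim H) K \<and> Delta_map C Q f \<cdot>\<^bsub>Grp (slice (Graph C) Q)\<^esub> \<eta> H = g"
    using assms(12) unfolding left_adjoint_def by - (elim conjE, assumption)+
  have Delta_group: "Delta C Q H \<in> Ob (Grp (slice (Graph C) Q))" if "group_object C H" for H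
    using conjunct1[OF Delta_functor[unfolded is_functor_def]] that by (simp add: Grp_def)
  from Delta_group[OF assms(5)] have "group_object (slice (Graph C) Q) (times_grp (Graph C) Q ?G)"
    by (simp add: Grp_def Delta_def)
  \<comment> \<open>Only now is the pulled back stabiliser known to be in the domain of the left adjoint, so that
    \<open>\<phi>\<close> is well defined.\<close>
  note embedding = D.section_stab_in_Delta[unfolded Q, OF this]
  have S: "S = pullback_grp (Graph C) s (stab_grp (Graph C) ?G X a)"
    unfolding assms(13) section_stab_def ..
  have sD: "stab_to_Delta C G X a q s
      = (S, (carr S, D.to_Delta, carr (Delta C Q G)), Delta C Q G)"
    unfolding stab_to_Delta_def Let_def S section_stab_def Q by simp
  have sD_hom: "stab_to_Delta C G X a q s \<in> hom (Grp (slice (Graph C) Q)) S (Delta C Q G)"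
    using embedding unfolding sD S[symmetric] Delta_def hom_def by (simp add: Grp_def)
  have S_Ob: "S \<in> Ob (Grp (slice (Graph C) Q))"
    using embedding unfolding S[symmetric] by (simp add: Grp_def)
  have pi: "\<pi> \<in> Ob (Grp C)"
    using bspec[OF conjunct1[OF colim_functor[unfolded is_functor_def]] S_Ob] unfolding assms(14) by blast
  have eta: "\<eta> S \<in> hom (Grp (slice (Graph C) Q)) S (Delta C Q \<pi>)"
    using bspec[OF unit S_Ob] unfolding assms(14) .
  have "\<exists>!f. f \<in> hom (Grp C) \<pi> G \<and>
      Delta_map C Q f \<cdot>\<^bsub>Grp (slice (Graph C) Q)\<^esub> \<eta> S = stab_to_Delta C G X a q s"
    unfolding assms(14)
    by (rule universal[rule_format, OF S_Ob _ sD_hom]) (use assms(5) in \<open>simp add: Grp_def\<close>)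
  from theI'[OF this] have phi: "\<phi> \<in> hom (Grp C) \<pi> G"
    "Delta_map C Q \<phi> \<cdot>\<^bsub>Grp (slice (Graph C) Q)\<^esub> \<eta> S = stab_to_Delta C G X a q s"
    unfolding assms(17)[symmetric] by blast+
  define f where "f = mid \<phi>"
  have \<phi>: "\<phi> = (\<pi>, f, G)" and hom: "(\<pi>, f, G) \<in> Ar (Grp C)"
    using phi(1) unfolding f_def mid_def Grp_hom_iff by auto
  let ?P = "const_grp C \<pi>"
  define n where "n = mid (mid (\<eta> S))"
  have eta_eq: "\<eta> S = (S, (carr S, n, carr (Delta C Q \<pi>)), Delta C Q \<pi>)"
    and eta_slice: "(carr S, n, carr (Delta C Q \<pi>)) \<in> hom (slice (Graph C) Q) (carr S) (carr (Delta C Q \<pi>))"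
  proof -
    obtain u where u: "\<eta> S = (S, u, Delta C Q \<pi>)"
      "u \<in> hom (slice (Graph C) Q) (carr S) (carr (Delta C Q \<pi>))"
      using eta unfolding Grp_hom_iff L.Grp_Ar by blast
    have "u = (carr S, n, carr (Delta C Q \<pi>))"
      using u(2) unfolding slice_hom_iff n_def u(1) mid_def by (elim exE) simp
    with u show "\<eta> S = (S, (carr S, n, carr (Delta C Q \<pi>)), Delta C Q \<pi>)"
      "(carr S, n, carr (Delta C Q \<pi>)) \<in> hom (slice (Graph C) Q) (carr S) (carr (Delta C Q \<pi>))"
      by simp_all
  qed
  have carr_S: "carr S = D.base"
    unfolding S by (simp add: pullback_grp_def stab_grp_def Let_def)
  have carr_D: "carr (Delta C Q H) = prr (Graph C) (carr (const_grp C H)) Q" for H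
    by (simp add: Delta_def times_grp_def Let_def)
  have n: "n \<in> Ar (Graph C)" "Dom (Graph C) n = D.fibre"
    "Cod (Graph C) n = prd (Graph C) (carr ?P) Q" "prr (Graph C) (carr ?P) Q \<cdot>\<^bsub>Graph C\<^esub> n = D.base"
  proof -
    have Ob: "carr ?P \<in> Ob (Graph C)" "Q \<in> Ob (Graph C)"
      using group_hom_typing(1)[OF hom] D.qs_typing(6) Q const_graph_Ob by simp_all
    have N: "n \<in> Ar (Graph C)" "Dom (Graph C) n = Dom (Graph C) D.base"
      "Cod (Graph C) n = Dom (Graph C) (prr (Graph C) (carr ?P) Q)"
      "prr (Graph C) (carr ?P) Q \<cdot>\<^bsub>Graph C\<^esub> n = D.base"
      using eta_slice unfolding slice_hom_iff carr_S carr_D by blast+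
    show "n \<in> Ar (Graph C)" "prr (Graph C) (carr ?P) Q \<cdot>\<^bsub>Graph C\<^esub> n = D.base"
      by (rule N)+
    show "Dom (Graph C) n = D.fibre" by (rule trans[OF N(2) D.fibre_typing(2)])
    show "Cod (Graph C) n = prd (Graph C) (carr ?P) Q" by (rule trans[OF N(3) D.prd_typing(5)[OF Ob]])
  qed
  have hom_D: "(?P, const_gmap C f, ?G) \<in> Ar (Grp (Graph C))"
    by (rule const_group_hom[OF hom])
  note hom_D_typing = D.group_hom_typing[OF hom_D]
  have to_Delta: "cross (Graph C) (const_gmap C f) (Idt (Graph C) Q) \<cdot>\<^bsub>Graph C\<^esub> n = D.to_Delta"
    using phi(2) unfolding \<phi> eta_eq sD Delta_map_def
    by (simp add: Grp_def times_grp_map_def slice_simps)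
  interpret D: labelled_section "Graph C" ?G X a q s ?P "const_gmap C f" n t
  proof
    show "products_preserve_coequalisers (Graph C)"
      by (rule Graph_products_preserve_coequalisers[OF assms(2,3)])
    show "is_coequaliser (Graph C)
       (cross (Graph C) (Idt (Graph C) (carr ?P)) D.base)
       (cross (Graph C) (mul ?P) (Idt (Graph C) D.Q) \<cdot>\<^bsub>Graph C\<^esub>
        assoc (Graph C) (carr ?P) (carr ?P) D.Q \<cdot>\<^bsub>Graph C\<^esub>
        cross (Graph C) (Idt (Graph C) (carr ?P)) n) t"
      using assms(15) unfolding is_standard_graph_def Let_def carr_S n_def[symmetric] Q const_grp_simps .
    have *: "Q \<in> Ob (Graph C)" using D.qs_typing(6) Q by simp
    have "const_gmap C f \<cdot>\<^bsub>Graph C\<^esub> prl (Graph C) (carr ?P) Q \<cdot>\<^bsub>Graph C\<^esub> n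
        = prl (Graph C) (carr ?G) Q \<cdot>\<^bsub>Graph C\<^esub> cross (Graph C) (const_gmap C f) (Idt (Graph C) Q) \<cdot>\<^bsub>Graph C\<^esub> n"
      using hom_D_typing n(1,3) * by (simp add: cross_def del: const_grp_simps)
    also have "\<dots> = prl (Graph C) (carr ?G) Q \<cdot>\<^bsub>Graph C\<^esub> D.to_Delta" unfolding to_Delta ..
    also have "\<dots> = D.grp_part"
      unfolding Q[symmetric] by (simp add: cross_def del: const_grp_simps)
    finally show "const_gmap C f \<cdot>\<^bsub>Graph C\<^esub> prl (Graph C) (carr ?P) D.Q \<cdot>\<^bsub>Graph C\<^esub> n = D.grp_part"
      unfolding Q .
  qed (use n hom_D in \<open>simp_all only: Q\<close>)
  have Phi: "\<Phi> \<in> hom (Graph C) D.T X \<and> \<Phi> \<cdot>\<^bsub>Graph C\<^esub> t = (a \<cdot>\<^bsub>Graph C\<^esub> cross (Graph C) (Idt (Graph C) (carr ?G)) s) \<cdot>\<^bsub>Graph C\<^esub>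
      cross (Graph C) (const_gmap C f) (Idt (Graph C) D.Q)"
    using theI'[OF D.comparison_map_ex1]
    unfolding assms(18) standard_to_def \<phi> prod.case Let_def Q const_grp_simps .
  interpret graph_comparison C G X a q s \<pi> f n t \<Phi>
    by unfold_locales (use Phi assms(2-4,8) hom in auto)
  have act: "D.act = standard_action C Q \<pi> t"
    unfolding D.act_def standard_action_def Let_def Q const_grp_simps ..
  have iii: "is_iso C f" if "is_section (Graph C) \<sigma> \<Phi>" for \<sigma>
    using hom_iso_if_section[OF _ _ that] assms(19,20) unfolding act \<phi> assms(16) by blast
  have ii: "is_iso (Graph C) \<Phi>" if "is_iso C f"
    by (rule D.iso_if_hom_iso[OF const_gmap_iso[OF that]])
  have i: "\<exists>\<sigma>. is_section (Graph C) \<sigma> \<Phi>" if "is_iso (Graph C) \<Phi>"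
    using that unfolding is_iso_def is_section_def by blast
  have "mid \<phi> = f" by (simp add: f_def)
  moreover have "is_iso (Grp C) \<phi>" if "is_iso C f"
    unfolding \<phi> by (rule group_hom_iso[OF hom that])
  ultimately show ?thesis using i ii iii by auto
qed

end
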